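(* (Logarithmic Artin–Rees) Let $\mathbf m\in\mathbb N^l$, let $\mathcal M$ be a finitely generated $\mathcal A^R_{Y,D}$-module and let $\mathcal N\subseteq\mathcal M$ be an $\mathcal A^R_{Y,D}$-submodule. Then there exists $n_0\in\mathbb Z_{\ge0}$ such that $$\alpha(\mathbf m)^n\cdot\mathcal M\cap\mathcal N\subseteq\alpha(\mathbf m)^{n-n_0}\,\mathcal N\qquad\text{for all }n\ge n_0.$$
   Context: $X$ is an irreducible smooth affine complex variety, $R$ a regular commutative finite-type $\mathbb C$-algebra domain, $Y=X\times\mathbb A^l_{\mathbb C}$ with coordinates $t_1,\dots,t_l$ on the second factor, $D=(\prod_i t_i=0)$. $\mathcal D_X$ is the ring of algebraic differential operators on $X$; $\mathcal D_{Y,D}=\mathcal D_X[t_1,\dots,t_l]\langle t_1\partial_{t_1},\dots,t_l\partial_{t_l}\rangle\subseteq\mathcal D_Y$ is the ring of logarithmic differential operators; $\mathcal A^R_{Y,D}=\mathcal D_{Y,D}\otimes_{\mathbb C}R$. For $\mathbf m=(m_1,\dots,m_l)\in\mathbb N^l$, $\alpha(\mathbf m)=\prod_i t_i^{m_i}$. One has $\alpha(\mathbf m)\mathcal A^R_{Y,D}=\mathcal A^R_{Y,D}\alpha(\mathbf m)$, so $\alpha(\mathbf m)^n\mathcal M$ is a submodule of $\mathcal M$. *)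

theory Defs
  imports
    "HOL-Analysis.Analysis"
    "HOL-Algebra.Algebra"
    "HOL-Algebra.Algebraic_Closure_Type"
begin

text \<open>Frees the name \<open>X\<close>, which HOL-Algebra uses for the polynomial variable.\<close>

no_notation var (\<open>X\<index>\<close>)

section \<open>Algebras over the complex numbers\<close>

text \<open>A \<open>\<complex>\<close>-algebra is a ring \<open>A\<close> with a structure map \<open>\<phi>\<close> from \<open>\<complex>\<close> to the centre of \<open>A\<close>;
  \<open>A\<close> need not be commutative.\<close>

definition complex_algebra :: "('a, 'z) ring_scheme \<Rightarrow> (complex \<Rightarrow> 'a) \<Rightarrow> bool" where
  "complex_algebra A \<phi> \<longleftrightarrow>
     ring A \<and> \<phi> \<in> ring_hom ring_of_type_algebra A \<and>
     (\<forall>c. \<forall>a\<in>carrier A. \<phi> c \<otimes>\<^bsub>A\<^esub> a = a \<otimes>\<^bsub>A\<^esub> \<phi> c)"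

definition finite_type :: "('a, 'z) ring_scheme \<Rightarrow> (complex \<Rightarrow> 'a) \<Rightarrow> bool" where
  "finite_type A \<phi> \<longleftrightarrow>
     (\<exists>F \<subseteq> carrier A. finite F \<and> carrier A = generate_ring A (range \<phi> \<union> F))"


section \<open>Regular rings\<close>

text \<open>The localization of a commutative ring at a prime \<open>P\<close>: a fraction \<open>a / s\<close> is its class of
  pairs, and the operations are defined on classes through representatives, in the style of
  \<^const>\<open>rcoset_mult\<close>.\<close>

definition frac_class :: "('a, 'z) ring_scheme \<Rightarrow> 'a set \<Rightarrow> 'a \<Rightarrow> 'a \<Rightarrow> ('a \<times> 'a) set" where
  "frac_class A P a s =
     {(b, t). b \<in> carrier A \<and> t \<in> carrier A - P \<and>
        (\<exists>u \<in> carrier A - P. u \<otimes>\<^bsub>A\<^esub> (a \<otimes>\<^bsub>A\<^esub> t) = u \<otimes>\<^bsub>A\<^esub> (b \<otimes>\<^bsub>A\<^esub> s))}"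

definition localization :: "('a, 'z) ring_scheme \<Rightarrow> 'a set \<Rightarrow> ('a \<times> 'a) set ring" where
  "localization A P =
     \<lparr>carrier = {frac_class A P a s | a s. a \<in> carrier A \<and> s \<in> carrier A - P},
      monoid.mult = (\<lambda>x y. \<Union>(a, s)\<in>x. \<Union>(b, t)\<in>y. frac_class A P (a \<otimes>\<^bsub>A\<^esub> b) (s \<otimes>\<^bsub>A\<^esub> t)),
      one = frac_class A P \<one>\<^bsub>A\<^esub> \<one>\<^bsub>A\<^esub>,
      ring.zero = frac_class A P \<zero>\<^bsub>A\<^esub> \<one>\<^bsub>A\<^esub>,
      add = (\<lambda>x y. \<Union>(a, s)\<in>x. \<Union>(b, t)\<in>y.
               frac_class A P (a \<otimes>\<^bsub>A\<^esub> t \<oplus>\<^bsub>A\<^esub> b \<otimes>\<^bsub>A\<^esub> s) (s \<otimes>\<^bsub>A\<^esub> t))\<rparr>"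

definition prime_chain :: "('a, 'z) ring_scheme \<Rightarrow> nat \<Rightarrow> (nat \<Rightarrow> 'a set) \<Rightarrow> bool" where
  "prime_chain A d p \<longleftrightarrow> (\<forall>i\<le>d. primeideal (p i) A) \<and> (\<forall>i<d. p i \<subset> p (Suc i))"

definition has_krull_dim :: "('a, 'z) ring_scheme \<Rightarrow> nat \<Rightarrow> bool" where
  "has_krull_dim A d \<longleftrightarrow> (\<exists>p. prime_chain A d p) \<and> (\<forall>e p. prime_chain A e p \<longrightarrow> e \<le> d)"

text \<open>The maximal ideal is generated by as many elements as the Krull dimension.\<close>

definition regular_local_ring :: "('a, 'z) ring_scheme \<Rightarrow> bool" where
  "regular_local_ring A \<longleftrightarrow>
     cring A \<and> noetherian_ring A \<and>
     (\<exists>\<mm>. {I. maximalideal I A} = {\<mm>} \<and>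
        (\<exists>S \<subseteq> carrier A. finite S \<and> has_krull_dim A (card S) \<and> \<mm> = Idl\<^bsub>A\<^esub> S))"

definition regular_ring :: "('a, 'z) ring_scheme \<Rightarrow> bool" where
  "regular_ring A \<longleftrightarrow>
     cring A \<and> noetherian_ring A \<and>
     (\<forall>P. primeideal P A \<longrightarrow> regular_local_ring (localization A P))"


section \<open>Affine varieties and their coordinate rings\<close>

inductive_set poly_funs :: "('p \<Rightarrow> complex) set \<Rightarrow> ('p \<Rightarrow> complex) set"
  for G :: "('p \<Rightarrow> complex) set" where
  const: "(\<lambda>_. c) \<in> poly_funs G"
| coord: "g \<in> G \<Longrightarrow> g \<in> poly_funs G"
| add: "f \<in> poly_funs G \<Longrightarrow> g \<in> poly_funs G \<Longrightarrow> (\<lambda>p. f p + g p) \<in> poly_funs G"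
| mult: "f \<in> poly_funs G \<Longrightarrow> g \<in> poly_funs G \<Longrightarrow> (\<lambda>p. f p * g p) \<in> poly_funs G"

definition coord_ring :: "'p set \<Rightarrow> ('p \<Rightarrow> complex) set \<Rightarrow> ('p \<Rightarrow> complex) ring" where
  "coord_ring V G =
     \<lparr>carrier = (\<lambda>f. restrict f V) ` poly_funs G,
      monoid.mult = (\<lambda>f g. \<lambda>p\<in>V. f p * g p),
      one = (\<lambda>p\<in>V. 1),
      ring.zero = (\<lambda>p\<in>V. 0),
      add = (\<lambda>f g. \<lambda>p\<in>V. f p + g p)\<rparr>"

definition const_fun :: "'p set \<Rightarrow> complex \<Rightarrow> 'p \<Rightarrow> complex" where
  "const_fun V c = (\<lambda>p\<in>V. c)"

text \<open>Points of affine \<open>n\<close>-space are extensional functions on \<open>{..<n}\<close>, so \<open>n = 0\<close> is allowed.\<close>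

definition affine_space :: "nat \<Rightarrow> (nat \<Rightarrow> complex) set" where
  "affine_space n = {..<n} \<rightarrow>\<^sub>E UNIV"

definition affine_coords :: "nat \<Rightarrow> ((nat \<Rightarrow> complex) \<Rightarrow> complex) set" where
  "affine_coords n = (\<lambda>i x. x i) ` {..<n}"

definition zariski_closed :: "nat \<Rightarrow> (nat \<Rightarrow> complex) set \<Rightarrow> bool" where
  "zariski_closed n V \<longleftrightarrow>
     (\<exists>F \<subseteq> poly_funs (affine_coords n). V = {x \<in> affine_space n. \<forall>f\<in>F. f x = 0})"

definition irreducible_affine_variety :: "nat \<Rightarrow> (nat \<Rightarrow> complex) set \<Rightarrow> bool" where
  "irreducible_affine_variety n X \<longleftrightarrow>
     zariski_closed n X \<and> X \<noteq> {} \<and>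
     (\<forall>V W. zariski_closed n V \<longrightarrow> zariski_closed n W \<longrightarrow> X = V \<union> W \<longrightarrow> X = V \<or> X = W)"

abbreviation functions_on :: "nat \<Rightarrow> (nat \<Rightarrow> complex) set \<Rightarrow> ((nat \<Rightarrow> complex) \<Rightarrow> complex) ring" where
  "functions_on n X \<equiv> coord_ring X (affine_coords n)"

definition smooth_variety :: "nat \<Rightarrow> (nat \<Rightarrow> complex) set \<Rightarrow> bool" where
  "smooth_variety n X \<longleftrightarrow>
     (\<forall>x\<in>X. regular_local_ring
        (localization (functions_on n X) {f \<in> carrier (functions_on n X). f x = 0}))"


section \<open>Differential operators\<close>

definition endo_ring :: "('a, 'z) ring_scheme \<Rightarrow> (complex \<Rightarrow> 'a) \<Rightarrow> ('a \<Rightarrow> 'a) ring" where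
  "endo_ring A \<phi> =
     \<lparr>carrier = {P \<in> carrier A \<rightarrow>\<^sub>E carrier A.
        (\<forall>f\<in>carrier A. \<forall>g\<in>carrier A. P (f \<oplus>\<^bsub>A\<^esub> g) = P f \<oplus>\<^bsub>A\<^esub> P g) \<and>
        (\<forall>c. \<forall>f\<in>carrier A. P (\<phi> c \<otimes>\<^bsub>A\<^esub> f) = \<phi> c \<otimes>\<^bsub>A\<^esub> P f)},
      monoid.mult = (\<lambda>P Q. compose (carrier A) P Q),
      one = (\<lambda>f\<in>carrier A. f),
      ring.zero = (\<lambda>f\<in>carrier A. \<zero>\<^bsub>A\<^esub>),
      add = (\<lambda>P Q. \<lambda>f\<in>carrier A. P f \<oplus>\<^bsub>A\<^esub> Q f)\<rparr>"

definition mult_op :: "('a, 'z) ring_scheme \<Rightarrow> 'a \<Rightarrow> 'a \<Rightarrow> 'a" where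
  "mult_op A h = (\<lambda>f\<in>carrier A. h \<otimes>\<^bsub>A\<^esub> f)"

definition derivations :: "('a, 'z) ring_scheme \<Rightarrow> (complex \<Rightarrow> 'a) \<Rightarrow> ('a \<Rightarrow> 'a) set" where
  "derivations A \<phi> =
     {P \<in> carrier (endo_ring A \<phi>).
        \<forall>f\<in>carrier A. \<forall>g\<in>carrier A. P (f \<otimes>\<^bsub>A\<^esub> g) = f \<otimes>\<^bsub>A\<^esub> P g \<oplus>\<^bsub>A\<^esub> g \<otimes>\<^bsub>A\<^esub> P f}"

text \<open>For a smooth affine variety with coordinate ring \<open>A\<close>, the ring of algebraic differential
  operators is by definition the ring of endomorphisms of \<open>A\<close> generated by the functions, acting by
  multiplication, and the vector fields (Hotta, Takeuchi, Tanisaki, \<^emph>\<open>D-Modules, Perverse Sheaves,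
  and Representation Theory\<close>, Section 1.1). It is used below only for smooth varieties.\<close>

definition diff_ops :: "('a, 'z) ring_scheme \<Rightarrow> (complex \<Rightarrow> 'a) \<Rightarrow> ('a \<Rightarrow> 'a) ring" where
  "diff_ops A \<phi> = (endo_ring A \<phi>)
     \<lparr>carrier := generate_ring (endo_ring A \<phi>) (mult_op A ` carrier A \<union> derivations A \<phi>)\<rparr>"


section \<open>Logarithmic differential operators on \<open>X \<times> \<complex>\<^sup>l\<close>\<close>

type_synonym point = "(nat \<Rightarrow> complex) \<times> (nat \<Rightarrow> complex)"

definition product_space :: "(nat \<Rightarrow> complex) set \<Rightarrow> nat \<Rightarrow> point set" where
  "product_space X l = X \<times> affine_space l"

definition product_ring :: "nat \<Rightarrow> (nat \<Rightarrow> complex) set \<Rightarrow> nat \<Rightarrow> (point \<Rightarrow> complex) ring" where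
  "product_ring n X l = coord_ring (product_space X l)
     ((\<lambda>i p. fst p i) ` {..<n} \<union> (\<lambda>j p. snd p j) ` {..<l})"

definition t_coord :: "(nat \<Rightarrow> complex) set \<Rightarrow> nat \<Rightarrow> nat \<Rightarrow> point \<Rightarrow> complex" where
  "t_coord X l j = (\<lambda>p\<in>product_space X l. snd p j)"

text \<open>An operator \<open>P\<close> on \<open>X\<close> acts on functions of \<open>(x, t)\<close> by fixing \<open>t\<close>.\<close>

definition extend_op ::
  "nat \<Rightarrow> (nat \<Rightarrow> complex) set \<Rightarrow> nat \<Rightarrow>
   (((nat \<Rightarrow> complex) \<Rightarrow> complex) \<Rightarrow> ((nat \<Rightarrow> complex) \<Rightarrow> complex)) \<Rightarrow>
   (point \<Rightarrow> complex) \<Rightarrow> (point \<Rightarrow> complex)" where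
  "extend_op n X l P = (\<lambda>f\<in>carrier (product_ring n X l).
     \<lambda>(x, t)\<in>product_space X l. P (\<lambda>x'\<in>X. f (x', t)) x)"

definition euler_op ::
  "nat \<Rightarrow> (nat \<Rightarrow> complex) set \<Rightarrow> nat \<Rightarrow> nat \<Rightarrow> (point \<Rightarrow> complex) \<Rightarrow> (point \<Rightarrow> complex)" where
  "euler_op n X l j = (\<lambda>f\<in>carrier (product_ring n X l).
     \<lambda>(x, t)\<in>product_space X l. t j * deriv (\<lambda>s. f (x, t(j := s))) (t j))"

definition log_diff_ops ::
  "nat \<Rightarrow> (nat \<Rightarrow> complex) set \<Rightarrow> nat \<Rightarrow> ((point \<Rightarrow> complex) \<Rightarrow> (point \<Rightarrow> complex)) ring" where
  "log_diff_ops n X l =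
    (let DY = diff_ops (product_ring n X l) (const_fun (product_space X l)) in
     DY\<lparr>carrier := generate_ring DY
       (extend_op n X l ` carrier (diff_ops (functions_on n X) (const_fun X)) \<union>
        (\<lambda>j. mult_op (product_ring n X l) (t_coord X l j)) ` {..<l} \<union>
        euler_op n X l ` {..<l})\<rparr>)"

definition log_scalar ::
  "nat \<Rightarrow> (nat \<Rightarrow> complex) set \<Rightarrow> nat \<Rightarrow> complex \<Rightarrow> (point \<Rightarrow> complex) \<Rightarrow> (point \<Rightarrow> complex)" where
  "log_scalar n X l c = mult_op (product_ring n X l) (const_fun (product_space X l) c)"


section \<open>Tensor products of algebras\<close>

text \<open>The tensor product over \<open>\<complex>\<close> of \<open>(A, \<phi>)\<close> and \<open>(B, \<psi>)\<close> is the free abelian group on the pairs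
  \<open>(a, b)\<close>, with \<open>(a, b) (a', b') = (a a', b b')\<close> extended bilinearly, modulo the usual relations.
  Multiplying a relation by a pair gives a relation again, so the two-sided ideal they generate
  is just the additive subgroup they generate.\<close>

definition pair_ring ::
  "('a, 'y) ring_scheme \<Rightarrow> ('b, 'z) ring_scheme \<Rightarrow> ('a \<times> 'b \<Rightarrow>\<^sub>0 int) ring" where
  "pair_ring A B =
     \<lparr>carrier = {p. Poly_Mapping.keys p \<subseteq> carrier A \<times> carrier B},
      monoid.mult = (\<lambda>p q. frag_extend (\<lambda>(a, b). frag_extend
                (\<lambda>(a', b'). frag_of (a \<otimes>\<^bsub>A\<^esub> a', b \<otimes>\<^bsub>B\<^esub> b')) q) p),
      one = frag_of (\<one>\<^bsub>A\<^esub>, \<one>\<^bsub>B\<^esub>),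
      ring.zero = 0,
      add = (+)\<rparr>"

definition tensor_relations ::
  "('a, 'y) ring_scheme \<Rightarrow> (complex \<Rightarrow> 'a) \<Rightarrow> ('b, 'z) ring_scheme \<Rightarrow> (complex \<Rightarrow> 'b) \<Rightarrow>
   ('a \<times> 'b \<Rightarrow>\<^sub>0 int) set" where
  "tensor_relations A \<phi> B \<psi> =
     {frag_of (a \<oplus>\<^bsub>A\<^esub> a', b) - frag_of (a, b) - frag_of (a', b) | a a' b.
        a \<in> carrier A \<and> a' \<in> carrier A \<and> b \<in> carrier B} \<union>
     {frag_of (a, b \<oplus>\<^bsub>B\<^esub> b') - frag_of (a, b) - frag_of (a, b') | a b b'.
        a \<in> carrier A \<and> b \<in> carrier B \<and> b' \<in> carrier B} \<union>
     {frag_of (\<phi> c \<otimes>\<^bsub>A\<^esub> a, b) - frag_of (a, \<psi> c \<otimes>\<^bsub>B\<^esub> b) | c a b.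
        a \<in> carrier A \<and> b \<in> carrier B}"

definition tensor_ideal ::
  "('a, 'y) ring_scheme \<Rightarrow> (complex \<Rightarrow> 'a) \<Rightarrow> ('b, 'z) ring_scheme \<Rightarrow> (complex \<Rightarrow> 'b) \<Rightarrow>
   ('a \<times> 'b \<Rightarrow>\<^sub>0 int) set" where
  "tensor_ideal A \<phi> B \<psi> = Idl\<^bsub>pair_ring A B\<^esub> (tensor_relations A \<phi> B \<psi>)"

definition tensor_ring ::
  "('a, 'y) ring_scheme \<Rightarrow> (complex \<Rightarrow> 'a) \<Rightarrow> ('b, 'z) ring_scheme \<Rightarrow> (complex \<Rightarrow> 'b) \<Rightarrow>
   ('a \<times> 'b \<Rightarrow>\<^sub>0 int) set ring" where
  "tensor_ring A \<phi> B \<psi> = pair_ring A B Quot tensor_ideal A \<phi> B \<psi>"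

definition pure_tensor ::
  "('a, 'y) ring_scheme \<Rightarrow> (complex \<Rightarrow> 'a) \<Rightarrow> ('b, 'z) ring_scheme \<Rightarrow> (complex \<Rightarrow> 'b) \<Rightarrow>
   'a \<Rightarrow> 'b \<Rightarrow> ('a \<times> 'b \<Rightarrow>\<^sub>0 int) set" where
  "pure_tensor A \<phi> B \<psi> a b = tensor_ideal A \<phi> B \<psi> +>\<^bsub>pair_ring A B\<^esub> frag_of (a, b)"


section \<open>The ring \<open>\<A>\<^sup>R\<close> and the elements \<open>\<alpha>(m)\<close>\<close>

type_synonym 'r log_elem = "(((point \<Rightarrow> complex) \<Rightarrow> (point \<Rightarrow> complex)) \<times> 'r \<Rightarrow>\<^sub>0 int) set"

definition log_ring ::
  "nat \<Rightarrow> (nat \<Rightarrow> complex) set \<Rightarrow> nat \<Rightarrow> ('r, 'z) ring_scheme \<Rightarrow> (complex \<Rightarrow> 'r) \<Rightarrow> 'r log_elem ring"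
  where "log_ring n X l R \<phi> = tensor_ring (log_diff_ops n X l) (log_scalar n X l) R \<phi>"

text \<open>The monomial \<open>\<Prod>\<^sub>j t\<^sub>j ^ m\<^sub>j\<close>, as the element \<open>\<alpha>(m) \<otimes> 1\<close>; values \<open>m j\<close> with \<open>j \<ge> l\<close> are ignored.\<close>

definition log_monomial ::
  "nat \<Rightarrow> (nat \<Rightarrow> complex) set \<Rightarrow> nat \<Rightarrow> ('r, 'z) ring_scheme \<Rightarrow> (complex \<Rightarrow> 'r) \<Rightarrow> (nat \<Rightarrow> nat) \<Rightarrow>
   'r log_elem" where
  "log_monomial n X l R \<phi> m =
     pure_tensor (log_diff_ops n X l) (log_scalar n X l) R \<phi>
       (mult_op (product_ring n X l) (\<lambda>p\<in>product_space X l. \<Prod>j<l. snd p j ^ m j)) \<one>\<^bsub>R\<^esub>"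


section \<open>Left modules over noncommutative rings\<close>

text \<open>\<^locale>\<open>module\<close> requires a commutative ring of scalars; \<^locale>\<open>submodule\<close> does not.\<close>

locale left_module = R?: ring R + M?: abelian_group M
  for R :: "('a, 'y) ring_scheme" (structure) and M :: "('a, 'v, 'z) module_scheme" (structure) +
  assumes smult_closed:
      "\<lbrakk>a \<in> carrier R; x \<in> carrier M\<rbrakk> \<Longrightarrow> a \<odot>\<^bsub>M\<^esub> x \<in> carrier M"
    and smult_l_distr:
      "\<lbrakk>a \<in> carrier R; b \<in> carrier R; x \<in> carrier M\<rbrakk> \<Longrightarrow>
       (a \<oplus> b) \<odot>\<^bsub>M\<^esub> x = a \<odot>\<^bsub>M\<^esub> x \<oplus>\<^bsub>M\<^esub> b \<odot>\<^bsub>M\<^esub> x"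
    and smult_r_distr:
      "\<lbrakk>a \<in> carrier R; x \<in> carrier M; y \<in> carrier M\<rbrakk> \<Longrightarrow>
       a \<odot>\<^bsub>M\<^esub> (x \<oplus>\<^bsub>M\<^esub> y) = a \<odot>\<^bsub>M\<^esub> x \<oplus>\<^bsub>M\<^esub> a \<odot>\<^bsub>M\<^esub> y"
    and smult_assoc:
      "\<lbrakk>a \<in> carrier R; b \<in> carrier R; x \<in> carrier M\<rbrakk> \<Longrightarrow>
       (a \<otimes> b) \<odot>\<^bsub>M\<^esub> x = a \<odot>\<^bsub>M\<^esub> (b \<odot>\<^bsub>M\<^esub> x)"
    and smult_one: "x \<in> carrier M \<Longrightarrow> \<one> \<odot>\<^bsub>M\<^esub> x = x"

definition finitely_generated_module ::
  "('a, 'y) ring_scheme \<Rightarrow> ('a, 'v, 'z) module_scheme \<Rightarrow> bool" where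
  "finitely_generated_module R M \<longleftrightarrow>
     (\<exists>F \<subseteq> carrier M. finite F \<and> (\<forall>H. submodule H R M \<longrightarrow> F \<subseteq> H \<longrightarrow> H = carrier M))"

end

theory Submission
  imports Defs "HOL-Library.Multiset_Order"
begin

text \<open>Write \<open>A\<close> for the algebra, \<open>\<alpha>\<close> for the monomial, and put \<open>N\<^sub>k = \<alpha>\<^sup>k M \<inter> N\<close>. Each \<open>N\<^sub>k\<close> is stable under \<open>A\<close>,
and \<open>\<alpha>\<close> maps \<open>N\<^sub>k\<close> into \<open>N\<^sub>k\<^sub>+\<^sub>1\<close>: the sum of the \<open>N\<^sub>k\<close> is a graded module over the Rees algebra of \<open>A\<close>, in
which \<open>\<alpha>\<close> has degree one. Suppose that finitely many elements \<open>x\<^sub>i \<in> N\<^bsub>k(i)\<^esub>\<close> generate it, and let \<open>n\<^sub>0\<close> be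
the largest \<open>k(i)\<close>. The family that is \<open>N\<close> in degrees up to \<open>n\<^sub>0\<close> and \<open>\<alpha>\<^bsup>k-n\<^sub>0\<^esup> N\<close> in degree \<open>k \<ge> n\<^sub>0\<close> is
stable too, because every element of \<open>A\<close> can be moved past \<open>\<alpha>\<close>, and it contains the \<open>x\<^sub>i\<close>. Hence it
contains every \<open>N\<^sub>k\<close>, which is the assertion (\<open>artin_rees\<close>).

The finiteness is a noncommutative form of Hilbert's basis theorem, proved by leading terms. The
algebra is generated by functions, of weight zero, and vector fields, of weight one, and a commutator
of two generators is a combination of words of smaller total weight. So a word in the generators
depends, up to words of smaller weight, only on the multiset of its letters. Words applied to module
generators are therefore ordered by weight, then by multiset, then by generator, which is a well-order
compatible with prepending letters. The leading monomials of a submodule form an upward closed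
set of multisets, which is finitely generated by Dickson's lemma, and scalars form a field, so leading
terms can be cancelled (\<open>graded_noetherian\<close>). The monomial \<open>\<alpha>\<close> may be added as one
more letter of weight zero and degree one, since \<open>\<alpha>\<close> commutes with functions and is an eigenvector of the
commutator with each of the chosen vector fields: with \<open>t\<^sub>j \<partial>\<^sub>j\<close> the commutator is \<open>m\<^sub>j \<alpha>\<close>, with a vector
field of \<open>X\<close> it vanishes.

It remains to exhibit the generators. The functions are the coordinates of \<open>X\<close>, the \<open>t\<^sub>j\<close>, and
generators of \<open>R\<close>. The vector fields are the \<open>t\<^sub>j \<partial>\<^sub>j\<close> and finitely many generators of the module of
derivations of the coordinate ring of \<open>X\<close>. Those exist because a derivation is determined by its values
on the \<open>n\<close> coordinates: this embeds the derivations in a free module of rank \<open>n\<close> over the coordinate ring, and the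
basis theorem above applies to that commutative algebra (\<open>derivations_finitely_generated\<close>). The
commutator relations are identities between derivations of the functions on \<open>X \<times> \<complex>\<^sup>l\<close>; those that involve an
Euler operator are checked on coordinates. The tensor product with \<open>R\<close> enters only
through the multiplication rule and the defining relations of pure tensors.\<close>

section \<open>Dickson's lemma\<close>

text \<open>One letter at a time: a sequence of natural numbers has a monotone subsequence, and a decreasing one is
  eventually constant, so it can always be taken to be nondecreasing.\<close>

lemma dickson_subsequence:
  fixes f :: "nat \<Rightarrow> 'a multiset"
  assumes "finite A"
  shows "\<exists>r :: nat \<Rightarrow> nat. strict_mono r \<and> (\<forall>a\<in>A. mono (\<lambda>n. count (f (r n)) a))"
  using assms
proof induction
  case empty
  show ?case by (intro exI[of _ "\<lambda>n. n"]) (auto simp: strict_mono_def)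
next
  case (insert a A)
  then obtain r :: "nat \<Rightarrow> nat" where r: "strict_mono r" "\<And>b. b \<in> A \<Longrightarrow> mono (\<lambda>n. count (f (r n)) b)"
    by blast
  define g where "g n = count (f (r n)) a" for n
  obtain s where s: "strict_mono s" "monoseq (\<lambda>n. g (s n))"
    using seq_monosub by blast
  have "\<exists>k. mono (\<lambda>n. g (s (k + n)))"
  proof (cases "incseq (\<lambda>n. g (s n))")
    case True
    then show ?thesis by (auto simp: mono_def intro!: exI[of _ 0])
  next
    case False
    then have dec: "\<And>i j. i \<le> j \<Longrightarrow> g (s j) \<le> g (s i)"
      using s(2) by (auto simp: monoseq_def mono_def)
    \<comment> \<open>A decreasing sequence is constant from the place where its minimum is attained.\<close>
    define k where "k = (ARG_MIN (\<lambda>n. g (s n)) n. True)"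
    have "g (s k) \<le> g (s n)" for n
      unfolding k_def by (rule arg_min_nat_le) simp
    then have "g (s (k + n)) = g (s k)" for n
      using dec[of k "k + n"] by (simp add: eq_iff)
    then show ?thesis by (auto simp: mono_def intro!: exI[of _ k])
  qed
  then obtain k where k: "mono (\<lambda>n. g (s (k + n)))" by blast
  define r' where "r' n = r (s (k + n))" for n
  have sm: "strict_mono (\<lambda>n. s (k + n))"
    using s(1) by (simp add: strict_mono_def)
  have "strict_mono r'"
    using r(1) sm by (simp add: strict_mono_def r'_def)
  moreover have "mono (\<lambda>n. count (f (r' n)) b)" if "b \<in> insert a A" for b
  proof (cases "b = a")
    case True
    then show ?thesis using k by (simp add: g_def r'_def)
  next
    case False
    then have "mono (\<lambda>n. count (f (r n)) b)" using r(2) that by simp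
    then show ?thesis
      using strict_mono_mono[OF sm] by (simp add: mono_def r'_def)
  qed
  ultimately show ?case by blast
qed

text \<open>The minimal elements of \<open>S\<close> form an antichain, and an infinite antichain would contradict
  \<open>dickson_subsequence\<close>.\<close>

lemma dickson_finite_basis:
  fixes S :: "'a multiset set"
  assumes "finite A" and over: "\<And>M. M \<in> S \<Longrightarrow> set_mset M \<subseteq> A"
  shows "\<exists>T\<subseteq>S. finite T \<and> (\<forall>M\<in>S. \<exists>M'\<in>T. M' \<subseteq># M)"
proof -
  define T where "T = {M \<in> S. \<forall>M'\<in>S. M' \<subseteq># M \<longrightarrow> M' = M}"
  have below: "\<exists>M'\<in>T. M' \<subseteq># M" if "M \<in> S" for M
    using that
  proof (induction "size M" arbitrary: M rule: less_induct)
    case less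
    show ?case
    proof (cases "M \<in> T")
      case False
      then obtain M' where "M' \<in> S" "M' \<subset># M"
        using less.prems by (auto simp: T_def subset_mset_def)
      then show ?thesis
        using less.hyps[of M'] mset_subset_size[of M' M]
        by (meson subset_mset.order_trans subset_mset.less_imp_le)
    qed auto
  qed
  have "finite T"
  proof (rule ccontr)
    assume "infinite T"
    then obtain f :: "nat \<Rightarrow> 'a multiset" where f: "inj f" "range f \<subseteq> T"
      using infinite_countable_subset by blast
    obtain r :: "nat \<Rightarrow> nat" where r: "strict_mono r" "\<forall>a\<in>A. mono (\<lambda>n. count (f (r n)) a)"
      using dickson_subsequence[OF assms(1)] by blast
    have "count (f (r 0)) a \<le> count (f (r 1)) a" for a
    proof (cases "a \<in> A")
      case True
      then show ?thesis using r(2) by (simp add: mono_def)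
    next
      case False
      have "f (r 0) \<in> S" using f(2) by (auto simp: T_def)
      then have "a \<notin># f (r 0)" using over False by blast
      then show ?thesis by (simp add: not_in_iff)
    qed
    then have "f (r 0) \<subseteq># f (r 1)" by (simp add: subseteq_mset_def)
    moreover have "f (r 0) \<in> S" "f (r 1) \<in> T" using f(2) by (auto simp: T_def)
    ultimately have "f (r 0) = f (r 1)" by (simp add: T_def)
    then have "r 0 = r 1" using f(1) by (simp add: inj_eq)
    then show False using r(1) by (metis strict_mono_eq zero_neq_one)
  qed
  then show ?thesis using below by (intro exI[of _ T]) (auto simp: T_def)
qed

section \<open>Complex vector spaces and congruences\<close>

text \<open>An abelian group with explicit carrier and an action of the complex numbers. The same notions of span and
  congruence then apply to an algebra and to its modules, with scalars acting through the structure map.\<close>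

locale complex_space = abelian_group G for G (structure) +
  fixes sc :: "complex \<Rightarrow> 'a \<Rightarrow> 'a"
  assumes sc_closed [simp, intro]: "x \<in> carrier G \<Longrightarrow> sc c x \<in> carrier G"
    and sc_add: "\<lbrakk>x \<in> carrier G; y \<in> carrier G\<rbrakk> \<Longrightarrow> sc c (x \<oplus> y) = sc c x \<oplus> sc c y"
    and add_sc: "x \<in> carrier G \<Longrightarrow> sc (c + d) x = sc c x \<oplus> sc d x"
    and sc_sc: "x \<in> carrier G \<Longrightarrow> sc c (sc d x) = sc (c * d) x"
    and sc_one: "x \<in> carrier G \<Longrightarrow> sc 1 x = x"
begin

definition csubspace :: "'a set \<Rightarrow> bool" where
  "csubspace S \<longleftrightarrow> S \<subseteq> carrier G \<and> \<zero> \<in> S \<and> (\<forall>x\<in>S. \<forall>y\<in>S. x \<oplus> y \<in> S) \<and> (\<forall>c. \<forall>x\<in>S. sc c x \<in> S)"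

definition lin :: "'a set \<Rightarrow> 'a set" where
  "lin T = \<Inter>{S. csubspace S \<and> T \<subseteq> S}"

definition congr :: "'a set \<Rightarrow> 'a \<Rightarrow> 'a \<Rightarrow> bool" where
  "congr S x y \<longleftrightarrow> x \<in> carrier G \<and> y \<in> carrier G \<and> x \<ominus> y \<in> S"

lemma sc_zero_right: "sc c \<zero> = \<zero>"
  using sc_add[of \<zero> \<zero> c] by (simp add: add.l_cancel_one)

lemma sc_zero_left: "x \<in> carrier G \<Longrightarrow> sc 0 x = \<zero>"
  using add_sc[of x 0 0] by (simp add: add.l_cancel_one)

lemma sc_minus_one: "x \<in> carrier G \<Longrightarrow> sc (-1) x = \<ominus> x"
proof -
  assume x: "x \<in> carrier G"
  have "sc (-1) x \<oplus> x = sc (-1 + 1) x" using x by (simp only: add_sc sc_one)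
  also have "\<dots> = \<zero>" using x by (simp add: sc_zero_left)
  finally show ?thesis using x by (metis minus_equality sc_closed)
qed

lemma csubspaceI:
  assumes "S \<subseteq> carrier G" "\<zero> \<in> S" "\<And>x y. x \<in> S \<Longrightarrow> y \<in> S \<Longrightarrow> x \<oplus> y \<in> S"
    "\<And>c x. x \<in> S \<Longrightarrow> sc c x \<in> S"
  shows "csubspace S"
  using assms by (auto simp: csubspace_def)

lemma csubspaceD:
  assumes "csubspace S"
  shows "x \<in> S \<Longrightarrow> x \<in> carrier G" "\<zero> \<in> S" "x \<in> S \<Longrightarrow> y \<in> S \<Longrightarrow> x \<oplus> y \<in> S" "x \<in> S \<Longrightarrow> sc c x \<in> S"
  using assms by (auto simp: csubspace_def)

lemma csubspace_minus: "csubspace S \<Longrightarrow> x \<in> S \<Longrightarrow> \<ominus> x \<in> S"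
  using sc_minus_one csubspaceD by metis

lemma csubspace_diff: "csubspace S \<Longrightarrow> x \<in> S \<Longrightarrow> y \<in> S \<Longrightarrow> x \<ominus> y \<in> S"
  unfolding a_minus_def using csubspace_minus csubspaceD by metis

lemma csubspace_carrier: "csubspace (carrier G)"
  by (rule csubspaceI) auto

lemma csubspace_lin: "T \<subseteq> carrier G \<Longrightarrow> csubspace (lin T)"
  unfolding lin_def csubspace_def using csubspace_carrier by blast

lemma lin_superset: "T \<subseteq> lin T"
  by (auto simp: lin_def)

lemma lin_incl: "x \<in> T \<Longrightarrow> x \<in> lin T"
  using lin_superset by blast

lemma lin_least: "csubspace S \<Longrightarrow> T \<subseteq> S \<Longrightarrow> lin T \<subseteq> S"
  by (auto simp: lin_def)

lemma lin_mono: "T \<subseteq> T' \<Longrightarrow> lin T \<subseteq> lin T'"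
  by (auto simp: lin_def)

lemma lin_carrier: "T \<subseteq> carrier G \<Longrightarrow> lin T \<subseteq> carrier G"
  by (rule lin_least[OF csubspace_carrier])

lemma lin_map:
  assumes T: "T \<subseteq> carrier G"
    and closed: "\<And>x. x \<in> carrier G \<Longrightarrow> h x \<in> carrier G"
    and add: "\<And>x y. \<lbrakk>x \<in> carrier G; y \<in> carrier G\<rbrakk> \<Longrightarrow> h (x \<oplus> y) = h x \<oplus> h y"
    and sc: "\<And>c x. x \<in> carrier G \<Longrightarrow> h (sc c x) = sc c (h x)"
    and S: "csubspace S" and hT: "\<And>x. x \<in> T \<Longrightarrow> h x \<in> S"
    and x: "x \<in> lin T"
  shows "h x \<in> S"
proof -
  have "h \<zero> = \<zero>" using sc[of \<zero> 0] closed[of \<zero>] by (simp add: sc_zero_left)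
  then have "csubspace {x \<in> carrier G. h x \<in> S}"
    by (intro csubspaceI) (auto simp: add sc csubspaceD[OF S])
  then have "lin T \<subseteq> {x \<in> carrier G. h x \<in> S}"
    by (rule lin_least) (use T hT in auto)
  then show ?thesis using x by blast
qed

lemma additive_minus:
  assumes closed: "\<And>x. x \<in> carrier G \<Longrightarrow> h x \<in> carrier G"
    and add: "\<And>x y. \<lbrakk>x \<in> carrier G; y \<in> carrier G\<rbrakk> \<Longrightarrow> h (x \<oplus> y) = h x \<oplus> h y"
    and sc: "\<And>c x. x \<in> carrier G \<Longrightarrow> h (sc c x) = sc c (h x)"
    and "x \<in> carrier G" "y \<in> carrier G"
  shows "h (x \<ominus> y) = h x \<ominus> h y"
  unfolding a_minus_def using assms(4,5) by (simp add: add closed flip: sc_minus_one) (simp add: sc)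

lemma congr_refl: "csubspace S \<Longrightarrow> x \<in> carrier G \<Longrightarrow> congr S x x"
  by (simp add: congr_def csubspaceD(2) a_minus_def r_neg)

lemma congr_sym: "csubspace S \<Longrightarrow> congr S x y \<Longrightarrow> congr S y x"
proof -
  assume S: "csubspace S" and c: "congr S x y"
  then have "y \<ominus> x = \<ominus> (x \<ominus> y)"
    by (simp add: congr_def a_minus_def minus_add a_comm)
  then show ?thesis using c S csubspace_minus by (auto simp: congr_def)
qed

lemma congr_trans: "csubspace S \<Longrightarrow> congr S x y \<Longrightarrow> congr S y z \<Longrightarrow> congr S x z"
proof -
  assume S: "csubspace S" and c: "congr S x y" "congr S y z"
  then have "x \<ominus> z = (x \<ominus> y) \<oplus> (y \<ominus> z)"
    by (simp add: congr_def a_minus_def a_assoc r_neg1)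
  then show ?thesis using c S csubspaceD(3) by (auto simp: congr_def)
qed

lemma congr_add: "csubspace S \<Longrightarrow> congr S x y \<Longrightarrow> congr S x' y' \<Longrightarrow> congr S (x \<oplus> x') (y \<oplus> y')"
proof -
  assume S: "csubspace S" and c: "congr S x y" "congr S x' y'"
  then have "(x \<oplus> x') \<ominus> (y \<oplus> y') = (x \<ominus> y) \<oplus> (x' \<ominus> y')"
    by (simp add: congr_def a_minus_def minus_add a_ac)
  then show ?thesis using c S csubspaceD(3) by (auto simp: congr_def)
qed

lemma congr_map:
  assumes closed: "\<And>x. x \<in> carrier G \<Longrightarrow> h x \<in> carrier G"
    and add: "\<And>x y. \<lbrakk>x \<in> carrier G; y \<in> carrier G\<rbrakk> \<Longrightarrow> h (x \<oplus> y) = h x \<oplus> h y"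
    and sc: "\<And>c x. x \<in> carrier G \<Longrightarrow> h (sc c x) = sc c (h x)"
    and S: "\<And>s. s \<in> S \<Longrightarrow> h s \<in> S'" and c: "congr S x y"
  shows "congr S' (h x) (h y)"
proof -
  have "h (x \<ominus> y) = h x \<ominus> h y"
    by (rule additive_minus) (use assms congr_def in auto)
  then show ?thesis using c S closed by (metis congr_def)
qed

lemma congr_sc: "csubspace S \<Longrightarrow> congr S x y \<Longrightarrow> congr S (sc c x) (sc c y)"
  by (rule congr_map[where h = "sc c" and S = S])
     (auto simp: sc_add sc_sc mult.commute csubspaceD)

lemma congr_mono: "congr S x y \<Longrightarrow> S \<subseteq> S' \<Longrightarrow> congr S' x y"
  by (auto simp: congr_def)

lemma congr_zero: "csubspace S \<Longrightarrow> x \<in> S \<Longrightarrow> congr S x \<zero>"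
  using csubspace_diff[of S x \<zero>] by (simp add: congr_def csubspaceD(1,2))

end

section \<open>Operators whose commutators lower a weight\<close>

text \<open>Finitely many operators carry a weight, which filters, and a degree, which grades. A commutator is a
  combination of words of strictly smaller weight and of the same degree; in particular operators of weight zero
  commute. The vectors \<open>gen i\<close> play the role of module generators of degree zero.\<close>

locale weighted_operators = complex_space G sc for G (structure) and sc +
  fixes op :: "nat \<Rightarrow> 'a \<Rightarrow> 'a" and N :: nat and wt dg :: "nat \<Rightarrow> nat"
    and gen :: "nat \<Rightarrow> 'a" and p :: nat
  assumes op_closed [simp, intro]: "\<lbrakk>i < N; x \<in> carrier G\<rbrakk> \<Longrightarrow> op i x \<in> carrier G"
    and op_add: "\<lbrakk>i < N; x \<in> carrier G; y \<in> carrier G\<rbrakk> \<Longrightarrow> op i (x \<oplus> y) = op i x \<oplus> op i y"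
    and op_sc: "\<lbrakk>i < N; x \<in> carrier G\<rbrakk> \<Longrightarrow> op i (sc c x) = sc c (op i x)"
    and gen_closed [simp, intro]: "i < p \<Longrightarrow> gen i \<in> carrier G"
    and op_commute: "\<lbrakk>i < N; j < N; x \<in> carrier G\<rbrakk> \<Longrightarrow>
      congr (lin {foldr op w x | w. set w \<subseteq> {..<N} \<and> sum_list (map wt w) < wt i + wt j
                    \<and> sum_list (map dg w) = dg i + dg j})
        (op i (op j x)) (op j (op i x))"
begin

abbreviation weight :: "nat list \<Rightarrow> nat" where "weight w \<equiv> sum_list (map wt w)"
abbreviation deg :: "nat list \<Rightarrow> nat" where "deg w \<equiv> sum_list (map dg w)"

lemma act_closed: "set w \<subseteq> {..<N} \<Longrightarrow> x \<in> carrier G \<Longrightarrow> foldr op w x \<in> carrier G"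
  by (induction w) auto

lemma act_add: "set w \<subseteq> {..<N} \<Longrightarrow> x \<in> carrier G \<Longrightarrow> y \<in> carrier G \<Longrightarrow>
    foldr op w (x \<oplus> y) = foldr op w x \<oplus> foldr op w y"
  by (induction w) (auto simp: op_add act_closed)

lemma act_sc: "set w \<subseteq> {..<N} \<Longrightarrow> x \<in> carrier G \<Longrightarrow> foldr op w (sc c x) = sc c (foldr op w x)"
  by (induction w) (auto simp: op_sc act_closed)

text \<open>The span of the words that are negligible in weight \<open>k\<close>.\<close>

definition lower :: "nat \<Rightarrow> nat \<Rightarrow> 'a \<Rightarrow> 'a set" where
  "lower k d x = lin {foldr op w x | w. set w \<subseteq> {..<N} \<and> weight w < k \<and> deg w = d}"

lemma lower_csubspace: "x \<in> carrier G \<Longrightarrow> csubspace (lower k d x)"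
  unfolding lower_def by (rule csubspace_lin) (auto intro: act_closed)

lemma act_lower:
  assumes u: "set u \<subseteq> {..<N}" and x: "x \<in> carrier G" and "y \<in> lower k d x"
  shows "foldr op u y \<in> lower (weight u + k) (deg u + d) x"
  using assms(3) unfolding lower_def
  apply (rule lin_map[where h = "foldr op u", rotated -1])
  using u x apply (auto simp: act_closed act_add act_sc)[4]
   apply (rule lower_csubspace[OF x, unfolded lower_def])
  using u apply (auto intro!: lin_incl)
  subgoal for w by (rule exI[of _ "u @ w"]) auto
  done

lemma lower_append:
  assumes w: "set w \<subseteq> {..<N}" and x: "x \<in> carrier G" and "y \<in> lower k d (foldr op w x)"
  shows "y \<in> lower (k + weight w) (d + deg w) x"
proof -
  have "lower k d (foldr op w x) \<subseteq> lower (k + weight w) (d + deg w) x"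
    unfolding lower_def
    apply (rule lin_mono)
    using w apply auto
    subgoal for u by (rule exI[of _ "u @ w"]) auto
    done
  then show ?thesis using assms(3) by blast
qed

lemma act_congr:
  assumes "set u \<subseteq> {..<N}" "x \<in> carrier G" "congr (lower k d x) y z"
  shows "congr (lower (weight u + k) (deg u + d) x) (foldr op u y) (foldr op u z)"
  by (rule congr_map[where S = "lower k d x"]) (use assms act_lower in \<open>auto simp: act_closed act_add act_sc\<close>)

lemma swap_congr:
  assumes "i < N" "j < N" "set w \<subseteq> {..<N}" "x \<in> carrier G"
  shows "congr (lower (weight (i # j # w)) (deg (i # j # w)) x)
           (foldr op (i # j # w) x) (foldr op (j # i # w) x)"
proof -
  have "congr (lower (wt i + wt j) (dg i + dg j) (foldr op w x))
           (op i (op j (foldr op w x))) (op j (op i (foldr op w x)))"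
    unfolding lower_def using assms by (intro op_commute) (auto intro: act_closed)
  moreover have "lower (wt i + wt j) (dg i + dg j) (foldr op w x)
      \<subseteq> lower (weight (i # j # w)) (deg (i # j # w)) x"
    using lower_append[OF assms(3,4), of _ "wt i + wt j" "dg i + dg j"] by (auto simp: add.assoc)
  ultimately show ?thesis by (simp add: congr_mono)
qed

lemma move_congr:
  assumes "i < N" "set u \<subseteq> {..<N}" "set w \<subseteq> {..<N}" "x \<in> carrier G"
  shows "congr (lower (weight (i # u @ w)) (deg (i # u @ w)) x)
           (foldr op (i # u @ w) x) (foldr op (u @ i # w) x)"
  using assms(2)
proof (induction u)
  case Nil
  then show ?case using assms by (simp add: congr_refl lower_csubspace act_closed)
next
  case (Cons j u)
  let ?L = "lower (weight (i # (j # u) @ w)) (deg (i # (j # u) @ w)) x"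
  have "congr (lower (weight [j] + weight (i # u @ w)) (deg [j] + deg (i # u @ w)) x)
      (foldr op [j] (foldr op (i # u @ w) x)) (foldr op [j] (foldr op (u @ i # w) x))"
    by (rule act_congr) (use Cons assms in auto)
  then have "congr ?L (foldr op (j # i # u @ w) x) (foldr op ((j # u) @ i # w) x)"
    by (simp add: ac_simps)
  moreover have "congr ?L (foldr op (i # j # u @ w) x) (foldr op (j # i # u @ w) x)"
    using swap_congr[of i j "u @ w" x] Cons assms by simp
  ultimately show ?case
    using congr_trans[OF lower_csubspace[OF assms(4)]] by (metis append_Cons)
qed

text \<open>The commutator of two letters inside a word contributes only words of smaller weight, so letters may be moved
  one after the other into any given order.\<close>

lemma perm_congr:
  assumes "mset w = mset w'" "set w \<subseteq> {..<N}" "x \<in> carrier G"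
  shows "congr (lower (weight w) (deg w) x) (foldr op w x) (foldr op w' x)"
  using assms(1,2)
proof (induction w arbitrary: w')
  case Nil
  then show ?case using assms by (simp add: congr_refl lower_csubspace)
next
  case (Cons i w)
  have "i \<in> set w'" using Cons.prems(1) by (metis list.set_intros(1) mset_eq_setD)
  then obtain u v where w': "w' = u @ i # v" by (meson split_list)
  have m: "mset w = mset (u @ v)" using Cons.prems(1) w' by simp
  then have uv: "set u \<subseteq> {..<N}" "set v \<subseteq> {..<N}"
    using Cons.prems(2) mset_eq_setD[OF m] by auto
  have wd: "weight w = weight (u @ v)" "deg w = deg (u @ v)"
    by (metis m mset_map sum_mset_sum_list)+
  have "congr (lower (weight [i] + weight w) (deg [i] + deg w) x)
      (foldr op [i] (foldr op w x)) (foldr op [i] (foldr op (u @ v) x))"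
    by (rule act_congr) (use Cons.IH[OF m] Cons.prems assms in auto)
  then have "congr (lower (weight (i # w)) (deg (i # w)) x) (foldr op (i # w) x) (foldr op (i # u @ v) x)"
    by simp
  moreover have "congr (lower (weight (i # w)) (deg (i # w)) x) (foldr op (i # u @ v) x) (foldr op w' x)"
    using move_congr[of i u v x] Cons.prems uv assms wd w' by simp
  ultimately show ?case
    using congr_trans[OF lower_csubspace[OF assms(3)]] by blast
qed

text \<open>The weight comes first so that the correction terms of \<open>perm_congr\<close> are smaller than the word they
  correct. The multiset order decides next: it is total, well-founded, and compatible with adding letters.\<close>

definition precedes :: "((nat \<times> nat multiset \<times> nat) \<times> (nat \<times> nat multiset \<times> nat)) set" where
  "precedes = less_than <*lex*> {(A, B). A < B} <*lex*> less_than"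

definition index :: "nat list \<Rightarrow> nat \<Rightarrow> nat \<times> nat multiset \<times> nat" where
  "index w i = (weight w, mset w, i)"

lemma wf_precedes: "wf precedes"
  unfolding precedes_def by (intro wf_lex_prod wf_less_than wf)

lemma precedes_total: "\<iota> \<noteq> \<kappa> \<Longrightarrow> (\<iota>, \<kappa>) \<in> precedes \<or> (\<kappa>, \<iota>) \<in> precedes"
  by (cases \<iota>; cases \<kappa>) (auto simp: precedes_def)

lemma precedes_trans: "(\<iota>, \<kappa>) \<in> precedes \<Longrightarrow> (\<kappa>, \<mu>) \<in> precedes \<Longrightarrow> (\<iota>, \<mu>) \<in> precedes"
  by (cases \<iota>; cases \<kappa>; cases \<mu>) (auto simp: precedes_def)

lemma precedes_mult: "(index w i, index w' j) \<in> precedes \<Longrightarrow> (index (u @ w) i, index (u @ w') j) \<in> precedes"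
  by (auto simp: precedes_def index_def)

text \<open>Words in every letter order are included, so that prepending letters maps these spans into one another without
  any reordering.\<close>

definition below :: "nat \<times> nat multiset \<times> nat \<Rightarrow> nat \<Rightarrow> 'a set" where
  "below \<iota> d = lin {foldr op w (gen i) | w i. set w \<subseteq> {..<N} \<and> i < p \<and> deg w = d \<and> (index w i, \<iota>) \<in> precedes}"

lemma below_csubspace: "csubspace (below \<iota> d)"
  unfolding below_def by (rule csubspace_lin) (auto intro: act_closed)

lemma lower_below: "i < p \<Longrightarrow> lower (weight w) d (gen i) \<subseteq> below (index w i) d"
  unfolding lower_def below_def by (rule lin_mono) (auto simp: index_def precedes_def)

lemma below_mono: "(\<iota>, \<kappa>) \<in> precedes \<Longrightarrow> below \<iota> d \<subseteq> below \<kappa> d"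
  unfolding below_def by (rule lin_mono) (use precedes_trans in blast)

lemma act_below:
  assumes u: "set u \<subseteq> {..<N}" and "y \<in> below (index w i) d"
  shows "foldr op u y \<in> below (index (u @ w) i) (deg u + d)"
  using assms(2) unfolding below_def
  apply (rule lin_map[where h = "foldr op u", rotated -1])
  using u apply (auto simp: act_closed act_add act_sc)[4]
   apply (rule below_csubspace[unfolded below_def])
  using u apply (auto intro!: lin_incl)
  subgoal for w' j by (rule exI[of _ "u @ w'"], rule exI[of _ j]) (auto intro: precedes_mult)
  done

definition graded_subspace :: "(nat \<Rightarrow> 'a set) \<Rightarrow> bool" where
  "graded_subspace S \<longleftrightarrow> (\<forall>d. csubspace (S d)) \<and> (\<forall>i<N. \<forall>d. \<forall>x\<in>S d. op i x \<in> S (dg i + d))"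

lemma graded_subspace_act:
  assumes "graded_subspace S" "set w \<subseteq> {..<N}" "x \<in> S d"
  shows "foldr op w x \<in> S (deg w + d)"
  using assms(2) by (induction w) (use assms in \<open>auto simp: graded_subspace_def add.assoc\<close>)

definition spanned :: "nat \<Rightarrow> 'a set" where
  "spanned d = lin {foldr op w (gen i) | w i. set w \<subseteq> {..<N} \<and> i < p \<and> deg w = d}"

lemma congr_below_mem:
  assumes "congr (below \<iota> d) x y" "y \<in> below \<iota> d"
  shows "x \<in> below \<iota> d"
proof -
  have "(x \<ominus> y) \<oplus> y \<in> below \<iota> d"
    using assms csubspaceD(3)[OF below_csubspace] by (auto simp: congr_def)
  then show ?thesis using assms by (simp add: congr_def a_minus_def a_assoc l_neg)
qed

text \<open>Up to smaller terms, only the index of a word matters for its action on a generator.\<close>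

lemma same_index_congr:
  assumes "index w i = index v j" "set w \<subseteq> {..<N}" "i < p" "deg w = d"
  shows "congr (below (index w i) d) (sc c (foldr op v (gen j))) (sc c (foldr op w (gen i)))"
proof -
  have ij: "j = i" "mset w = mset v" using assms(1) by (auto simp: index_def)
  have "congr (below (index w i) d) (foldr op w (gen i)) (foldr op v (gen i))"
    using perm_congr[OF ij(2) assms(2) gen_closed[OF assms(3)]] lower_below[OF assms(3), of w d] assms(4)
    by (auto intro: congr_mono)
  then show ?thesis
    unfolding ij(1) by (intro congr_sc below_csubspace) (rule congr_sym[OF below_csubspace])
qed

text \<open>The set of vectors with a leading term is a subspace: of two terms with different indices the larger one
  survives in a sum, and terms with the same index are multiples of one another up to smaller terms. The
  coefficient \<open>c\<close> may be zero, so cancellation in the leading term needs no separate treatment.\<close>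

lemma leading_term:
  assumes P: "\<And>w i. P w i \<Longrightarrow> set w \<subseteq> {..<N} \<and> i < p \<and> deg w = d"
    and "x \<in> lin {foldr op w (gen i) | w i. P w i}"
  shows "x = \<zero> \<or> (\<exists>w i c. P w i \<and> congr (below (index w i) d) x (sc c (foldr op w (gen i))))"
proof -
  define S where "S = {x \<in> carrier G. x = \<zero> \<or>
    (\<exists>w i c. P w i \<and> congr (below (index w i) d) x (sc c (foldr op w (gen i))))}"
  have absorb: "x \<oplus> y \<in> S" if x: "congr (below (index w i) d) x (sc c (foldr op w (gen i)))"
      and y: "congr (below (index v j) d) y (sc b (foldr op v (gen j)))"
      and P': "P w i" "P v j" and pr: "(index v j, index w i) \<in> precedes" for x y w i c v j b
  proof -
    have "foldr op v (gen j) \<in> below (index w i) d"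
      unfolding below_def using P P' pr by (intro lin_incl) blast
    then have "sc b (foldr op v (gen j)) \<in> below (index w i) d"
      using csubspaceD(4)[OF below_csubspace] by blast
    moreover have "congr (below (index w i) d) y (sc b (foldr op v (gen j)))"
      by (rule congr_mono[OF y below_mono[OF pr]])
    ultimately have "y \<in> below (index w i) d"
      using congr_below_mem by blast
    then have "congr (below (index w i) d) (x \<oplus> y) (sc c (foldr op w (gen i)) \<oplus> \<zero>)"
      by (intro congr_add congr_zero x below_csubspace)
    moreover have "sc c (foldr op w (gen i)) \<in> carrier G" using x by (simp add: congr_def)
    ultimately show ?thesis
      using P' x y unfolding S_def congr_def by auto
  qed
  have "csubspace S"
  proof (rule csubspaceI)
    fix c x assume x: "x \<in> S"
    show "sc c x \<in> S"
    proof (cases "x = \<zero>")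
      case True
      then show ?thesis by (auto simp: S_def sc_zero_right)
    next
      case False
      then obtain w i c' where w: "P w i" "congr (below (index w i) d) x (sc c' (foldr op w (gen i)))"
        using x by (auto simp: S_def)
      then have "congr (below (index w i) d) (sc c x) (sc (c * c') (foldr op w (gen i)))"
        using congr_sc[OF below_csubspace w(2), of c] P[OF w(1)] by (simp add: sc_sc act_closed)
      then show ?thesis using x w by (auto simp: S_def)
    qed
  next
    fix x y assume xy: "x \<in> S" "y \<in> S"
    then have car: "x \<in> carrier G" "y \<in> carrier G" by (auto simp: S_def)
    show "x \<oplus> y \<in> S"
    proof (cases "x = \<zero> \<or> y = \<zero>")
      case True
      then show ?thesis using xy car by auto
    next
      case False
      then obtain w i c where w: "P w i" "congr (below (index w i) d) x (sc c (foldr op w (gen i)))"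
        using xy by (auto simp: S_def)
      obtain v j b where v: "P v j" "congr (below (index v j) d) y (sc b (foldr op v (gen j)))"
        using False xy by (auto simp: S_def)
      consider "index w i = index v j" | "(index w i, index v j) \<in> precedes"
        | "(index v j, index w i) \<in> precedes"
        using precedes_total by blast
      then show ?thesis
      proof cases
        case 1
        have "congr (below (index w i) d) (sc b (foldr op v (gen j))) (sc b (foldr op w (gen i)))"
          by (rule same_index_congr[OF 1]) (use P w in auto)
        then have "congr (below (index w i) d) y (sc b (foldr op w (gen i)))"
          using v(2) 1 congr_trans[OF below_csubspace] by metis
        then have "congr (below (index w i) d) (x \<oplus> y)
            (sc c (foldr op w (gen i)) \<oplus> sc b (foldr op w (gen i)))"
          by (intro congr_add w(2) below_csubspace)
        then have "congr (below (index w i) d) (x \<oplus> y) (sc (c + b) (foldr op w (gen i)))"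
          using P[OF w(1)] by (simp add: add_sc act_closed)
        then show ?thesis using w car by (auto simp: S_def)
      next
        case 2
        then show ?thesis using absorb[OF v(2) w(2) v(1) w(1)] car by (simp add: a_comm)
      next
        case 3
        then show ?thesis using absorb[OF w(2) v(2) w(1) v(1)] by simp
      qed
    qed
  qed (auto simp: S_def)
  moreover have "{foldr op w (gen i) | w i. P w i} \<subseteq> S"
  proof safe
    fix w i assume w: "P w i"
    then have c: "foldr op w (gen i) \<in> carrier G" using P act_closed gen_closed by blast
    then have "congr (below (index w i) d) (foldr op w (gen i)) (sc 1 (foldr op w (gen i)))"
      by (simp add: sc_one congr_refl below_csubspace)
    then show "foldr op w (gen i) \<in> S" using w c by (auto simp: S_def)
  qed
  ultimately have "x \<in> S" using lin_least assms(2) by blast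
  then show ?thesis unfolding S_def by blast
qed

text \<open>Leading monomials, at the generator \<open>i\<close>, of elements of \<open>S\<close> with leading coefficient one.\<close>

definition leading_monomials :: "(nat \<Rightarrow> 'a set) \<Rightarrow> nat \<Rightarrow> nat multiset set" where
  "leading_monomials S i = {A. \<exists>w x. mset w = A \<and> set w \<subseteq> {..<N} \<and> x \<in> S (deg w)
      \<and> congr (below (index w i) (deg w)) x (foldr op w (gen i))}"

text \<open>Choose an element of \<open>S\<close> for each member of a finite basis of the leading monomials at each generator. Any vector of
  \<open>S\<close> has the leading term of a scalar multiple of a word applied to one of them; subtracting it lowers the index, and
  the order is well-founded.\<close>

theorem graded_noetherian:
  assumes S: "graded_subspace S" and sp: "\<And>d. S d \<subseteq> spanned d"
  shows "\<exists>F. finite F \<and> (\<forall>(d, x)\<in>F. x \<in> S d) \<and>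
    (\<forall>H. graded_subspace H \<longrightarrow> (\<forall>(d, x)\<in>F. x \<in> H d) \<longrightarrow> (\<forall>d. S d \<subseteq> H d))"
proof -
  have "\<exists>T\<subseteq>leading_monomials S i. finite T \<and> (\<forall>A\<in>leading_monomials S i. \<exists>B\<in>T. B \<subseteq># A)" for i
    by (rule dickson_finite_basis[of "{..<N}"]) (auto simp: leading_monomials_def)
  then obtain T where T: "\<And>i. T i \<subseteq> leading_monomials S i" "\<And>i. finite (T i)"
    "\<And>i A. A \<in> leading_monomials S i \<Longrightarrow> \<exists>B\<in>T i. B \<subseteq># A" by metis
  have "\<forall>i A. \<exists>w x. A \<in> T i \<longrightarrow> mset w = A \<and> set w \<subseteq> {..<N} \<and> x \<in> S (deg w)
      \<and> congr (below (index w i) (deg w)) x (foldr op w (gen i))"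
    using T(1) unfolding leading_monomials_def by blast
  then obtain word elt where we: "\<And>i A. A \<in> T i \<Longrightarrow> mset (word i A) = A \<and> set (word i A) \<subseteq> {..<N}
      \<and> elt i A \<in> S (deg (word i A))
      \<and> congr (below (index (word i A) i) (deg (word i A))) (elt i A) (foldr op (word i A) (gen i))"
    by metis
  define F where "F = (\<lambda>(i, A). (deg (word i A), elt i A)) ` (SIGMA i:{..<p}. T i)"
  have "S d \<subseteq> H d" if H: "graded_subspace H" "\<forall>(d, x)\<in>F. x \<in> H d" for H d
  proof -
    have Sd: "csubspace (S d)" and Hd: "csubspace (H d)"
      using S H by (auto simp: graded_subspace_def)
    have main: "x \<in> H d" if "index w i = \<iota>" "set w \<subseteq> {..<N}" "i < p" "deg w = d" "x \<in> S d"
      "congr (below (index w i) d) x (sc c (foldr op w (gen i)))" for \<iota> w i c x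
      using that
    proof (induction \<iota> arbitrary: w i c x rule: wf_induct_rule[OF wf_precedes])
      case (1 \<iota>)
      have rec: "y \<in> H d" if "y \<in> S d" "y \<in> below \<iota> d" for y
      proof -
        have "y = \<zero> \<or> (\<exists>w' j b. (set w' \<subseteq> {..<N} \<and> j < p \<and> deg w' = d \<and> (index w' j, \<iota>) \<in> precedes) \<and>
          congr (below (index w' j) d) y (sc b (foldr op w' (gen j))))"
          by (rule leading_term) (use that in \<open>simp_all only: below_def conj_assoc\<close>)
        then show ?thesis using "1.IH" \<open>y \<in> S d\<close> csubspaceD(2)[OF Hd] by blast
      qed
      have fc: "foldr op w (gen i) \<in> carrier G" using 1 act_closed by blast
      show ?case
      proof (cases "c = 0")
        case True
        then have "congr (below \<iota> d) x \<zero>" using 1 fc by (simp add: sc_zero_left)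
        then have "x \<in> below \<iota> d" using congr_below_mem csubspaceD(2)[OF below_csubspace] by blast
        then show ?thesis using rec 1 by blast
      next
        case False
        have "congr (below \<iota> d) (sc (1 / c) x) (foldr op w (gen i))"
          using congr_sc[OF below_csubspace "1.prems"(6), of "1 / c"] False fc 1
          by (simp add: sc_sc sc_one)
        then have "mset w \<in> leading_monomials S i"
          using 1 csubspaceD(4)[OF Sd] unfolding leading_monomials_def by blast
        then obtain B where B: "B \<in> T i" "B \<subseteq># mset w" using T(3) by blast
        define v y where "v = word i B" and "y = elt i B"
        note v = we[OF B(1), folded v_def y_def]
        \<comment> \<open>The letters \<open>u\<close> missing from the basis monomial \<open>B\<close> turn its chosen element \<open>y\<close> into one with leading term \<open>w\<close>.\<close>
        obtain u where u: "mset u = mset w - B" by (meson ex_mset)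
        have uN: "set u \<subseteq> {..<N}"
          using u "1.prems"(2) by (metis in_diffD set_mset_mset subset_iff)
        have muv: "mset w = mset (u @ v)" using u v B(2) by simp
        have "weight w = weight (u @ v)" "deg w = deg (u @ v)"
          by (metis muv mset_map sum_mset_sum_list)+
        then have wuv: "deg w = deg u + deg v" "index w i = index (u @ v) i"
          using muv by (simp_all add: index_def)
        have "(deg v, y) \<in> F" unfolding F_def v_def y_def using B(1) "1.prems"(3) by (auto simp: image_iff intro!: bexI[of _ "(i, B)"])
        then have yH: "y \<in> H (deg v)" using H(2) by blast
        have "foldr op u y \<in> H d" "foldr op u y \<in> S d"
          using graded_subspace_act[OF H(1) uN yH] graded_subspace_act[OF S uN, of y "deg v"] v wuv(1) "1.prems"(4)
          by simp_all
        then have zH: "sc c (foldr op u y) \<in> H d" and zS: "sc c (foldr op u y) \<in> S d"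
          using csubspaceD(4) Hd Sd by blast+
        have "congr (below (index (u @ v) i) (deg u + deg v)) (foldr op u y) (foldr op u (foldr op v (gen i)))"
          by (rule congr_map[where S = "below (index v i) (deg v)"])
             (use v uN act_below in \<open>auto simp: act_closed act_add act_sc\<close>)
        then have "congr (below \<iota> d) (foldr op u y) (foldr op (u @ v) (gen i))"
          using wuv 1 by simp
        then have "congr (below \<iota> d) (sc c (foldr op u y)) (sc c (foldr op (u @ v) (gen i)))"
          by (rule congr_sc[OF below_csubspace])
        moreover have "congr (below \<iota> d) (sc c (foldr op (u @ v) (gen i))) (sc c (foldr op w (gen i)))"
          using same_index_congr[OF wuv(2)] 1 by blast
        ultimately have "congr (below \<iota> d) x (sc c (foldr op u y))"
          using "1.prems"(1,6) congr_trans[OF below_csubspace] congr_sym[OF below_csubspace] by metis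
        then have d: "x \<ominus> sc c (foldr op u y) \<in> below \<iota> d" "x \<in> carrier G" "sc c (foldr op u y) \<in> carrier G"
          by (auto simp: congr_def)
        then have "x \<ominus> sc c (foldr op u y) \<in> H d"
          using rec csubspace_diff[OF Sd] 1 zS by blast
        then have "(x \<ominus> sc c (foldr op u y)) \<oplus> sc c (foldr op u y) \<in> H d"
          using zH csubspaceD(3)[OF Hd] by blast
        then show ?thesis using d by (simp add: a_minus_def a_assoc l_neg)
      qed
    qed
    show ?thesis
    proof
      fix x assume x: "x \<in> S d"
      have "x = \<zero> \<or> (\<exists>w i c. (set w \<subseteq> {..<N} \<and> i < p \<and> deg w = d) \<and>
          congr (below (index w i) d) x (sc c (foldr op w (gen i))))"
        by (rule leading_term) (use x sp[of d] in \<open>auto simp only: spanned_def\<close>)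
      then show "x \<in> H d" using main x csubspaceD(2)[OF Hd] by blast
    qed
  qed
  moreover have "finite F" using T(2) by (auto simp: F_def)
  moreover have "\<forall>(d, x)\<in>F. x \<in> S d" using we by (auto simp: F_def)
  ultimately show ?thesis by blast
qed

end

section \<open>Modules over algebras with weighted generators\<close>

lemma complex_algebra_map:
  assumes "complex_algebra A \<kappa>"
  shows "\<kappa> c \<in> carrier A" "\<kappa> (c + d) = \<kappa> c \<oplus>\<^bsub>A\<^esub> \<kappa> d" "\<kappa> (c * d) = \<kappa> c \<otimes>\<^bsub>A\<^esub> \<kappa> d" "\<kappa> 1 = \<one>\<^bsub>A\<^esub>"
    and "a \<in> carrier A \<Longrightarrow> \<kappa> c \<otimes>\<^bsub>A\<^esub> a = a \<otimes>\<^bsub>A\<^esub> \<kappa> c"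
proof -
  have h: "\<kappa> \<in> ring_hom ring_of_type_algebra A" using assms by (simp add: complex_algebra_def)
  show "\<kappa> c \<in> carrier A" "\<kappa> (c + d) = \<kappa> c \<oplus>\<^bsub>A\<^esub> \<kappa> d" "\<kappa> (c * d) = \<kappa> c \<otimes>\<^bsub>A\<^esub> \<kappa> d" "\<kappa> 1 = \<one>\<^bsub>A\<^esub>"
    using ring_hom_closed[OF h, of c] ring_hom_add[OF h, of c d] ring_hom_mult[OF h, of c d] ring_hom_one[OF h]
    by (simp_all add: ring_of_type_algebra_def)
  show "a \<in> carrier A \<Longrightarrow> \<kappa> c \<otimes>\<^bsub>A\<^esub> a = a \<otimes>\<^bsub>A\<^esub> \<kappa> c"
    using assms unfolding complex_algebra_def by blast
qed

lemma complex_algebra_space: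
  assumes "complex_algebra A \<kappa>"
  shows "complex_space A (\<lambda>c a. \<kappa> c \<otimes>\<^bsub>A\<^esub> a)"
proof -
  interpret ring A using assms by (simp add: complex_algebra_def)
  note map = complex_algebra_map[OF assms]
  show ?thesis
    by unfold_locales (simp_all add: map(1,2,4) l_distr r_distr map(3) m_assoc)
qed

lemma left_module_space:
  assumes "complex_algebra A \<kappa>" "left_module A M"
  shows "complex_space M (\<lambda>c v. \<kappa> c \<odot>\<^bsub>M\<^esub> v)"
proof -
  interpret left_module A M by fact
  note map = complex_algebra_map[OF assms(1)]
  show ?thesis
    by unfold_locales (simp_all add: map(1-4) smult_closed smult_l_distr smult_r_distr smult_assoc smult_one)
qed

locale complex_algebra_ring = ring A for A (structure) +
  fixes \<kappa> :: "complex \<Rightarrow> 'a"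
  assumes algebra: "complex_algebra A \<kappa>"
begin

sublocale A: complex_space A "\<lambda>c a. \<kappa> c \<otimes> a"
  by (rule complex_algebra_space[OF algebra])

lemma neg_add: "a \<in> carrier A \<Longrightarrow> \<ominus> a \<oplus> a = \<zero>" "a \<in> carrier A \<Longrightarrow> \<ominus> a \<in> carrier A"
  by (simp_all add: l_neg)

lemma scalar_closed [simp, intro]: "\<kappa> c \<in> carrier A"
  using complex_algebra_map[OF algebra] by blast

lemma scalar_zero: "\<kappa> 0 = \<zero>"
  using A.sc_zero_left[of \<one>] by simp

lemma scalar_central: "a \<in> carrier A \<Longrightarrow> \<kappa> c \<otimes> a = a \<otimes> \<kappa> c"
  using complex_algebra_map[OF algebra] by blast

lemma lin_mult:
  assumes S: "S \<subseteq> carrier A" and T: "T \<subseteq> carrier A" and U: "A.csubspace U"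
    and st: "\<And>s t. s \<in> S \<Longrightarrow> t \<in> T \<Longrightarrow> s \<otimes> t \<in> U"
    and a: "a \<in> A.lin S" and b: "b \<in> A.lin T"
  shows "a \<otimes> b \<in> U"
proof -
  have bA: "b \<in> carrier A" using A.lin_carrier[OF T] b by blast
  have s: "s \<otimes> b \<in> U" if "s \<in> S" for s
  proof (rule A.lin_map[where h = "\<lambda>b. s \<otimes> b", OF T _ _ _ U st[OF that] b])
    fix c x assume "x \<in> carrier A"
    then show "s \<otimes> (\<kappa> c \<otimes> x) = \<kappa> c \<otimes> (s \<otimes> x)"
      using that S by (simp add: subset_iff scalar_central m_assoc)
  qed (use that S in \<open>auto simp: r_distr\<close>)
  show ?thesis
    by (rule A.lin_map[where h = "\<lambda>a. a \<otimes> b", OF S _ _ _ U s a])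
       (use bA in \<open>auto simp: l_distr m_assoc\<close>)
qed

lemma foldr_mult_closed: "set xs \<subseteq> carrier A \<Longrightarrow> foldr (\<otimes>) xs \<one> \<in> carrier A"
  by (induction xs) auto

lemma foldr_mult_append:
  "set xs \<subseteq> carrier A \<Longrightarrow> set ys \<subseteq> carrier A \<Longrightarrow>
    foldr (\<otimes>) (xs @ ys) \<one> = foldr (\<otimes>) xs \<one> \<otimes> foldr (\<otimes>) ys \<one>"
  by (induction xs) (auto simp: m_assoc foldr_mult_closed)

text \<open>Stated for arbitrary word predicates so that it covers both the filtration by weight and the span of all
  words.\<close>

lemma lin_words_mult:
  assumes z: "\<And>i. i < N \<Longrightarrow> z i \<in> carrier A"
    and PQ: "\<And>u w. P u \<Longrightarrow> Q w \<Longrightarrow> R (u @ w)"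
    and a: "a \<in> A.lin {foldr (\<otimes>) (map z w) \<one> | w. set w \<subseteq> {..<N} \<and> P w}"
    and b: "b \<in> A.lin {foldr (\<otimes>) (map z w) \<one> | w. set w \<subseteq> {..<N} \<and> Q w}"
  shows "a \<otimes> b \<in> A.lin {foldr (\<otimes>) (map z w) \<one> | w. set w \<subseteq> {..<N} \<and> R w}"
proof (rule lin_mult[OF _ _ _ _ a b])
  have car: "{foldr (\<otimes>) (map z w) \<one> | w. set w \<subseteq> {..<N} \<and> P w} \<subseteq> carrier A" for P
    using z by (auto intro!: foldr_mult_closed simp: subset_iff)
  then show "{foldr (\<otimes>) (map z w) \<one> | w. set w \<subseteq> {..<N} \<and> P w} \<subseteq> carrier A"
     "{foldr (\<otimes>) (map z w) \<one> | w. set w \<subseteq> {..<N} \<and> Q w} \<subseteq> carrier A"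
     "A.csubspace (A.lin {foldr (\<otimes>) (map z w) \<one> | w. set w \<subseteq> {..<N} \<and> R w})"
    using A.csubspace_lin by blast+
  fix s t assume "s \<in> {foldr (\<otimes>) (map z w) \<one> | w. set w \<subseteq> {..<N} \<and> P w}"
    "t \<in> {foldr (\<otimes>) (map z w) \<one> | w. set w \<subseteq> {..<N} \<and> Q w}"
  then obtain u w where u: "s = foldr (\<otimes>) (map z u) \<one>" "set u \<subseteq> {..<N}" "P u"
    and w: "t = foldr (\<otimes>) (map z w) \<one>" "set w \<subseteq> {..<N}" "Q w" by blast
  have "s \<otimes> t = foldr (\<otimes>) (map z (u @ w)) \<one>"
    unfolding u(1) w(1) map_append
    by (rule foldr_mult_append[symmetric]) (use u(2) w(2) z in auto)
  then show "s \<otimes> t \<in> A.lin {foldr (\<otimes>) (map z w) \<one> | w. set w \<subseteq> {..<N} \<and> R w}"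
    using PQ[OF u(3) w(3)] u(2) w(2) by (intro A.lin_incl CollectI exI[of _ "u @ w"]) auto
qed

text \<open>Closure under negation comes from the scalar \<open>-1\<close>.\<close>

lemma generate_ring_subset:
  assumes H: "H \<subseteq> S" and S: "A.csubspace S" "\<one> \<in> S"
    and mult: "\<And>a b. a \<in> S \<Longrightarrow> b \<in> S \<Longrightarrow> a \<otimes> b \<in> S"
  shows "generate_ring A H \<subseteq> S"
proof
  fix a assume "a \<in> generate_ring A H"
  then show "a \<in> S"
    by induction (use assms A.csubspace_minus[OF S(1)] A.csubspaceD(3)[OF S(1)] in auto)
qed

end

text \<open>The conditions of \<open>weighted_operators\<close>, stated once in the algebra itself; they are inherited by
  the action on every module.\<close>

locale weighted_generators = complex_algebra_ring A \<kappa> for A (structure) and \<kappa> +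
  fixes z :: "nat \<Rightarrow> 'a" and N :: nat and wt :: "nat \<Rightarrow> nat"
  assumes z_closed [simp, intro]: "i < N \<Longrightarrow> z i \<in> carrier A"
    and commutator: "\<lbrakk>i < N; j < N\<rbrakk> \<Longrightarrow> z i \<otimes> z j \<ominus> z j \<otimes> z i \<in>
      A.lin {foldr (\<otimes>) (map z w) \<one> | w. set w \<subseteq> {..<N} \<and> sum_list (map wt w) < wt i + wt j}"
    and generated: "carrier A \<subseteq> A.lin {foldr (\<otimes>) (map z w) \<one> | w. set w \<subseteq> {..<N}}"
begin

lemma prod_closed: "set w \<subseteq> {..<N} \<Longrightarrow> foldr (\<otimes>) (map z w) \<one> \<in> carrier A"
  by (rule foldr_mult_closed) auto

end

locale weighted_module = weighted_generators A \<kappa> z N wt + left_module A M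
  for A (structure) and \<kappa> z N wt and M (structure)
begin

sublocale V: complex_space M "\<lambda>c v. \<kappa> c \<odot>\<^bsub>M\<^esub> v"
  by (rule left_module_space[OF algebra left_module_axioms])

lemmas smult_simps = smult_closed smult_l_distr smult_r_distr smult_assoc smult_one

lemma smult_zero: "v \<in> carrier M \<Longrightarrow> \<zero> \<odot>\<^bsub>M\<^esub> v = \<zero>\<^bsub>M\<^esub>"
proof -
  assume v: "v \<in> carrier M"
  then have "\<zero> \<odot>\<^bsub>M\<^esub> v \<oplus>\<^bsub>M\<^esub> \<zero> \<odot>\<^bsub>M\<^esub> v = \<zero> \<odot>\<^bsub>M\<^esub> v"
    using smult_l_distr[of \<zero> \<zero> v] by simp
  then show ?thesis using v by (simp add: smult_closed M.add.l_cancel_one)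
qed

lemma smult_minus: "a \<in> carrier A \<Longrightarrow> v \<in> carrier M \<Longrightarrow> (\<ominus> a) \<odot>\<^bsub>M\<^esub> v = \<ominus>\<^bsub>M\<^esub> (a \<odot>\<^bsub>M\<^esub> v)"
proof -
  assume v: "a \<in> carrier A" "v \<in> carrier M"
  then have "(\<ominus> a) \<odot>\<^bsub>M\<^esub> v \<oplus>\<^bsub>M\<^esub> a \<odot>\<^bsub>M\<^esub> v = \<zero>\<^bsub>M\<^esub>"
    using smult_l_distr[of "\<ominus> a" a v] by (simp add: neg_add smult_zero)
  then show ?thesis using v by (metis M.minus_equality smult_closed neg_add(2))
qed

lemma smult_diff:
  "\<lbrakk>a \<in> carrier A; b \<in> carrier A; v \<in> carrier M\<rbrakk> \<Longrightarrow> (a \<ominus> b) \<odot>\<^bsub>M\<^esub> v = a \<odot>\<^bsub>M\<^esub> v \<ominus>\<^bsub>M\<^esub> b \<odot>\<^bsub>M\<^esub> v"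
  by (simp add: a_minus_def smult_l_distr smult_minus)

lemma lin_smult:
  assumes "T \<subseteq> carrier A" "v \<in> carrier M" "V.csubspace S"
    and "\<And>a. a \<in> T \<Longrightarrow> a \<odot>\<^bsub>M\<^esub> v \<in> S" and "a \<in> A.lin T"
  shows "a \<odot>\<^bsub>M\<^esub> v \<in> S"
proof -
  have "A.csubspace {a \<in> carrier A. a \<odot>\<^bsub>M\<^esub> v \<in> S}"
    by (rule A.csubspaceI) (use assms(2) in \<open>auto simp: smult_simps smult_zero V.csubspaceD[OF assms(3)]\<close>)
  then have "A.lin T \<subseteq> {a \<in> carrier A. a \<odot>\<^bsub>M\<^esub> v \<in> S}"
    by (rule A.lin_least) (use assms in auto)
  then show ?thesis using assms(5) by blast
qed

lemma foldr_smult: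
  assumes "set w \<subseteq> {..<N}" "v \<in> carrier M"
  shows "foldr (\<otimes>) (map z w) \<one> \<odot>\<^bsub>M\<^esub> v = foldr (\<lambda>i v. z i \<odot>\<^bsub>M\<^esub> v) w v"
  using assms(1) by (induction w) (auto simp: assms(2) smult_one smult_assoc prod_closed)

lemma submodule_space: "submodule H A M \<Longrightarrow> V.csubspace H"
  by (intro V.csubspaceI)
     (auto dest: submodule.axioms(1) submodule.smult_closed
        intro: subgroup.m_closed[of H "add_monoid M", simplified]
          subgroup.one_closed[of H "add_monoid M", simplified]
          subgroup.mem_carrier[of H "add_monoid M", simplified])

lemma submodule_of_subspace:
  assumes "V.csubspace H" "\<And>a v. a \<in> carrier A \<Longrightarrow> v \<in> H \<Longrightarrow> a \<odot>\<^bsub>M\<^esub> v \<in> H"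
  shows "submodule H A M"
proof -
  have "subgroup H (add_monoid M)"
    by (rule M.add.subgroupI)
       (use assms(1) V.csubspace_minus in \<open>auto simp: V.csubspace_def simp flip: a_inv_def\<close>)
  then show ?thesis
    using assms(2) by (simp add: submodule_def submodule_axioms_def)
qed

lemma submodule_of_letters:
  assumes "V.csubspace H" and letters: "\<And>i v. i < N \<Longrightarrow> v \<in> H \<Longrightarrow> z i \<odot>\<^bsub>M\<^esub> v \<in> H"
  shows "submodule H A M"
proof (rule submodule_of_subspace[OF assms(1)])
  fix a v assume a: "a \<in> carrier A" and v: "v \<in> H"
  then have vM: "v \<in> carrier M" using V.csubspaceD(1)[OF assms(1)] by blast
  have act: "foldr (\<lambda>i v. z i \<odot>\<^bsub>M\<^esub> v) w v \<in> H" if "set w \<subseteq> {..<N}" for w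
    using that by (induction w) (auto simp: v letters)
  show "a \<odot>\<^bsub>M\<^esub> v \<in> H"
  proof (rule lin_smult[OF _ vM assms(1)])
    show "a \<in> A.lin {foldr (\<otimes>) (map z w) \<one> | w. set w \<subseteq> {..<N}}" using a generated by blast
  qed (use act vM foldr_smult in \<open>auto simp: prod_closed\<close>)
qed

text \<open>Finite generation speaks about submodules; leading terms need an actual spanning set. The span of all words
  applied to the generators is a submodule because every element of the algebra is a combination of words.\<close>

lemma finite_generators_span:
  assumes "finitely_generated_module A M"
  obtains gen and p :: nat where "\<And>i. i < p \<Longrightarrow> gen i \<in> carrier M"
    and "carrier M \<subseteq> V.lin {foldr (\<lambda>i v. z i \<odot>\<^bsub>M\<^esub> v) w (gen i) | w i. set w \<subseteq> {..<N} \<and> i < p}"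
proof -
  obtain F where F: "F \<subseteq> carrier M" "finite F" "\<And>H. submodule H A M \<Longrightarrow> F \<subseteq> H \<Longrightarrow> H = carrier M"
    using assms by (auto simp: finitely_generated_module_def)
  obtain p gen where gen: "F = gen ` {i::nat. i < p}"
    using F(2) by (metis finite_conv_nat_seg_image)
  let ?T = "{foldr (\<lambda>i v. z i \<odot>\<^bsub>M\<^esub> v) w (gen i) | w i. set w \<subseteq> {..<N} \<and> i < p}"
  have genM: "\<And>i. i < p \<Longrightarrow> gen i \<in> carrier M" using F(1) gen by auto
  have act: "foldr (\<lambda>i v. z i \<odot>\<^bsub>M\<^esub> v) w v \<in> carrier M" if "set w \<subseteq> {..<N}" "v \<in> carrier M" for w v
    using that by (induction w) (auto simp: smult_closed)
  have T: "?T \<subseteq> carrier M" using act genM by blast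
  have "submodule (V.lin ?T) A M"
  proof (rule submodule_of_letters[OF V.csubspace_lin[OF T]])
    fix i v assume i: "i < N" and v: "v \<in> V.lin ?T"
    show "z i \<odot>\<^bsub>M\<^esub> v \<in> V.lin ?T"
    proof (rule V.lin_map[where h = "\<lambda>v. z i \<odot>\<^bsub>M\<^esub> v", OF T _ _ _ V.csubspace_lin[OF T] _ v])
      fix x assume "x \<in> ?T"
      then obtain w j where "x = foldr (\<lambda>i v. z i \<odot>\<^bsub>M\<^esub> v) (w) (gen j)" "set w \<subseteq> {..<N}" "j < p" by blast
      then show "z i \<odot>\<^bsub>M\<^esub> x \<in> V.lin ?T"
        using i by (intro V.lin_incl) (auto intro!: exI[of _ "i # w"])
    next
      fix c x assume "x \<in> carrier M"
      then show "z i \<odot>\<^bsub>M\<^esub> (\<kappa> c \<odot>\<^bsub>M\<^esub> x) = \<kappa> c \<odot>\<^bsub>M\<^esub> (z i \<odot>\<^bsub>M\<^esub> x)"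
        using i by (simp add: scalar_central flip: smult_assoc)
    qed (use i in \<open>auto simp: smult_simps\<close>)
  qed
  moreover have "gen i \<in> V.lin ?T" if "i < p" for i
    using that by (intro V.lin_incl) (auto intro!: exI[of _ "[]"])
  then have "F \<subseteq> V.lin ?T" unfolding gen by auto
  ultimately show thesis using F(3) that[of p gen] genM by simp
qed

text \<open>The element \<open>\<alpha>\<close> becomes the letter with number \<open>N\<close>, of weight zero and degree one. Its commutator with \<open>z i\<close>
  is \<open>\<kappa> (e i) \<alpha>\<close>, a multiple of the one-letter word \<open>\<alpha>\<close> of weight zero and degree one; this is smaller in weight than the
  product when \<open>z i\<close> has positive weight, and it vanishes otherwise.\<close>

lemma extended_operators:
  assumes \<alpha>: "\<alpha> \<in> carrier A"
    and eig: "\<And>i. i < N \<Longrightarrow> z i \<otimes> \<alpha> = \<alpha> \<otimes> z i \<oplus> \<kappa> (e i) \<otimes> \<alpha>"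
    and eig0: "\<And>i. i < N \<Longrightarrow> wt i = 0 \<Longrightarrow> e i = 0"
    and gen: "\<And>i. i < p \<Longrightarrow> gen i \<in> carrier M"
  shows "weighted_operators M (\<lambda>c v. \<kappa> c \<odot>\<^bsub>M\<^esub> v) (\<lambda>i v. (if i < N then z i else \<alpha>) \<odot>\<^bsub>M\<^esub> v) (Suc N)
    (\<lambda>i. if i < N then wt i else 0) (\<lambda>i. if i < N then 0 else 1) gen p"
proof -
  let ?op = "\<lambda>i v. (if i < N then z i else \<alpha>) \<odot>\<^bsub>M\<^esub> v"
  let ?wt = "\<lambda>i. if i < N then wt i else 0"
  let ?dg = "\<lambda>i. if i < N then 0 else 1 :: nat"
  let ?T = "\<lambda>i j x. {foldr ?op w x | w. set w \<subseteq> {..<Suc N} \<and> sum_list (map ?wt w) < ?wt i + ?wt j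
                    \<and> sum_list (map ?dg w) = ?dg i + ?dg j}"
  have op: "?op i x \<in> carrier M" if "x \<in> carrier M" "i < Suc N" for i x
    using that \<alpha> by (auto simp: smult_closed)
  have act: "foldr ?op w x \<in> carrier M" if "set w \<subseteq> {..<Suc N}" "x \<in> carrier M" for w x
    using that \<alpha> by (induction w) (auto simp: smult_closed)
  have T: "V.csubspace (V.lin (?T i j x))" if "x \<in> carrier M" for i j x
    by (rule V.csubspace_lin) (use act[OF _ that] in blast)
  have letters: "V.congr (V.lin (?T i j x)) (?op i (?op j x)) (?op j (?op i x))"
    if ij: "i < N" "j < N" and x: "x \<in> carrier M" for i j x
  proof -
    have "(z i \<otimes> z j \<ominus> z j \<otimes> z i) \<odot>\<^bsub>M\<^esub> x \<in> V.lin (?T i j x)"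
    proof (rule lin_smult[OF _ x T[OF x] _ commutator[OF ij]], goal_cases)
      case 1
      then show ?case by (auto simp: prod_closed)
    next
      case (2 a)
      then obtain w where w: "a = foldr (\<otimes>) (map z w) \<one>" "set w \<subseteq> {..<N}"
        "sum_list (map wt w) < wt i + wt j" by blast
      have "foldr (\<lambda>i v. z i \<odot>\<^bsub>M\<^esub> v) w x = foldr ?op w x"
        by (rule foldr_cong) (use w(2) in auto)
      then have "a \<odot>\<^bsub>M\<^esub> x = foldr ?op w x" using w x by (simp only: foldr_smult)
      moreover have "sum_list (map ?wt w) = sum_list (map wt w)" "sum_list (map ?dg w) = 0"
        using w(2) by (auto intro!: arg_cong[of _ _ sum_list])
      moreover have "set w \<subseteq> {..<Suc N}" using w(2) by auto
      ultimately have "a \<odot>\<^bsub>M\<^esub> x \<in> ?T i j x"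
        using w(3) ij by (intro CollectI exI[of _ w]) (simp only: if_True simp_thms add_0)
      then show ?case by (rule V.lin_incl)
    qed
    then show ?thesis
      using ij x by (simp add: V.congr_def smult_diff smult_assoc smult_closed)
  qed
  have mixed: "V.congr (V.lin (?T i N x)) (?op i (?op N x)) (?op N (?op i x))"
    if i: "i < N" and x: "x \<in> carrier M" for i x
  proof -
    have "?op i (?op N x) = (z i \<otimes> \<alpha>) \<odot>\<^bsub>M\<^esub> x" using i x \<alpha> by (simp add: smult_assoc)
    also have "\<dots> = ?op N (?op i x) \<oplus>\<^bsub>M\<^esub> \<kappa> (e i) \<odot>\<^bsub>M\<^esub> (\<alpha> \<odot>\<^bsub>M\<^esub> x)"
      using i x \<alpha> by (simp add: eig smult_l_distr smult_assoc)
    finally have d: "?op i (?op N x) \<ominus>\<^bsub>M\<^esub> ?op N (?op i x) = \<kappa> (e i) \<odot>\<^bsub>M\<^esub> (\<alpha> \<odot>\<^bsub>M\<^esub> x)"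
      using i x \<alpha> by (simp add: smult_closed a_minus_def M.a_comm[of "_ \<odot>\<^bsub>M\<^esub> (z i \<odot>\<^bsub>M\<^esub> x)"] M.a_assoc M.r_neg)
    have "\<kappa> (e i) \<odot>\<^bsub>M\<^esub> (\<alpha> \<odot>\<^bsub>M\<^esub> x) \<in> V.lin (?T i N x)"
    proof (cases "wt i = 0")
      case True
      then have "\<kappa> (e i) \<odot>\<^bsub>M\<^esub> (\<alpha> \<odot>\<^bsub>M\<^esub> x) = \<zero>\<^bsub>M\<^esub>"
        using eig0[OF i] x \<alpha> V.sc_zero_left[of "\<alpha> \<odot>\<^bsub>M\<^esub> x"] by (simp add: smult_closed)
      then show ?thesis using V.csubspaceD(2)[OF T[OF x, of i N]] by (simp only:)
    next
      case False
      then have "\<alpha> \<odot>\<^bsub>M\<^esub> x \<in> ?T i N x"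
        using i by (intro CollectI exI[of _ "[N]"]) auto
      then show ?thesis by (rule V.csubspaceD(4)[OF T[OF x] V.lin_incl])
    qed
    then have "?op i (?op N x) \<ominus>\<^bsub>M\<^esub> ?op N (?op i x) \<in> V.lin (?T i N x)" unfolding d .
    moreover have "?op i (?op N x) \<in> carrier M" "?op N (?op i x) \<in> carrier M"
      using x i \<alpha> by (simp_all add: smult_closed)
    ultimately show ?thesis unfolding V.congr_def by blast
  qed
  show ?thesis
  proof unfold_locales
    fix i j x assume ij: "i < Suc N" "j < Suc N" and x: "x \<in> carrier M"
    have sym: "?T j i x = ?T i j x" by (simp add: add.commute)
    consider "i < N" "j < N" | "i < N" "j = N" | "i = N" "j < N" | "i = N" "j = N"
      using ij by linarith
    then show "V.congr (V.lin (?T i j x)) (?op i (?op j x)) (?op j (?op i x))"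
    proof cases
      case 1
      then show ?thesis by (rule letters[OF _ _ x])
    next
      case 2
      then show ?thesis using mixed[OF _ x] by blast
    next
      case 3
      show ?thesis using V.congr_sym[OF T[OF x] mixed[OF 3(2) x]] sym unfolding 3(1) by (simp only:)
    next
      case 4
      show ?thesis unfolding 4 by (rule V.congr_refl[OF T[OF x]]) (use x \<alpha> in \<open>simp add: smult_closed\<close>)
    qed
  next
    fix i x c assume "i < Suc N" "x \<in> carrier M"
    then show "?op i (\<kappa> c \<odot>\<^bsub>M\<^esub> x) = \<kappa> c \<odot>\<^bsub>M\<^esub> ?op i x"
      using \<alpha> by (simp add: scalar_central flip: smult_assoc)
  qed (use \<alpha> gen in \<open>auto simp: smult_simps\<close>)
qed

text \<open>A graded submodule of the Rees module \<open>\<Oplus>\<^sub>d \<alpha>\<^sup>d M\<close>, when its homogeneous parts \<open>H d\<close> lie in \<open>\<alpha>\<^sup>d M\<close>; in general, of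
  the sum of copies of \<open>M\<close> in all degrees.\<close>

definition rees_submodule :: "'a \<Rightarrow> (nat \<Rightarrow> 'c set) \<Rightarrow> bool" where
  "rees_submodule \<alpha> H \<longleftrightarrow> (\<forall>d. V.csubspace (H d)) \<and> (\<forall>i<N. \<forall>d. \<forall>v\<in>H d. z i \<odot>\<^bsub>M\<^esub> v \<in> H d)
     \<and> (\<forall>d. \<forall>v\<in>H d. \<alpha> \<odot>\<^bsub>M\<^esub> v \<in> H (Suc d))"

text \<open>The part \<open>\<alpha>\<^sup>d M\<close> of degree \<open>d\<close> is spanned by words with exactly \<open>d\<close> letters \<open>\<alpha>\<close>, so \<open>graded_noetherian\<close> applies to
  graded submodules of the Rees module.\<close>

lemma graded_finiteness:
  assumes fg: "finitely_generated_module A M"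
    and \<alpha>: "\<alpha> \<in> carrier A"
    and eig: "\<And>i. i < N \<Longrightarrow> z i \<otimes> \<alpha> = \<alpha> \<otimes> z i \<oplus> \<kappa> (e i) \<otimes> \<alpha>"
    and eig0: "\<And>i. i < N \<Longrightarrow> wt i = 0 \<Longrightarrow> e i = 0"
    and S: "rees_submodule \<alpha> S" "\<And>d. S d \<subseteq> (\<lambda>v. (\<alpha> [^] d) \<odot>\<^bsub>M\<^esub> v) ` carrier M"
  shows "\<exists>F. finite F \<and> (\<forall>(d, x)\<in>F. x \<in> S d) \<and>
    (\<forall>H. rees_submodule \<alpha> H \<longrightarrow> (\<forall>(d, x)\<in>F. x \<in> H d) \<longrightarrow> (\<forall>d. S d \<subseteq> H d))"
proof -
  obtain gen and p :: nat where gen: "\<And>i. i < p \<Longrightarrow> gen i \<in> carrier M"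
    and span: "carrier M \<subseteq> V.lin {foldr (\<lambda>i v. z i \<odot>\<^bsub>M\<^esub> v) w (gen i) | w i. set w \<subseteq> {..<N} \<and> i < p}"
    by (rule finite_generators_span[OF fg]) (rule that)
  let ?op = "\<lambda>i v. (if i < N then z i else \<alpha>) \<odot>\<^bsub>M\<^esub> v"
  let ?wt = "\<lambda>i. if i < N then wt i else 0"
  let ?dg = "\<lambda>i. if i < N then 0 else 1 :: nat"
  interpret W: weighted_operators M "\<lambda>c v. \<kappa> c \<odot>\<^bsub>M\<^esub> v" ?op "Suc N" ?wt ?dg gen p
    by (rule extended_operators[OF \<alpha> eig eig0 gen])
  have gs: "W.graded_subspace H \<longleftrightarrow> rees_submodule \<alpha> H" for H
    unfolding W.graded_subspace_def rees_submodule_def by (auto simp: less_Suc_eq)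
  have "S d \<subseteq> W.spanned d" for d
  proof
    fix x assume "x \<in> S d"
    then obtain v where v: "v \<in> carrier M" "x = (\<alpha> [^] d) \<odot>\<^bsub>M\<^esub> v" using S(2) by blast
    have sp: "V.csubspace (W.spanned d)"
      unfolding W.spanned_def by (rule V.csubspace_lin) (auto intro: W.act_closed)
    have pow: "(\<alpha> [^] k) \<odot>\<^bsub>M\<^esub> v = foldr ?op (replicate k N) v" if "v \<in> carrier M" for v k
      using that \<alpha>
    proof (induction k)
      case (Suc k)
      have "\<alpha> [^] Suc k = \<alpha> \<otimes> \<alpha> [^] k" using \<alpha> by (metis nat_pow_Suc2)
      then show ?case using Suc by (simp add: smult_assoc del: nat_pow_Suc)
    qed (simp add: smult_one)
    show "x \<in> W.spanned d"
      unfolding v(2)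
    proof (rule V.lin_map[where h = "\<lambda>v. (\<alpha> [^] d) \<odot>\<^bsub>M\<^esub> v", OF _ _ _ _ sp _ subsetD[OF span v(1)]])
      have w: "foldr (\<lambda>i v. z i \<odot>\<^bsub>M\<^esub> v) w (gen i) = foldr ?op w (gen i)" if "set w \<subseteq> {..<N}" for w i
        by (rule foldr_cong) (use that in auto)
      have ws: "set w \<subseteq> {..<Suc N}" if "set w \<subseteq> {..<N}" for w using that by auto
      show "{foldr (\<lambda>i v. z i \<odot>\<^bsub>M\<^esub> v) w (gen i) | w i. set w \<subseteq> {..<N} \<and> i < p} \<subseteq> carrier M"
        using w W.act_closed[OF ws gen] by auto
      fix x assume "x \<in> {foldr (\<lambda>i v. z i \<odot>\<^bsub>M\<^esub> v) w (gen i) | w i. set w \<subseteq> {..<N} \<and> i < p}"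
      then obtain w i where wi: "x = foldr ?op w (gen i)" "set w \<subseteq> {..<N}" "i < p"
        using w by auto
      then have "(\<alpha> [^] d) \<odot>\<^bsub>M\<^esub> x = foldr ?op (replicate d N @ w) (gen i)"
        using pow W.act_closed[OF ws gen] by simp
      moreover have "sum_list (map ?dg w) = 0" using wi(2) by (auto intro!: sum_list_0)
      then have "sum_list (map ?dg (replicate d N @ w)) = d" by (simp add: sum_list_replicate)
      moreover have "set (replicate d N @ w) \<subseteq> {..<Suc N}" using ws[OF wi(2)] by auto
      ultimately show "(\<alpha> [^] d) \<odot>\<^bsub>M\<^esub> x \<in> W.spanned d"
        unfolding W.spanned_def using wi(3) by (intro V.lin_incl) blast
    next
      fix c x assume "x \<in> carrier M"
      then show "(\<alpha> [^] d) \<odot>\<^bsub>M\<^esub> (\<kappa> c \<odot>\<^bsub>M\<^esub> x) = \<kappa> c \<odot>\<^bsub>M\<^esub> ((\<alpha> [^] d) \<odot>\<^bsub>M\<^esub> x)"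
        using \<alpha> by (simp add: scalar_central flip: smult_assoc)
    qed (use \<alpha> in \<open>auto simp: smult_simps\<close>)
  qed
  then show ?thesis
    using W.graded_noetherian[of S] S(1) by (simp only: gs simp_thms)
qed

text \<open>The constant family \<open>U\<close> is a graded submodule of the Rees module for \<open>\<alpha> = 1\<close>, and its generators, with degrees
  forgotten, generate \<open>U\<close>.\<close>

theorem noetherian:
  assumes fg: "finitely_generated_module A M" and U: "submodule U A M"
  shows "\<exists>F\<subseteq>U. finite F \<and> (\<forall>H. submodule H A M \<longrightarrow> F \<subseteq> H \<longrightarrow> U \<subseteq> H)"
proof -
  note Us = submodule_space[OF U]
  have z1: "z i \<otimes> \<one> = \<one> \<otimes> z i \<oplus> \<kappa> 0 \<otimes> \<one>" if "i < N" for i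
    using that by (simp add: scalar_zero)
  have UM: "U \<subseteq> carrier M" using V.csubspaceD(1)[OF Us] by blast
  have const: "rees_submodule \<one> (\<lambda>_. H) \<longleftrightarrow> submodule H A M" for H
    using submodule_of_letters[of H] submodule_space[of H] submodule.smult_closed[of H A M]
      V.csubspaceD(1)[of H] by (auto simp: rees_submodule_def smult_one)
  obtain F where F: "finite F \<and> (\<forall>(d::nat, x)\<in>F. x \<in> U) \<and>
    (\<forall>H. rees_submodule \<one> H \<longrightarrow> (\<forall>(d, x)\<in>F. x \<in> H d) \<longrightarrow> (\<forall>d. U \<subseteq> H d))"
    using graded_finiteness[OF fg one_closed z1, of "\<lambda>_. U"] U UM
    by (auto simp: const smult_one)
  have "U \<subseteq> H" if H: "submodule H A M" "snd ` F \<subseteq> H" for H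
  proof -
    have "\<forall>(d, x)\<in>F. x \<in> H" using H(2) by force
    then show ?thesis
      using F H(1) const[of H] by blast
  qed
  moreover have "snd ` F \<subseteq> U" using F by force
  ultimately show ?thesis using F by (intro exI[of _ "snd ` F"]) auto
qed

text \<open>The family \<open>\<alpha>\<^sup>d M \<inter> U\<close> has generators of bounded degree. If \<open>n\<^sub>0\<close> bounds the degrees, the family with parts
  \<open>\<alpha>\<^bsup>d-n\<^sub>0\<^esup> U\<close> (truncated subtraction) is a graded submodule that contains the generators, hence contains the whole family.\<close>

theorem artin_rees:
  assumes fg: "finitely_generated_module A M" and U: "submodule U A M"
    and \<alpha>: "\<alpha> \<in> carrier A"
    and eig: "\<And>i. i < N \<Longrightarrow> z i \<otimes> \<alpha> = \<alpha> \<otimes> z i \<oplus> \<kappa> (e i) \<otimes> \<alpha>"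
    and eig0: "\<And>i. i < N \<Longrightarrow> wt i = 0 \<Longrightarrow> e i = 0"
  shows "\<exists>n\<^sub>0::nat. \<forall>k\<ge>n\<^sub>0. (\<lambda>v. (\<alpha> [^] k) \<odot>\<^bsub>M\<^esub> v) ` carrier M \<inter> U \<subseteq>
    (\<lambda>v. (\<alpha> [^] (k - n\<^sub>0)) \<odot>\<^bsub>M\<^esub> v) ` U"
proof -
  note Us = submodule_space[OF U]
  note Ud = V.csubspaceD[OF Us]
  note Ua = submodule.smult_closed[OF U]
  \<comment> \<open>Each letter moves past \<open>\<alpha>\<^sup>d\<close> at the cost of a scalar correction, so \<open>\<alpha>\<^sup>d U\<close> is again a submodule.\<close>
  have normal: "\<exists>a\<in>carrier A. z i \<otimes> \<alpha> [^] d = \<alpha> [^] d \<otimes> a" if i: "i < N" for i and d :: nat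
  proof (induction d)
    case 0
    then show ?case using i by (intro bexI[of _ "z i"]) auto
  next
    case (Suc d)
    then obtain a where a: "a \<in> carrier A" "z i \<otimes> \<alpha> [^] d = \<alpha> [^] d \<otimes> a" by blast
    have "z i \<otimes> \<alpha> [^] Suc d = (\<alpha> \<otimes> z i \<oplus> \<alpha> \<otimes> \<kappa> (e i)) \<otimes> \<alpha> [^] d"
      using i \<alpha> nat_pow_Suc2[OF \<alpha>, of d] eig[OF i]
      by (simp add: scalar_central del: nat_pow_Suc flip: m_assoc)
    also have "\<dots> = \<alpha> \<otimes> (z i \<otimes> \<alpha> [^] d) \<oplus> \<alpha> \<otimes> (\<alpha> [^] d \<otimes> \<kappa> (e i))"
      using i \<alpha> by (simp add: l_distr m_assoc scalar_central)
    also have "\<dots> = \<alpha> \<otimes> \<alpha> [^] d \<otimes> (a \<oplus> \<kappa> (e i))"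
      using i \<alpha> a by (simp add: r_distr m_assoc)
    finally show ?case
      using \<alpha> a nat_pow_Suc2[OF \<alpha>, of d] by (intro bexI[of _ "a \<oplus> \<kappa> (e i)"]) auto
  qed
  define pow where "pow d v = (\<alpha> [^] d) \<odot>\<^bsub>M\<^esub> v" for d :: nat and v
  have pow_sub: "V.csubspace (pow d ` W)" if W: "V.csubspace W" for d W
  proof (rule V.csubspaceI)
    have "pow d (\<zero>\<^bsub>M\<^esub>) = \<zero>\<^bsub>M\<^esub>"
      using \<alpha> smult_r_distr[of "\<alpha> [^] d" "\<zero>\<^bsub>M\<^esub>" "\<zero>\<^bsub>M\<^esub>"]
      by (simp add: pow_def M.add.l_cancel_one smult_closed)
    then show "\<zero>\<^bsub>M\<^esub> \<in> pow d ` W" using V.csubspaceD(2)[OF W] by force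
  next
    fix x y assume "x \<in> pow d ` W" "y \<in> pow d ` W"
    then obtain x' y' where "x = pow d x'" "y = pow d y'" "x' \<in> W" "y' \<in> W" by blast
    then show "x \<oplus>\<^bsub>M\<^esub> y \<in> pow d ` W"
      using \<alpha> V.csubspaceD[OF W] by (auto simp: pow_def image_iff smult_r_distr intro!: bexI[of _ "x' \<oplus>\<^bsub>M\<^esub> y'"])
  next
    fix c x assume "x \<in> pow d ` W"
    then obtain x' where x': "x = pow d x'" "x' \<in> W" by blast
    then have "\<kappa> c \<odot>\<^bsub>M\<^esub> x = pow d (\<kappa> c \<odot>\<^bsub>M\<^esub> x')"
      using \<alpha> V.csubspaceD(1)[OF W] by (simp add: pow_def scalar_central flip: smult_assoc)
    then show "\<kappa> c \<odot>\<^bsub>M\<^esub> x \<in> pow d ` W" using V.csubspaceD(4)[OF W] x' by blast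
  qed (use \<alpha> V.csubspaceD(1)[OF W] in \<open>auto simp: pow_def smult_closed\<close>)
  have pow_z: "z i \<odot>\<^bsub>M\<^esub> v \<in> pow d ` W" if iN: "i < N" and vW: "v \<in> pow d ` W" and W: "submodule W A M" for i d v W
  proof -
    note Ws = V.csubspaceD(1)[OF submodule_space[OF W]]
    obtain a where a: "a \<in> carrier A" "z i \<otimes> \<alpha> [^] d = \<alpha> [^] d \<otimes> a"
      using normal[OF iN] by blast
    obtain w where w: "w \<in> W" "v = pow d w" using vW by blast
    then have "z i \<odot>\<^bsub>M\<^esub> v = pow d (a \<odot>\<^bsub>M\<^esub> w)"
      using a \<alpha> iN Ws by (simp add: pow_def flip: smult_assoc)
    then show ?thesis using submodule.smult_closed[OF W] a w by blast
  qed
  have pow_\<alpha>: "\<alpha> \<odot>\<^bsub>M\<^esub> pow d v = pow (Suc d) v" if "v \<in> carrier M" for d v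
    using \<alpha> that nat_pow_Suc2[OF \<alpha>, of d] by (simp add: pow_def flip: smult_assoc del: nat_pow_Suc)
  have M: "submodule (carrier M) A M"
    by (rule submodule_of_subspace) (auto simp: V.csubspace_carrier smult_closed)
  define S where "S d = pow d ` carrier M \<inter> U" for d
  have Sspace: "V.csubspace (S d)" for d
    unfolding S_def using pow_sub[OF V.csubspace_carrier, of d] Us by (auto simp: V.csubspace_def)
  have Sz: "z i \<odot>\<^bsub>M\<^esub> v \<in> S d" if "i < N" "v \<in> S d" for i d v
    using that pow_z[OF that(1) _ M, of v d] Ua by (auto simp: S_def)
  have S\<alpha>: "\<alpha> \<odot>\<^bsub>M\<^esub> v \<in> S (Suc d)" if "v \<in> S d" for d v
    using that pow_\<alpha> Ua[OF \<alpha>] by (auto simp: S_def)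
  have rees: "rees_submodule \<alpha> S" using Sspace Sz S\<alpha> by (simp add: rees_submodule_def)
  have homogeneous: "S d \<subseteq> (\<lambda>v. (\<alpha> [^] d) \<odot>\<^bsub>M\<^esub> v) ` carrier M" for d
    by (auto simp: S_def pow_def)
  have "\<exists>F. finite F \<and> (\<forall>(d, x)\<in>F. x \<in> S d) \<and>
    (\<forall>H. rees_submodule \<alpha> H \<longrightarrow> (\<forall>(d, x)\<in>F. x \<in> H d) \<longrightarrow> (\<forall>d. S d \<subseteq> H d))"
    by (rule graded_finiteness[of \<alpha> e S]) (fact fg \<alpha> eig eig0 rees homogeneous)+
  then obtain F where F: "finite F \<and> (\<forall>(d, x)\<in>F. x \<in> S d) \<and>
    (\<forall>H. rees_submodule \<alpha> H \<longrightarrow> (\<forall>(d, x)\<in>F. x \<in> H d) \<longrightarrow> (\<forall>d. S d \<subseteq> H d))" ..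
  \<comment> \<open>The element \<open>0\<close> keeps the maximum defined when there are no generators.\<close>
  define n0 where "n0 = Max (insert 0 (fst ` F))"
  define H where "H d = pow (d - n0) ` U" for d
  have pow0: "pow 0 v = v" if "v \<in> carrier M" for v using that by (simp add: pow_def smult_one)
  have H0: "H d = U" if "d \<le> n0" for d
    using that Ud(1) pow0 by (force simp: H_def image_iff)
  have "rees_submodule \<alpha> H"
    unfolding rees_submodule_def
  proof (intro conjI)
    show "\<forall>d. V.csubspace (H d)" by (simp add: H_def pow_sub Us)
    show "\<forall>i<N. \<forall>d. \<forall>v\<in>H d. z i \<odot>\<^bsub>M\<^esub> v \<in> H d" using pow_z[OF _ _ U] by (simp add: H_def)
    show "\<forall>d. \<forall>v\<in>H d. \<alpha> \<odot>\<^bsub>M\<^esub> v \<in> H (Suc d)"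
    proof (intro allI ballI)
      fix d v assume v: "v \<in> H d"
      show "\<alpha> \<odot>\<^bsub>M\<^esub> v \<in> H (Suc d)"
      proof (cases "d < n0")
        case True
        then show ?thesis using v H0 Ua[OF \<alpha>] by simp
      next
        case False
        then have "Suc d - n0 = Suc (d - n0)" by simp
        then show ?thesis using v Ud(1) pow_\<alpha> by (auto simp: H_def)
      qed
    qed
  qed
  moreover have "\<forall>(d, x)\<in>F. x \<in> H d"
  proof safe
    fix d x assume dx: "(d, x) \<in> F"
    then have "d \<le> n0" using F by (force simp: n0_def intro!: Max_ge)
    then show "x \<in> H d" using F dx H0 by (auto simp: S_def)
  qed
  ultimately have "\<forall>d. S d \<subseteq> H d" using F by blast
  then show ?thesis
    by (intro exI[of _ n0]) (simp add: S_def H_def pow_def)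
qed

end

section \<open>Algebras generated by commuting functions and vector fields\<close>

text \<open>A description of the generators by sets: \<open>B\<close> and the scalars generate a commutative algebra of functions, \<open>D\<close> consists
  of vector fields. A commutator of a vector field with a function is a function, and one of two vector fields is a combination of
  \<open>D\<close> and \<open>1\<close> with function coefficients.\<close>

locale filtered_generators = complex_algebra_ring A \<kappa> for A (structure) and \<kappa> +
  fixes B D :: "'a set"
  assumes finite_B: "finite B" and finite_D: "finite D"
    and B_closed: "B \<subseteq> carrier A" and D_closed: "D \<subseteq> carrier A"
    and B_commute: "\<lbrakk>b \<in> B; b' \<in> B\<rbrakk> \<Longrightarrow> b \<otimes> b' = b' \<otimes> b"
    and D_B_commute: "\<lbrakk>d \<in> D; b \<in> B\<rbrakk> \<Longrightarrow>
      \<exists>c\<in>generate_ring A (range \<kappa> \<union> B). d \<otimes> b = b \<otimes> d \<oplus> c"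
    and D_D_commute: "\<lbrakk>d \<in> D; d' \<in> D\<rbrakk> \<Longrightarrow>
      \<exists>c\<in>A.lin {b \<otimes> d | b d. b \<in> generate_ring A (range \<kappa> \<union> B) \<and> d \<in> insert \<one> D}.
        d \<otimes> d' = d' \<otimes> d \<oplus> c"
    and generated: "carrier A = generate_ring A (range \<kappa> \<union> B \<union> D)"
begin

text \<open>Functions get weight zero and vector fields weight one. A word with at most one vector field, multiplied by a word
  in functions alone, still has at most one vector field, so \<open>low 1\<close> contains all combinations of vector fields with
  function coefficients.\<close>

lemma weighted_listing:
  obtains z and N :: nat and wt where "weighted_generators A \<kappa> z N wt"
    and "\<And>i. i < N \<Longrightarrow> (z i \<in> B \<and> wt i = 0) \<or> (z i \<in> D \<and> wt i = 1)"
proof -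
  obtain bs ds where lists: "set bs = B" "set ds = D"
    using finite_B finite_D finite_list by metis
  define z where "z i = (bs @ ds) ! i" for i
  define N where "N = length (bs @ ds)"
  define wt :: "nat \<Rightarrow> nat" where "wt i = (if i < length bs then 0 else 1)" for i
  have cases: "(z i \<in> B \<and> wt i = 0) \<or> (z i \<in> D \<and> wt i = 1)" if "i < N" for i
    using that unfolding z_def N_def wt_def lists[symmetric] by (auto simp: nth_append)
  have zA: "z i \<in> carrier A" if "i < N" for i
    using cases[OF that] B_closed D_closed by blast
  have index: "\<exists>i<N. z i = b \<and> wt i = 0" if "b \<in> B" for b
  proof -
    have "b \<in> set bs" using that lists(1) by simp
    then obtain i where "i < length bs" "bs ! i = b" by (auto simp only: in_set_conv_nth)
    then show ?thesis by (intro exI[of _ i]) (auto simp: z_def N_def wt_def nth_append)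
  qed
  have index': "\<exists>i<N. z i = d \<and> wt i = 1" if "d \<in> D" for d
  proof -
    have "d \<in> set ds" using that lists(2) by simp
    then obtain i where "i < length ds" "ds ! i = d" by (auto simp only: in_set_conv_nth)
    then show ?thesis by (intro exI[of _ "length bs + i"]) (auto simp: z_def N_def wt_def nth_append)
  qed
  define words where "words P = A.lin {foldr (\<otimes>) (map z w) \<one> | w. set w \<subseteq> {..<N} \<and> P w}" for P
  have words: "A.csubspace (words P)" for P
    unfolding words_def by (rule A.csubspace_lin) (use zA in \<open>auto intro!: foldr_mult_closed simp: subset_iff\<close>)
  have words_one: "\<one> \<in> words P" if "P []" for P
    unfolding words_def using that by (intro A.lin_incl) (auto intro!: exI[of _ "[]"])
  have words_scalar: "\<kappa> c \<in> words P" if "P []" for c P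
    using A.csubspaceD(4)[OF words words_one[of P, OF that], of c] by simp
  have words_letter: "z i \<in> words P" if "P [i]" "i < N" for i P
    unfolding words_def using that zA by (intro A.lin_incl) (auto intro!: exI[of _ "[i]"])
  have in_words_B: "b \<in> words P" if "b \<in> B" "\<And>i. wt i = 0 \<Longrightarrow> P [i]" for b P
    using index[OF that(1)] that(2) words_letter by metis
  have in_words_D: "d \<in> words P" if "d \<in> D" "\<And>i. wt i = 1 \<Longrightarrow> P [i]" for d P
    using index'[OF that(1)] that(2) words_letter by metis
  have words_mult: "a \<otimes> b \<in> words R" if "\<And>u w. P u \<Longrightarrow> Q w \<Longrightarrow> R (u @ w)" "a \<in> words P" "b \<in> words Q"
    for a b P Q R
    using lin_words_mult[of N z P Q R a b] that zA unfolding words_def by blast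
  define low where "low k = words (\<lambda>w. sum_list (map wt w) \<le> k)" for k
  have low_mult: "a \<otimes> b \<in> low (j + k)" if "a \<in> low j" "b \<in> low k" for a b j k
    unfolding low_def by (rule words_mult[OF _ that[unfolded low_def]]) simp
  have zero_part: "generate_ring A (range \<kappa> \<union> B) \<subseteq> low 0"
  proof (rule generate_ring_subset)
    show "range \<kappa> \<union> B \<subseteq> low 0"
      using words_scalar[of "\<lambda>w. sum_list (map wt w) \<le> 0"]
        in_words_B[of _ "\<lambda>w. sum_list (map wt w) \<le> 0"] by (auto simp: low_def)
  qed (use low_mult[of _ 0 _ 0] words words_one in \<open>auto simp: low_def\<close>)
  have first_part: "A.lin {b \<otimes> d | b d. b \<in> generate_ring A (range \<kappa> \<union> B) \<and> d \<in> insert \<one> D} \<subseteq> low 1"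
  proof (rule A.lin_least)
    show "A.csubspace (low 1)" by (simp add: low_def words)
    have "insert \<one> D \<subseteq> low 1"
      using in_words_D[of _ "\<lambda>w. sum_list (map wt w) \<le> 1"] words_one by (auto simp: low_def)
    then show "{b \<otimes> d | b d. b \<in> generate_ring A (range \<kappa> \<union> B) \<and> d \<in> insert \<one> D} \<subseteq> low 1"
      using low_mult[of _ 0 _ 1] zero_part by auto
  qed
  have diff: "a \<ominus> b = c" if "a = b \<oplus> c" "b \<in> carrier A" "c \<in> carrier A" for a b c
    using that by (simp add: a_minus_def a_comm[of b] a_assoc r_neg)
  have "weighted_generators A \<kappa> z N wt"
  proof unfold_locales
    fix i j assume ij: "i < N" "j < N"
    let ?P = "\<lambda>w. sum_list (map wt w) < wt i + wt j"
    have "z i \<otimes> z j \<ominus> z j \<otimes> z i \<in> words ?P"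
    proof -
      consider "z i \<in> B" "z j \<in> B" | "z i \<in> D" "z j \<in> B" "wt i = 1" "wt j = 0"
        | "z i \<in> B" "z j \<in> D" "wt i = 0" "wt j = 1" | "z i \<in> D" "z j \<in> D" "wt i = 1" "wt j = 1"
        using cases[OF ij(1)] cases[OF ij(2)] by metis
      then show ?thesis
      proof cases
        case 1
        then have "z i \<otimes> z j \<ominus> z j \<otimes> z i = \<zero>"
          using B_commute[OF 1] zA ij by (simp add: a_minus_def r_neg)
        then show ?thesis using A.csubspaceD(2)[OF words] by simp
      next
        case 2
        then obtain c where c: "c \<in> low 0" "z i \<otimes> z j = z j \<otimes> z i \<oplus> c"
          using D_B_commute[OF 2(1,2)] zero_part by blast
        have "c \<in> words ?P" using c(1) 2 by (simp add: low_def less_Suc_eq_le)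
        then show ?thesis using diff[OF c(2)] A.csubspaceD(1)[OF words] zA ij by simp
      next
        case 3
        then obtain c where c: "c \<in> low 0" "z j \<otimes> z i = z i \<otimes> z j \<oplus> c"
          using D_B_commute[OF 3(2,1)] zero_part by blast
        have cP: "c \<in> words ?P" using c(1) 3 by (simp add: low_def less_Suc_eq_le)
        then have cA: "c \<in> carrier A" using A.csubspaceD(1)[OF words] by blast
        have "z i \<otimes> z j \<ominus> z j \<otimes> z i = \<ominus> (z j \<otimes> z i \<ominus> z i \<otimes> z j)"
          using zA ij by (simp add: a_minus_def minus_add a_comm)
        then have "z i \<otimes> z j \<ominus> z j \<otimes> z i = \<ominus> c" using diff[OF c(2)] cA zA ij by simp
        then show ?thesis using A.csubspace_minus[OF words cP] by simp
      next
        case 4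
        then obtain c where c: "c \<in> low 1" "z i \<otimes> z j = z j \<otimes> z i \<oplus> c"
          using D_D_commute[OF 4(1,2)] first_part by blast
        have "c \<in> words ?P" using c(1) 4 by (simp add: low_def less_Suc_eq_le)
        then show ?thesis using diff[OF c(2)] A.csubspaceD(1)[OF words] zA ij by simp
      qed
    qed
    then show "z i \<otimes> z j \<ominus> z j \<otimes> z i \<in>
      A.lin {foldr (\<otimes>) (map z w) \<one> | w. set w \<subseteq> {..<N} \<and> sum_list (map wt w) < wt i + wt j}"
      by (simp add: words_def)
  next
    have "carrier A \<subseteq> words (\<lambda>_. True)"
      unfolding generated
    proof (rule generate_ring_subset)
      show "range \<kappa> \<union> B \<union> D \<subseteq> words (\<lambda>_. True)"
        using words_scalar[of "\<lambda>_. True"] in_words_B[of _ "\<lambda>_. True"] in_words_D[of _ "\<lambda>_. True"]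
        by auto
    qed (use words words_one words_mult[of "\<lambda>_. True" "\<lambda>_. True" "\<lambda>_. True"] in auto)
    then show "carrier A \<subseteq> A.lin {foldr (\<otimes>) (map z w) \<one> | w. set w \<subseteq> {..<N}}"
      by (simp add: words_def)
  qed (rule zA)
  then show thesis by (rule that) (rule cases)
qed

theorem noetherian_module:
  assumes "left_module A M" "finitely_generated_module A M" "submodule U A M"
  shows "\<exists>F\<subseteq>U. finite F \<and> (\<forall>H. submodule H A M \<longrightarrow> F \<subseteq> H \<longrightarrow> U \<subseteq> H)"
proof -
  obtain z and N :: nat and wt where "weighted_generators A \<kappa> z N wt"
    by (rule weighted_listing)
  then interpret weighted_module A \<kappa> z N wt M
    using assms(1) by (simp add: weighted_module_def)
  show ?thesis by (rule noetherian[OF assms(2,3)])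
qed

theorem artin_rees_eigenelement:
  assumes M: "left_module A M" "finitely_generated_module A M" "submodule U A M"
    and \<alpha>: "\<alpha> \<in> carrier A" "\<And>b. b \<in> B \<Longrightarrow> b \<otimes> \<alpha> = \<alpha> \<otimes> b"
      "\<And>d. d \<in> D \<Longrightarrow> \<exists>e. d \<otimes> \<alpha> = \<alpha> \<otimes> d \<oplus> \<kappa> e \<otimes> \<alpha>"
  shows "\<exists>n\<^sub>0::nat. \<forall>k\<ge>n\<^sub>0. (\<lambda>v. (\<alpha> [^] k) \<odot>\<^bsub>M\<^esub> v) ` carrier M \<inter> U \<subseteq>
    (\<lambda>v. (\<alpha> [^] (k - n\<^sub>0)) \<odot>\<^bsub>M\<^esub> v) ` U"
proof -
  obtain z and N :: nat and wt where z: "weighted_generators A \<kappa> z N wt"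
    and cases: "\<And>i. i < N \<Longrightarrow> (z i \<in> B \<and> wt i = 0) \<or> (z i \<in> D \<and> wt i = 1)"
    by (rule weighted_listing) (rule that)
  interpret weighted_module A \<kappa> z N wt M
    using M(1) z by (simp add: weighted_module_def)
  have "\<exists>e. z i \<otimes> \<alpha> = \<alpha> \<otimes> z i \<oplus> \<kappa> e \<otimes> \<alpha> \<and> (wt i = 0 \<longrightarrow> e = 0)" if i: "i < N" for i
  proof (cases "wt i = 0")
    case True
    then have "z i \<in> B" using cases[OF i] by auto
    then show ?thesis using \<alpha>(1,2) i by (intro exI[of _ 0]) (simp add: scalar_zero)
  next
    case False
    then show ?thesis using cases[OF i] \<alpha>(3) by auto
  qed
  then obtain e where e: "\<And>i. i < N \<Longrightarrow> z i \<otimes> \<alpha> = \<alpha> \<otimes> z i \<oplus> \<kappa> (e i) \<otimes> \<alpha>"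
    "\<And>i. i < N \<Longrightarrow> wt i = 0 \<Longrightarrow> e i = 0"
    by metis
  show ?thesis by (rule artin_rees[OF M(2,3) \<alpha>(1) e])
qed

end

section \<open>Tensor products of complex algebras\<close>

text \<open>Multiplication of formal sums of pairs is bilinear, so identities between formal sums are reduced to single pairs by
  induction, and pass to the quotient by the ideal of relations.\<close>

locale tensor_product = A: complex_algebra_ring A \<phi> + B: complex_algebra_ring B \<psi>
  for A (structure) and \<phi> and B (structure) and \<psi>
begin

abbreviation "PR \<equiv> pair_ring A B"
abbreviation "T \<equiv> tensor_ring A \<phi> B \<psi>"
abbreviation "pure \<equiv> pure_tensor A \<phi> B \<psi>"

lemma pair_mult_of: "frag_of (a, b) \<otimes>\<^bsub>PR\<^esub> frag_of (a', b') = frag_of (a \<otimes>\<^bsub>A\<^esub> a', b \<otimes>\<^bsub>B\<^esub> b')"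
  by (simp add: pair_ring_def)

lemma pair_mult_zero: "0 \<otimes>\<^bsub>PR\<^esub> q = 0" "p \<otimes>\<^bsub>PR\<^esub> 0 = 0"
proof -
  show "0 \<otimes>\<^bsub>PR\<^esub> q = 0" by (simp add: pair_ring_def)
  show "p \<otimes>\<^bsub>PR\<^esub> 0 = 0" unfolding pair_ring_def by (simp add: frag_extend_eq_0 split: prod.split)
qed

lemma pair_mult_diff_left: "(p - p') \<otimes>\<^bsub>PR\<^esub> q = p \<otimes>\<^bsub>PR\<^esub> q - p' \<otimes>\<^bsub>PR\<^esub> q"
  by (simp add: pair_ring_def frag_extend_diff)

lemma pair_mult_diff_right: "p \<otimes>\<^bsub>PR\<^esub> (q - q') = p \<otimes>\<^bsub>PR\<^esub> q - p \<otimes>\<^bsub>PR\<^esub> q'"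
proof -
  have "Poly_Mapping.keys p \<subseteq> UNIV" by simp
  then show ?thesis
  proof (induction p rule: frag_induction)
    case (one x)
    then show ?case by (cases x) (simp add: pair_ring_def frag_extend_diff)
  next
    case (diff a b)
    then show ?case by (simp add: pair_mult_diff_left)
  qed (simp add: pair_mult_zero)
qed

lemma pair_carrier: "p \<in> carrier PR \<longleftrightarrow> Poly_Mapping.keys p \<subseteq> carrier A \<times> carrier B"
  by (simp add: pair_ring_def)

lemma pair_of_carrier [simp]: "frag_of (a, b) \<in> carrier PR \<longleftrightarrow> a \<in> carrier A \<and> b \<in> carrier B"
  by (simp add: pair_carrier)

lemma pair_diff_closed: "p \<in> carrier PR \<Longrightarrow> q \<in> carrier PR \<Longrightarrow> p - q \<in> carrier PR"
  unfolding pair_carrier using keys_diff[of p q] by blast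

lemma pair_zero_closed: "0 \<in> carrier PR"
  by (simp add: pair_carrier)

lemma pair_induct [consumes 1, case_names zero of diff]:
  assumes "p \<in> carrier PR" "Q 0"
    and "\<And>a b. a \<in> carrier A \<Longrightarrow> b \<in> carrier B \<Longrightarrow> Q (frag_of (a, b))"
    and "\<And>p q. Q p \<Longrightarrow> Q q \<Longrightarrow> Q (p - q)"
  shows "Q p"
proof -
  have "Poly_Mapping.keys p \<subseteq> carrier A \<times> carrier B" using assms(1) pair_carrier by blast
  then show ?thesis by (induction p rule: frag_induction) (use assms in auto)
qed

lemma pair_mult_closed: "p \<in> carrier PR \<Longrightarrow> q \<in> carrier PR \<Longrightarrow> p \<otimes>\<^bsub>PR\<^esub> q \<in> carrier PR"
proof (induction p rule: pair_induct)
  case (of a b)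
  from of(3) show ?case
    by (induction q rule: pair_induct)
       (use of in \<open>auto simp: pair_mult_zero pair_mult_of pair_mult_diff_right
          intro: pair_zero_closed pair_diff_closed\<close>)
qed (auto simp: pair_mult_zero pair_mult_diff_left intro: pair_zero_closed pair_diff_closed)

lemma pair_mult_assoc:
  assumes "p \<in> carrier PR" "q \<in> carrier PR" "r \<in> carrier PR"
  shows "(p \<otimes>\<^bsub>PR\<^esub> q) \<otimes>\<^bsub>PR\<^esub> r = p \<otimes>\<^bsub>PR\<^esub> (q \<otimes>\<^bsub>PR\<^esub> r)"
  using assms(1)
proof (induction p rule: pair_induct)
  case (of a b)
  from assms(2) show ?case
  proof (induction q rule: pair_induct)
    case (of a' b')
    from assms(3) show ?case
      by (induction r rule: pair_induct)
         (use of \<open>a \<in> carrier A\<close> \<open>b \<in> carrier B\<close> in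
           \<open>auto simp: pair_mult_zero pair_mult_of pair_mult_diff_right A.m_assoc B.m_assoc\<close>)
  qed (auto simp: pair_mult_zero pair_mult_diff_left pair_mult_diff_right)
qed (auto simp: pair_mult_zero pair_mult_diff_left)

lemma pair_ops: "\<one>\<^bsub>PR\<^esub> = frag_of (\<one>\<^bsub>A\<^esub>, \<one>\<^bsub>B\<^esub>)" "\<zero>\<^bsub>PR\<^esub> = 0" "p \<oplus>\<^bsub>PR\<^esub> q = p + q"
  by (simp_all add: pair_ring_def)

lemma pair_add_closed: "p \<in> carrier PR \<Longrightarrow> q \<in> carrier PR \<Longrightarrow> p + q \<in> carrier PR"
  using pair_diff_closed[of p "0 - q"] pair_diff_closed[OF pair_zero_closed] by simp

lemma pair_one:
  assumes "p \<in> carrier PR"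
  shows "\<one>\<^bsub>PR\<^esub> \<otimes>\<^bsub>PR\<^esub> p = p" "p \<otimes>\<^bsub>PR\<^esub> \<one>\<^bsub>PR\<^esub> = p"
  using assms
  by (induction p rule: pair_induct)
     (auto simp: pair_ops pair_mult_zero pair_mult_of pair_mult_diff_left pair_mult_diff_right)

lemma pair_ring_ring: "ring PR"
proof (rule ringI)
  show "abelian_group PR"
  proof (rule abelian_groupI)
    fix x assume "x \<in> carrier PR"
    then show "\<exists>y\<in>carrier PR. y \<oplus>\<^bsub>PR\<^esub> x = \<zero>\<^bsub>PR\<^esub>"
      using pair_diff_closed[OF pair_zero_closed] by (intro bexI[of _ "0 - x"]) (auto simp: pair_ops)
  qed (auto simp: pair_ops add_ac intro: pair_add_closed pair_zero_closed)
  show "monoid PR"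
    by (rule monoidI) (auto simp: pair_ops(1) pair_mult_assoc pair_mult_closed pair_one[unfolded pair_ops])
next
  fix x y z
  show "(x \<oplus>\<^bsub>PR\<^esub> y) \<otimes>\<^bsub>PR\<^esub> z = x \<otimes>\<^bsub>PR\<^esub> z \<oplus>\<^bsub>PR\<^esub> y \<otimes>\<^bsub>PR\<^esub> z"
    using pair_mult_diff_left[of x "0 - y" z] pair_mult_diff_left[of 0 y z]
    by (simp add: pair_ops pair_mult_zero)
  show "z \<otimes>\<^bsub>PR\<^esub> (x \<oplus>\<^bsub>PR\<^esub> y) = z \<otimes>\<^bsub>PR\<^esub> x \<oplus>\<^bsub>PR\<^esub> z \<otimes>\<^bsub>PR\<^esub> y"
    using pair_mult_diff_right[of z x "0 - y"] pair_mult_diff_right[of z 0 y]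
    by (simp add: pair_ops pair_mult_zero)
qed

lemma relations_carrier: "tensor_relations A \<phi> B \<psi> \<subseteq> carrier PR"
  unfolding tensor_relations_def by (auto intro!: pair_diff_closed)

lemma tensor_ideal: "ideal (tensor_ideal A \<phi> B \<psi>) PR"
  unfolding tensor_ideal_def by (rule ring.genideal_ideal[OF pair_ring_ring relations_carrier])

lemma tensor_ring_ring: "ring T"
  unfolding tensor_ring_def by (rule ideal.quotient_is_ring[OF tensor_ideal])

abbreviation "proj \<equiv> \<lambda>p. tensor_ideal A \<phi> B \<psi> +>\<^bsub>PR\<^esub> p"

lemma proj_hom: "proj \<in> ring_hom PR T"
  unfolding tensor_ring_def by (rule ideal.rcos_ring_hom[OF tensor_ideal])

lemma proj_diff:
  assumes "p \<in> carrier PR" "q \<in> carrier PR"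
  shows "proj (p - q) = proj p \<ominus>\<^bsub>T\<^esub> proj q"
proof -
  interpret T: ring T by (rule tensor_ring_ring)
  have "proj p = proj ((p - q) + q)" by simp
  also have "\<dots> = proj (p - q) \<oplus>\<^bsub>T\<^esub> proj q"
    using ring_hom_add[OF proj_hom, of "p - q" q] pair_diff_closed assms by (simp add: pair_ops)
  finally show ?thesis
    using ring_hom_closed[OF proj_hom] assms pair_diff_closed[OF assms]
    by (simp add: T.minus_eq T.a_assoc T.r_neg)
qed

lemma pure_closed: "a \<in> carrier A \<Longrightarrow> b \<in> carrier B \<Longrightarrow> pure a b \<in> carrier T"
  unfolding pure_tensor_def by (rule ring_hom_closed[OF proj_hom]) simp

lemma pure_mult:
  assumes "a \<in> carrier A" "b \<in> carrier B" "a' \<in> carrier A" "b' \<in> carrier B"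
  shows "pure a b \<otimes>\<^bsub>T\<^esub> pure a' b' = pure (a \<otimes>\<^bsub>A\<^esub> a') (b \<otimes>\<^bsub>B\<^esub> b')"
  unfolding pure_tensor_def pair_mult_of[symmetric]
  by (rule ring_hom_mult[OF proj_hom, symmetric]) (use assms in auto)

lemma pure_one: "pure \<one>\<^bsub>A\<^esub> \<one>\<^bsub>B\<^esub> = \<one>\<^bsub>T\<^esub>"
  unfolding pure_tensor_def using ring_hom_one[OF proj_hom] by (simp add: pair_ops)

lemma relation_zero:
  assumes "r \<in> tensor_relations A \<phi> B \<psi>"
  shows "proj r = \<zero>\<^bsub>T\<^esub>"
proof -
  have "r \<in> tensor_ideal A \<phi> B \<psi>"
    unfolding tensor_ideal_def using ring.genideal_self[OF pair_ring_ring relations_carrier] assms by blast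
  then show ?thesis
    using abelian_group.a_coset_join2[OF ring.is_abelian_group[OF pair_ring_ring], of r]
      additive_subgroup.a_subgroup[OF ideal.axioms(1)[OF tensor_ideal]] relations_carrier assms
    by (auto simp: tensor_ring_def FactRing_def)
qed

lemma relation_add_eq:
  assumes "frag_of x - frag_of y - frag_of w \<in> tensor_relations A \<phi> B \<psi>"
    and "frag_of x \<in> carrier PR" "frag_of y \<in> carrier PR" "frag_of w \<in> carrier PR"
  shows "proj (frag_of x) = proj (frag_of y) \<oplus>\<^bsub>T\<^esub> proj (frag_of w)"
proof -
  have "proj (frag_of x) = proj ((frag_of x - frag_of y - frag_of w) + (frag_of y + frag_of w))"
    by simp
  also have "\<dots> = proj (frag_of x - frag_of y - frag_of w) \<oplus>\<^bsub>T\<^esub> proj (frag_of y + frag_of w)"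
    using ring_hom_add[OF proj_hom, of "frag_of x - frag_of y - frag_of w" "frag_of y + frag_of w"]
      assms pair_diff_closed pair_add_closed by (simp add: pair_ops)
  also have "\<dots> = proj (frag_of y + frag_of w)"
    using relation_zero[OF assms(1)] ring_hom_closed[OF proj_hom pair_add_closed[OF assms(3,4)]]
    by (simp add: ring.ring_simprules[OF tensor_ring_ring])
  also have "\<dots> = proj (frag_of y) \<oplus>\<^bsub>T\<^esub> proj (frag_of w)"
    using ring_hom_add[OF proj_hom assms(3,4)] by (simp add: pair_ops)
  finally show ?thesis .
qed

lemma pure_add_left:
  assumes "a \<in> carrier A" "a' \<in> carrier A" "b \<in> carrier B"
  shows "pure (a \<oplus>\<^bsub>A\<^esub> a') b = pure a b \<oplus>\<^bsub>T\<^esub> pure a' b"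
  unfolding pure_tensor_def
  by (rule relation_add_eq) (use assms in \<open>auto simp: tensor_relations_def\<close>)

lemma pure_add_right:
  assumes "a \<in> carrier A" "b \<in> carrier B" "b' \<in> carrier B"
  shows "pure a (b \<oplus>\<^bsub>B\<^esub> b') = pure a b \<oplus>\<^bsub>T\<^esub> pure a b'"
  unfolding pure_tensor_def
  by (rule relation_add_eq) (use assms in \<open>auto simp: tensor_relations_def\<close>)

lemma pure_scalar:
  assumes "a \<in> carrier A" "b \<in> carrier B"
  shows "pure (\<phi> c \<otimes>\<^bsub>A\<^esub> a) b = pure a (\<psi> c \<otimes>\<^bsub>B\<^esub> b)"
proof -
  have rel: "frag_of (\<phi> c \<otimes>\<^bsub>A\<^esub> a, b) - frag_of (a, \<psi> c \<otimes>\<^bsub>B\<^esub> b) \<in> tensor_relations A \<phi> B \<psi>"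
    using assms unfolding tensor_relations_def by blast
  have "proj (frag_of (\<phi> c \<otimes>\<^bsub>A\<^esub> a, b)) \<ominus>\<^bsub>T\<^esub> proj (frag_of (a, \<psi> c \<otimes>\<^bsub>B\<^esub> b)) = \<zero>\<^bsub>T\<^esub>"
    unfolding relation_zero[OF rel, symmetric]
    by (rule proj_diff[symmetric]) (use assms in auto)
  then show ?thesis
    unfolding pure_tensor_def using ring_hom_closed[OF proj_hom] assms
    by (simp add: ring.r_right_minus_eq[OF tensor_ring_ring])
qed

text \<open>Closure under differences suffices, since integer coefficients are built from differences of pairs.\<close>

lemma tensor_induct:
  assumes x: "x \<in> carrier T" and S: "\<zero>\<^bsub>T\<^esub> \<in> S" "\<And>x y. x \<in> S \<Longrightarrow> y \<in> S \<Longrightarrow> x \<ominus>\<^bsub>T\<^esub> y \<in> S"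
    and pure: "\<And>a b. a \<in> carrier A \<Longrightarrow> b \<in> carrier B \<Longrightarrow> pure a b \<in> S"
  shows "x \<in> S"
proof -
  obtain p where p: "p \<in> carrier PR" "x = proj p"
    using x by (auto simp: tensor_ring_def FactRing_def A_RCOSETS_def')
  have "p \<in> carrier PR \<and> proj p \<in> S"
    using p(1)
  proof (induction p rule: pair_induct)
    case zero
    interpret T: ring T by (rule tensor_ring_ring)
    have "proj 0 = proj 0 \<ominus>\<^bsub>T\<^esub> proj 0"
      using proj_diff[OF pair_zero_closed pair_zero_closed] by simp
    then show ?case
      using S(1) ring_hom_closed[OF proj_hom pair_zero_closed] pair_zero_closed
      by (simp add: T.minus_eq T.r_neg)
  next
    case (of a b)
    then show ?case using pure by (simp add: pure_tensor_def)
  next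
    case (diff p q)
    then show ?case using proj_diff S(2) pair_diff_closed by simp
  qed
  then show ?thesis using p by blast
qed

lemma left_hom: "(\<lambda>a. pure a \<one>\<^bsub>B\<^esub>) \<in> ring_hom A T"
  by (rule ring_hom_memI) (auto simp: pure_closed pure_mult pure_add_left pure_one)

lemma right_hom: "(\<lambda>b. pure \<one>\<^bsub>A\<^esub> b) \<in> ring_hom B T"
  by (rule ring_hom_memI) (auto simp: pure_closed pure_mult pure_add_right pure_one)

lemma pure_factor:
  "a \<in> carrier A \<Longrightarrow> b \<in> carrier B \<Longrightarrow> pure a b = pure a \<one>\<^bsub>B\<^esub> \<otimes>\<^bsub>T\<^esub> pure \<one>\<^bsub>A\<^esub> b"
  "a \<in> carrier A \<Longrightarrow> b \<in> carrier B \<Longrightarrow> pure a b = pure \<one>\<^bsub>A\<^esub> b \<otimes>\<^bsub>T\<^esub> pure a \<one>\<^bsub>B\<^esub>"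
  by (simp_all add: pure_mult)

lemma tensor_complex_algebra: "complex_algebra T (\<lambda>c. pure (\<phi> c) \<one>\<^bsub>B\<^esub>)"
proof -
  interpret T: ring T by (rule tensor_ring_ring)
  have "(\<lambda>c. pure (\<phi> c) \<one>\<^bsub>B\<^esub>) \<in> ring_hom ring_of_type_algebra T"
    using ring_hom_trans[OF _ left_hom, of \<phi> ring_of_type_algebra] A.algebra
    by (simp add: complex_algebra_def comp_def)
  moreover have "pure (\<phi> c) \<one>\<^bsub>B\<^esub> \<otimes>\<^bsub>T\<^esub> x = x \<otimes>\<^bsub>T\<^esub> pure (\<phi> c) \<one>\<^bsub>B\<^esub>" if "x \<in> carrier T" for c x
  proof -
    have "x \<in> {x \<in> carrier T. pure (\<phi> c) \<one>\<^bsub>B\<^esub> \<otimes>\<^bsub>T\<^esub> x = x \<otimes>\<^bsub>T\<^esub> pure (\<phi> c) \<one>\<^bsub>B\<^esub>}"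
      by (rule tensor_induct[OF that])
         (auto simp: pure_closed pure_mult A.scalar_central T.minus_eq T.r_distr T.l_distr T.r_minus T.l_minus)
    then show ?thesis by blast
  qed
  ultimately show ?thesis using T.ring_axioms by (simp add: complex_algebra_def)
qed

end

section \<open>Endomorphisms and derivations of commutative algebras\<close>

locale commutative_complex_algebra = complex_algebra_ring A \<phi> + cring A for A (structure) and \<phi>
begin

abbreviation "E \<equiv> endo_ring A \<phi>"

lemma endo_apply:
  "f \<in> carrier A \<Longrightarrow> (P \<otimes>\<^bsub>E\<^esub> Q) f = P (Q f)"
  "f \<in> carrier A \<Longrightarrow> (P \<oplus>\<^bsub>E\<^esub> Q) f = P f \<oplus> Q f"
  "f \<in> carrier A \<Longrightarrow> \<one>\<^bsub>E\<^esub> f = f"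
  "f \<in> carrier A \<Longrightarrow> \<zero>\<^bsub>E\<^esub> f = \<zero>"
  "f \<in> carrier A \<Longrightarrow> mult_op A a f = a \<otimes> f"
  by (auto simp: endo_ring_def compose_def mult_op_def)

lemma endo_memI:
  assumes "P \<in> extensional (carrier A)" "\<And>f. f \<in> carrier A \<Longrightarrow> P f \<in> carrier A"
    "\<And>f g. \<lbrakk>f \<in> carrier A; g \<in> carrier A\<rbrakk> \<Longrightarrow> P (f \<oplus> g) = P f \<oplus> P g"
    "\<And>c f. f \<in> carrier A \<Longrightarrow> P (\<phi> c \<otimes> f) = \<phi> c \<otimes> P f"
  shows "P \<in> carrier E"
  using assms by (auto simp: endo_ring_def PiE_def)

lemma endoD:
  assumes "P \<in> carrier E"
  shows "P \<in> extensional (carrier A)" "f \<in> carrier A \<Longrightarrow> P f \<in> carrier A"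
    "\<lbrakk>f \<in> carrier A; g \<in> carrier A\<rbrakk> \<Longrightarrow> P (f \<oplus> g) = P f \<oplus> P g"
    "f \<in> carrier A \<Longrightarrow> P (\<phi> c \<otimes> f) = \<phi> c \<otimes> P f"
  using assms by (auto simp: endo_ring_def PiE_def)

lemma endo_eqI:
  assumes "P \<in> extensional (carrier A)" "Q \<in> extensional (carrier A)"
    "\<And>f. f \<in> carrier A \<Longrightarrow> P f = Q f"
  shows "P = Q"
  by (rule extensionalityI[OF assms])

lemma endo_op_extensional:
  "P \<otimes>\<^bsub>E\<^esub> Q \<in> extensional (carrier A)" "P \<oplus>\<^bsub>E\<^esub> Q \<in> extensional (carrier A)"
  "\<one>\<^bsub>E\<^esub> \<in> extensional (carrier A)" "\<zero>\<^bsub>E\<^esub> \<in> extensional (carrier A)"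
  "mult_op A a \<in> extensional (carrier A)"
  by (auto simp: endo_ring_def mult_op_def compose_def)

lemma mult_op_closed: "a \<in> carrier A \<Longrightarrow> mult_op A a \<in> carrier E"
  by (rule endo_memI) (auto simp: endo_apply endo_op_extensional r_distr m_lcomm)

lemma endo_closed:
  "\<lbrakk>P \<in> carrier E; Q \<in> carrier E\<rbrakk> \<Longrightarrow> P \<otimes>\<^bsub>E\<^esub> Q \<in> carrier E"
  "\<lbrakk>P \<in> carrier E; Q \<in> carrier E\<rbrakk> \<Longrightarrow> P \<oplus>\<^bsub>E\<^esub> Q \<in> carrier E"
  "\<one>\<^bsub>E\<^esub> \<in> carrier E" "\<zero>\<^bsub>E\<^esub> \<in> carrier E"
  by (rule endo_memI; simp add: endo_apply endo_op_extensional endoD r_distr a_ac)+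

lemma endo_ring_ring: "ring E"
proof (rule ringI)
  show "abelian_group E"
  proof (rule abelian_groupI)
    fix P assume P: "P \<in> carrier E"
    have "mult_op A (\<phi> (-1)) \<otimes>\<^bsub>E\<^esub> P \<oplus>\<^bsub>E\<^esub> P = \<zero>\<^bsub>E\<^esub>"
      by (rule endo_eqI) (use P in \<open>auto simp: endo_op_extensional endo_apply endoD A.sc_minus_one l_neg\<close>)
    then show "\<exists>Q\<in>carrier E. Q \<oplus>\<^bsub>E\<^esub> P = \<zero>\<^bsub>E\<^esub>"
      using P by (blast intro: endo_closed mult_op_closed)
  next
    fix P Q W assume "P \<in> carrier E" "Q \<in> carrier E" "W \<in> carrier E"
    then show "P \<oplus>\<^bsub>E\<^esub> Q \<oplus>\<^bsub>E\<^esub> W = P \<oplus>\<^bsub>E\<^esub> (Q \<oplus>\<^bsub>E\<^esub> W)"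
      by (intro endo_eqI) (auto simp: endo_op_extensional endo_apply endoD a_assoc)
  next
    fix P Q assume "P \<in> carrier E" "Q \<in> carrier E"
    then show "P \<oplus>\<^bsub>E\<^esub> Q = Q \<oplus>\<^bsub>E\<^esub> P"
      by (intro endo_eqI) (auto simp: endo_op_extensional endo_apply endoD a_comm)
  next
    fix P assume "P \<in> carrier E"
    then show "\<zero>\<^bsub>E\<^esub> \<oplus>\<^bsub>E\<^esub> P = P"
      by (intro endo_eqI) (auto simp: endo_op_extensional endo_apply endoD)
  qed (auto intro: endo_closed)
  show "monoid E"
  proof (rule monoidI)
    fix P Q W assume "P \<in> carrier E" "Q \<in> carrier E" "W \<in> carrier E"
    then show "P \<otimes>\<^bsub>E\<^esub> Q \<otimes>\<^bsub>E\<^esub> W = P \<otimes>\<^bsub>E\<^esub> (Q \<otimes>\<^bsub>E\<^esub> W)"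
      by (intro endo_eqI) (auto simp: endo_op_extensional endo_apply endoD)
  next
    fix P assume "P \<in> carrier E"
    then show "\<one>\<^bsub>E\<^esub> \<otimes>\<^bsub>E\<^esub> P = P" "P \<otimes>\<^bsub>E\<^esub> \<one>\<^bsub>E\<^esub> = P"
      by (intro endo_eqI; auto simp: endo_op_extensional endo_apply endoD)+
  qed (auto intro: endo_closed)
next
  fix P Q W assume "P \<in> carrier E" "Q \<in> carrier E" "W \<in> carrier E"
  then show "(P \<oplus>\<^bsub>E\<^esub> Q) \<otimes>\<^bsub>E\<^esub> W = P \<otimes>\<^bsub>E\<^esub> W \<oplus>\<^bsub>E\<^esub> Q \<otimes>\<^bsub>E\<^esub> W"
    "W \<otimes>\<^bsub>E\<^esub> (P \<oplus>\<^bsub>E\<^esub> Q) = W \<otimes>\<^bsub>E\<^esub> P \<oplus>\<^bsub>E\<^esub> W \<otimes>\<^bsub>E\<^esub> Q"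
    by (intro endo_eqI; auto simp: endo_op_extensional endo_apply endoD)+
qed

lemma mult_op_hom: "mult_op A \<in> ring_hom A E"
  by (rule ring_hom_memI)
     (auto intro!: endo_eqI mult_op_closed simp: endo_op_extensional endo_apply m_assoc l_distr)

lemma endo_complex_algebra: "complex_algebra E (\<lambda>c. mult_op A (\<phi> c))"
proof -
  have "mult_op A \<circ> \<phi> \<in> ring_hom ring_of_type_algebra E"
    using ring_hom_trans[OF _ mult_op_hom, of \<phi> ring_of_type_algebra] algebra
    by (simp add: complex_algebra_def)
  then show ?thesis
    using endo_ring_ring unfolding complex_algebra_def
    by (auto intro!: endo_eqI simp: endo_op_extensional endo_apply endoD comp_def)
qed

lemma derivationD:
  assumes "\<delta> \<in> derivations A \<phi>"
  shows "\<delta> \<in> carrier E"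
    "\<lbrakk>f \<in> carrier A; g \<in> carrier A\<rbrakk> \<Longrightarrow> \<delta> (f \<otimes> g) = f \<otimes> \<delta> g \<oplus> g \<otimes> \<delta> f"
    "f \<in> carrier A \<Longrightarrow> \<delta> f \<in> carrier A"
  using assms endoD(2) by (auto simp: derivations_def)

lemma derivation_scalar:
  assumes "\<delta> \<in> derivations A \<phi>"
  shows "\<delta> (\<phi> c) = \<zero>"
proof -
  have "\<delta> \<one> \<oplus> \<delta> \<one> = \<delta> \<one>"
    using derivationD(2)[OF assms, of \<one> \<one>] derivationD(3)[OF assms] by simp
  then have "\<delta> \<one> = \<zero>"
    using derivationD(3)[OF assms] by (metis add.l_cancel_one one_closed)
  then show ?thesis
    using endoD(4)[OF derivationD(1)[OF assms], of \<one> c] by simp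
qed

text \<open>The Leibniz rule, read as a commutator of operators.\<close>

lemma derivation_commutes_mult_op:
  assumes "\<delta> \<in> derivations A \<phi>" "a \<in> carrier A"
  shows "\<delta> \<otimes>\<^bsub>E\<^esub> mult_op A a = mult_op A a \<otimes>\<^bsub>E\<^esub> \<delta> \<oplus>\<^bsub>E\<^esub> mult_op A (\<delta> a)"
  by (rule endo_eqI)
     (use assms in \<open>auto simp: endo_op_extensional endo_apply derivationD m_comm a_comm\<close>)

definition bracket :: "('a \<Rightarrow> 'a) \<Rightarrow> ('a \<Rightarrow> 'a) \<Rightarrow> 'a \<Rightarrow> 'a" where
  "bracket \<delta> \<epsilon> = (\<lambda>f\<in>carrier A. \<delta> (\<epsilon> f) \<ominus> \<epsilon> (\<delta> f))"

lemma bracket_endo: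
  assumes "\<delta> \<in> carrier E" "\<epsilon> \<in> carrier E"
  shows "bracket \<delta> \<epsilon> \<in> carrier E"
    and "\<delta> \<otimes>\<^bsub>E\<^esub> \<epsilon> = \<epsilon> \<otimes>\<^bsub>E\<^esub> \<delta> \<oplus>\<^bsub>E\<^esub> bracket \<delta> \<epsilon>"
proof -
  show "bracket \<delta> \<epsilon> \<in> carrier E"
  proof (rule endo_memI)
    fix f g assume "f \<in> carrier A" "g \<in> carrier A"
    then show "bracket \<delta> \<epsilon> (f \<oplus> g) = bracket \<delta> \<epsilon> f \<oplus> bracket \<delta> \<epsilon> g"
      using assms by (simp add: bracket_def endoD minus_eq minus_add a_ac)
  next
    fix c f assume "f \<in> carrier A"
    then show "bracket \<delta> \<epsilon> (\<phi> c \<otimes> f) = \<phi> c \<otimes> bracket \<delta> \<epsilon> f"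
      using assms by (simp add: bracket_def endoD minus_eq r_distr r_minus)
  qed (use assms in \<open>auto simp: bracket_def endoD\<close>)
  show "\<delta> \<otimes>\<^bsub>E\<^esub> \<epsilon> = \<epsilon> \<otimes>\<^bsub>E\<^esub> \<delta> \<oplus>\<^bsub>E\<^esub> bracket \<delta> \<epsilon>"
  proof (rule endo_eqI)
    fix f assume f: "f \<in> carrier A"
    have "x = y \<oplus> (x \<ominus> y)" if "x \<in> carrier A" "y \<in> carrier A" for x y
      using that by (simp add: minus_eq a_lcomm r_neg)
    then show "(\<delta> \<otimes>\<^bsub>E\<^esub> \<epsilon>) f = (\<epsilon> \<otimes>\<^bsub>E\<^esub> \<delta> \<oplus>\<^bsub>E\<^esub> bracket \<delta> \<epsilon>) f"
      using f assms by (simp add: endo_apply bracket_def endoD)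
  qed (auto simp: endo_op_extensional)
qed

text \<open>Applying both derivations to \<open>f g\<close> gives mixed terms that are symmetric in \<open>\<delta>\<close> and \<open>\<epsilon>\<close> and cancel in the
  commutator.\<close>

lemma bracket_derivation:
  assumes "\<delta> \<in> derivations A \<phi>" "\<epsilon> \<in> derivations A \<phi>"
  shows "bracket \<delta> \<epsilon> \<in> derivations A \<phi>"
proof -
  have "bracket \<delta> \<epsilon> (f \<otimes> g) = f \<otimes> bracket \<delta> \<epsilon> g \<oplus> g \<otimes> bracket \<delta> \<epsilon> f"
    if fg: "f \<in> carrier A" "g \<in> carrier A" for f g
  proof -
    have leib: "\<delta> (\<epsilon> (f \<otimes> g)) = (f \<otimes> \<delta> (\<epsilon> g) \<oplus> g \<otimes> \<delta> (\<epsilon> f)) \<oplus> (\<epsilon> g \<otimes> \<delta> f \<oplus> \<epsilon> f \<otimes> \<delta> g)"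
      if "\<delta> \<in> derivations A \<phi>" "\<epsilon> \<in> derivations A \<phi>" for \<delta> \<epsilon>
      using fg that by (simp add: derivationD endoD a_ac)
    have sub: "(x \<oplus> u) \<ominus> (y \<oplus> u) = x \<ominus> y" if "x \<in> carrier A" "y \<in> carrier A" "u \<in> carrier A" for x y u
      using that by (simp add: minus_eq minus_add a_assoc r_neg1 a_lcomm[of u] r_neg)
    have "bracket \<delta> \<epsilon> (f \<otimes> g) = (f \<otimes> \<delta> (\<epsilon> g) \<oplus> g \<otimes> \<delta> (\<epsilon> f)) \<ominus> (f \<otimes> \<epsilon> (\<delta> g) \<oplus> g \<otimes> \<epsilon> (\<delta> f))"
    proof -
      have "\<delta> g \<otimes> \<epsilon> f \<oplus> \<delta> f \<otimes> \<epsilon> g = \<epsilon> g \<otimes> \<delta> f \<oplus> \<epsilon> f \<otimes> \<delta> g"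
        using fg assms by (simp add: derivationD m_comm a_comm)
      then show ?thesis
        using fg assms leib[OF assms] leib[OF assms(2,1)] by (simp add: bracket_def sub derivationD)
    qed
    also have "\<dots> = f \<otimes> bracket \<delta> \<epsilon> g \<oplus> g \<otimes> bracket \<delta> \<epsilon> f"
    proof -
      have "(p \<oplus> q) \<ominus> (r \<oplus> s) = (p \<ominus> r) \<oplus> (q \<ominus> s)"
        if "p \<in> carrier A" "q \<in> carrier A" "r \<in> carrier A" "s \<in> carrier A" for p q r s
        using that by (simp add: minus_eq minus_add a_ac)
      moreover have "h \<otimes> (x \<ominus> y) = h \<otimes> x \<ominus> h \<otimes> y"
        if "h \<in> carrier A" "x \<in> carrier A" "y \<in> carrier A" for h x y
        using that by (simp add: minus_eq r_distr r_minus)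
      ultimately show ?thesis using fg assms by (simp add: bracket_def derivationD)
    qed
    finally show ?thesis .
  qed
  moreover have "bracket \<delta> \<epsilon> \<in> carrier E"
    by (intro bracket_endo derivationD assms)
  ultimately show ?thesis by (simp add: derivations_def)
qed

lemma derivation_combination:
  assumes "\<delta> \<in> derivations A \<phi>" "\<epsilon> \<in> derivations A \<phi>"
  shows "\<delta> \<oplus>\<^bsub>E\<^esub> \<epsilon> \<in> derivations A \<phi>"
    and "a \<in> carrier A \<Longrightarrow> mult_op A a \<otimes>\<^bsub>E\<^esub> \<delta> \<in> derivations A \<phi>"
proof -
  note d = derivationD[OF assms(1)] derivationD[OF assms(2)]
  have "(\<delta> \<oplus>\<^bsub>E\<^esub> \<epsilon>) (f \<otimes> g) = f \<otimes> (\<delta> \<oplus>\<^bsub>E\<^esub> \<epsilon>) g \<oplus> g \<otimes> (\<delta> \<oplus>\<^bsub>E\<^esub> \<epsilon>) f"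
    if "f \<in> carrier A" "g \<in> carrier A" for f g
    using that d by (simp add: endo_apply r_distr a_ac)
  then show "\<delta> \<oplus>\<^bsub>E\<^esub> \<epsilon> \<in> derivations A \<phi>"
    unfolding derivations_def using d(1,4) by (auto intro: endo_closed)
  assume a: "a \<in> carrier A"
  have "(mult_op A a \<otimes>\<^bsub>E\<^esub> \<delta>) (f \<otimes> g) = f \<otimes> (mult_op A a \<otimes>\<^bsub>E\<^esub> \<delta>) g \<oplus> g \<otimes> (mult_op A a \<otimes>\<^bsub>E\<^esub> \<delta>) f"
    if "f \<in> carrier A" "g \<in> carrier A" for f g
    using that a d by (simp add: endo_apply r_distr m_lcomm)
  then show "mult_op A a \<otimes>\<^bsub>E\<^esub> \<delta> \<in> derivations A \<phi>"
    unfolding derivations_def using d(1) a by (auto intro: endo_closed mult_op_closed)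
qed

lemma zero_derivation: "\<zero>\<^bsub>E\<^esub> \<in> derivations A \<phi>"
  by (auto simp: derivations_def endo_closed endo_apply)

text \<open>The elements at which two derivations agree form a subalgebra.\<close>

lemma derivation_eqI:
  assumes gen: "carrier A = generate_ring A (range \<phi> \<union> B)"
    and d: "\<delta> \<in> derivations A \<phi>" "\<epsilon> \<in> derivations A \<phi>" and eq: "\<And>b. b \<in> B \<Longrightarrow> \<delta> b = \<epsilon> b"
  shows "\<delta> = \<epsilon>"
proof (rule endo_eqI)
  let ?S = "{f \<in> carrier A. \<delta> f = \<epsilon> f}"
  have "generate_ring A (range \<phi> \<union> B) \<subseteq> ?S"
  proof (rule generate_ring_subset)
    have "B \<subseteq> carrier A" unfolding gen by (auto intro: generate_ring.incl)
    then show "range \<phi> \<union> B \<subseteq> ?S"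
      using eq d by (auto simp: derivation_scalar)
    show one: "\<one> \<in> ?S"
      using derivation_scalar[OF d(1), of 1] derivation_scalar[OF d(2), of 1] complex_algebra_map(4)[OF algebra]
      by simp
    show "A.csubspace ?S"
    proof (rule A.csubspaceI)
      show "\<zero> \<in> ?S"
        using derivation_scalar[OF d(1), of 0] derivation_scalar[OF d(2), of 0] scalar_zero by simp
    qed (use d in \<open>auto simp: derivationD(1) endoD\<close>)
  qed (use d in \<open>auto simp: derivationD\<close>)
  then have sub: "carrier A \<subseteq> ?S" by (simp only: gen[symmetric])
  show "\<delta> f = \<epsilon> f" if "f \<in> carrier A" for f using subsetD[OF sub that] by simp
qed (use d derivationD(1) endoD(1) in auto)

text \<open>The record type of modules has fields for a product and a unit; componentwise values are used for them.\<close>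

definition free_module :: "nat \<Rightarrow> ('a, nat \<Rightarrow> 'a) module" where
  "free_module n = \<lparr>carrier = {..<n} \<rightarrow>\<^sub>E carrier A,
     monoid.mult = (\<lambda>u v. \<lambda>i\<in>{..<n}. u i \<otimes> v i), one = (\<lambda>i\<in>{..<n}. \<one>),
     ring.zero = (\<lambda>i\<in>{..<n}. \<zero>), add = (\<lambda>u v. \<lambda>i\<in>{..<n}. u i \<oplus> v i),
     smult = (\<lambda>a u. \<lambda>i\<in>{..<n}. a \<otimes> u i)\<rparr>"

lemma free_left_module: "left_module A (free_module n)"
proof -
  have eqI: "u = v" if "u \<in> {..<n} \<rightarrow>\<^sub>E carrier A" "v \<in> {..<n} \<rightarrow>\<^sub>E carrier A" "\<And>i. i < n \<Longrightarrow> u i = v i" for u v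
    using that by (intro extensionalityI[of u "{..<n}" v]) (auto simp: PiE_def)
  note [simp] = free_module_def
  have "abelian_group (free_module n)"
  proof (rule abelian_groupI)
    fix u assume u: "u \<in> carrier (free_module n)"
    let ?v = "\<lambda>i\<in>{..<n}. \<ominus> u i"
    have v: "?v \<in> carrier (free_module n)" using u by (auto simp: PiE_iff)
    have "?v \<oplus>\<^bsub>free_module n\<^esub> u = \<zero>\<^bsub>free_module n\<^esub>"
      using u by (auto simp: PiE_iff l_neg intro!: restrict_ext)
    then show "\<exists>v\<in>carrier (free_module n). v \<oplus>\<^bsub>free_module n\<^esub> u = \<zero>\<^bsub>free_module n\<^esub>"
      using v by blast
  next
    fix u v w assume "u \<in> carrier (free_module n)" "v \<in> carrier (free_module n)" "w \<in> carrier (free_module n)"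
    then show "u \<oplus>\<^bsub>free_module n\<^esub> v \<oplus>\<^bsub>free_module n\<^esub> w = u \<oplus>\<^bsub>free_module n\<^esub> (v \<oplus>\<^bsub>free_module n\<^esub> w)"
      by (auto simp: PiE_iff a_assoc intro!: restrict_ext)
  next
    fix u v assume "u \<in> carrier (free_module n)" "v \<in> carrier (free_module n)"
    then show "u \<oplus>\<^bsub>free_module n\<^esub> v = v \<oplus>\<^bsub>free_module n\<^esub> u"
      by (auto simp: PiE_iff a_comm intro!: restrict_ext)
  next
    fix u assume u: "u \<in> carrier (free_module n)"
    then show "\<zero>\<^bsub>free_module n\<^esub> \<oplus>\<^bsub>free_module n\<^esub> u = u"
      by (intro eqI) (auto simp: PiE_iff)
  qed (auto simp: PiE_iff)
  then show ?thesis
  proof (intro left_module.intro left_module_axioms.intro)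
    fix u assume "u \<in> carrier (free_module n)"
    then show "\<one> \<odot>\<^bsub>free_module n\<^esub> u = u" by (intro eqI) (auto simp: PiE_iff)
  qed (auto simp: PiE_iff l_distr r_distr m_assoc ring_axioms intro!: restrict_ext)
qed

text \<open>A submodule that contains the unit vectors contains each vector truncated after its first \<open>k\<close> entries, by
  induction on \<open>k\<close>.\<close>

lemma free_module_finitely_generated: "finitely_generated_module A (free_module n)"
proof -
  define e where "e k = (\<lambda>i\<in>{..<n}. if i = k then \<one> else \<zero>)" for k
  have "H = carrier (free_module n)" if H: "submodule H A (free_module n)" and e: "e ` {..<n} \<subseteq> H" for H
  proof -
    interpret H: submodule H A "free_module n" by fact
    have sub: "H \<subseteq> carrier (free_module n)" using H.subset by simp
    have "(\<lambda>i\<in>{..<n}. if i < k then u i else \<zero>) \<in> H" if "k \<le> n" "u \<in> carrier (free_module n)" for k u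
      using that(1)
    proof (induction k)
      case 0
      have eq: "(\<lambda>i\<in>{..<n}. if i < 0 then u i else \<zero>) = \<zero>\<^bsub>free_module n\<^esub>"
        by (simp add: free_module_def)
      show ?case unfolding eq using H.one_closed by simp
    next
      case (Suc k)
      have ui: "u i \<in> carrier A" if "i < n" for i
        using that \<open>u \<in> carrier (free_module n)\<close> by (auto simp: free_module_def)
      have "(\<lambda>i\<in>{..<n}. if i < k then u i else \<zero>) \<oplus>\<^bsub>free_module n\<^esub> (u k \<odot>\<^bsub>free_module n\<^esub> e k) \<in> H"
      proof (rule H.m_closed[simplified])
        show "(\<lambda>i\<in>{..<n}. if i < k then u i else \<zero>) \<in> H" by (rule Suc.IH) (use Suc.prems in simp)
        show "u k \<odot>\<^bsub>free_module n\<^esub> e k \<in> H" using e Suc.prems ui by (intro H.smult_closed) auto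
      qed
      moreover have "(\<lambda>i\<in>{..<n}. if i < k then u i else \<zero>) \<oplus>\<^bsub>free_module n\<^esub> (u k \<odot>\<^bsub>free_module n\<^esub> e k)
          = (\<lambda>i\<in>{..<n}. if i < Suc k then u i else \<zero>)"
        using ui Suc by (auto simp: free_module_def e_def less_Suc_eq)
      ultimately show ?case by metis
    qed
    moreover have "(\<lambda>i\<in>{..<n}. if i < n then u i else \<zero>) = u" if "u \<in> carrier (free_module n)" for u
      using that by (auto simp: free_module_def fun_eq_iff PiE_def extensional_def)
    ultimately show ?thesis using sub by (metis order_refl subsetI subset_antisym)
  qed
  moreover have "e k \<in> carrier (free_module n)" for k
    unfolding free_module_def e_def by (simp add: restrict_PiE_iff)
  then have "e ` {..<n} \<subseteq> carrier (free_module n)" by blast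
  ultimately show ?thesis
    unfolding finitely_generated_module_def by (intro exI[of _ "e ` {..<n}"]) auto
qed

text \<open>Evaluation at the \<open>n\<close> elements of \<open>B\<close> is linear over \<open>A\<close> and injective on derivations. Its image in the free
  module of rank \<open>n\<close> is finitely generated by \<open>noetherian_module\<close>, with no vector fields among the generators of \<open>A\<close>. Generation
  is stated as a closure property of sets of operators, which is the form needed to transport it along \<open>ext\<close>.\<close>

lemma derivations_finitely_generated:
  assumes gen: "carrier A = generate_ring A (range \<phi> \<union> B)" and "finite B"
  shows "\<exists>D\<subseteq>derivations A \<phi>. finite D \<and> (\<forall>K. \<zero>\<^bsub>E\<^esub> \<in> K \<longrightarrow>
    (\<forall>\<delta>\<in>K. \<forall>\<epsilon>\<in>K. \<delta> \<oplus>\<^bsub>E\<^esub> \<epsilon> \<in> K) \<longrightarrow> (\<forall>a\<in>carrier A. \<forall>\<delta>\<in>K. mult_op A a \<otimes>\<^bsub>E\<^esub> \<delta> \<in> K) \<longrightarrow>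
    D \<subseteq> K \<longrightarrow> derivations A \<phi> \<subseteq> K)"
proof -
  have BA: "B \<subseteq> carrier A" unfolding gen by (auto intro: generate_ring.incl)
  obtain b and n :: nat where b: "B = b ` {i. i < n}"
    using \<open>finite B\<close> by (metis finite_conv_nat_seg_image)
  have bA: "b i \<in> carrier A" if "i < n" for i using that b BA by auto
  interpret filtered_generators A \<phi> B "{}"
    by unfold_locales (use gen BA \<open>finite B\<close> in \<open>auto simp: m_comm subset_iff\<close>)
  define val where "val \<delta> = (\<lambda>i\<in>{..<n}. \<delta> (b i))" for \<delta> :: "'a \<Rightarrow> 'a"
  let ?M = "free_module n"
  interpret M: left_module A ?M by (rule free_left_module)
  have sp: "complex_space ?M (\<lambda>c v. \<phi> c \<odot>\<^bsub>?M\<^esub> v)"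
    by (rule left_module_space[OF algebra free_left_module])
  have val_carrier: "val \<delta> \<in> carrier ?M" if "\<delta> \<in> derivations A \<phi>" for \<delta>
    using that bA by (auto simp: val_def free_module_def derivationD)
  have val_add: "val (\<delta> \<oplus>\<^bsub>E\<^esub> \<epsilon>) = val \<delta> \<oplus>\<^bsub>?M\<^esub> val \<epsilon>" for \<delta> \<epsilon>
    using bA by (auto simp: val_def free_module_def endo_apply intro!: restrict_ext)
  have val_mult: "val (mult_op A a \<otimes>\<^bsub>E\<^esub> \<delta>) = a \<odot>\<^bsub>?M\<^esub> val \<delta>" if "\<delta> \<in> derivations A \<phi>" for a \<delta>
    using bA that by (auto simp: val_def free_module_def endo_apply derivationD intro!: restrict_ext)
  have val_zero: "val \<zero>\<^bsub>E\<^esub> = \<zero>\<^bsub>?M\<^esub>"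
    using bA by (auto simp: val_def free_module_def endo_apply intro!: restrict_ext)
  have val_inj: "\<delta> = \<epsilon>" if "\<delta> \<in> derivations A \<phi>" "\<epsilon> \<in> derivations A \<phi>" "val \<delta> = val \<epsilon>" for \<delta> \<epsilon>
  proof (rule derivation_eqI[OF gen that(1,2)])
    fix x assume "x \<in> B"
    then obtain i where "i < n" "x = b i" using b by blast
    then show "\<delta> x = \<epsilon> x" using fun_cong[OF that(3), of i] by (simp add: val_def)
  qed
  have image_submodule: "submodule (val ` K) A ?M"
    if K: "K \<subseteq> derivations A \<phi>" "\<zero>\<^bsub>E\<^esub> \<in> K" "\<And>\<delta> \<epsilon>. \<delta> \<in> K \<Longrightarrow> \<epsilon> \<in> K \<Longrightarrow> \<delta> \<oplus>\<^bsub>E\<^esub> \<epsilon> \<in> K"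
      "\<And>a \<delta>. a \<in> carrier A \<Longrightarrow> \<delta> \<in> K \<Longrightarrow> mult_op A a \<otimes>\<^bsub>E\<^esub> \<delta> \<in> K" for K
  proof -
    interpret V: complex_space ?M "\<lambda>c v. \<phi> c \<odot>\<^bsub>?M\<^esub> v" by (rule sp)
    have smult: "a \<odot>\<^bsub>?M\<^esub> v \<in> val ` K" if "a \<in> carrier A" "v \<in> val ` K" for a v
      using that K val_mult by (auto simp: image_iff) (metis subsetD)
    have "V.csubspace (val ` K)"
    proof (rule V.csubspaceI)
      show "val ` K \<subseteq> carrier ?M" using K(1) val_carrier by blast
      show "\<zero>\<^bsub>?M\<^esub> \<in> val ` K" using K(2) val_zero by (metis imageI)
      show "x \<oplus>\<^bsub>?M\<^esub> y \<in> val ` K" if "x \<in> val ` K" "y \<in> val ` K" for x y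
        using that K(3) by (auto simp flip: val_add)
    qed (auto intro: smult)
    then have "subgroup (val ` K) (add_monoid ?M)"
      by (intro M.add.subgroupI) (use V.csubspace_minus in \<open>auto simp: V.csubspace_def simp flip: a_inv_def\<close>)
    then show ?thesis by (simp add: submodule_def submodule_axioms_def smult)
  qed
  have U: "submodule (val ` derivations A \<phi>) A ?M"
    by (rule image_submodule) (auto intro: zero_derivation derivation_combination)
  obtain F where F: "F \<subseteq> val ` derivations A \<phi>" "finite F"
    "\<And>H. submodule H A ?M \<Longrightarrow> F \<subseteq> H \<Longrightarrow> val ` derivations A \<phi> \<subseteq> H"
    using noetherian_module[OF free_left_module free_module_finitely_generated U] by blast
  obtain D where D: "D \<subseteq> derivations A \<phi>" "finite D" "F = val ` D"
    using finite_subset_image[OF F(2,1)] by blast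
  have "derivations A \<phi> \<subseteq> K" if K: "\<zero>\<^bsub>E\<^esub> \<in> K" "\<forall>\<delta>\<in>K. \<forall>\<epsilon>\<in>K. \<delta> \<oplus>\<^bsub>E\<^esub> \<epsilon> \<in> K"
    "\<forall>a\<in>carrier A. \<forall>\<delta>\<in>K. mult_op A a \<otimes>\<^bsub>E\<^esub> \<delta> \<in> K" "D \<subseteq> K" for K
  proof
    fix \<delta> assume \<delta>: "\<delta> \<in> derivations A \<phi>"
    have "submodule (val ` (K \<inter> derivations A \<phi>)) A ?M"
      by (rule image_submodule) (use K in \<open>auto intro: zero_derivation derivation_combination\<close>)
    then have "val ` derivations A \<phi> \<subseteq> val ` (K \<inter> derivations A \<phi>)"
      by (rule F(3)) (use D K(4) in auto)
    then obtain \<epsilon> where "\<epsilon> \<in> K" "\<epsilon> \<in> derivations A \<phi>" "val \<delta> = val \<epsilon>" using \<delta> by blast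
    then show "\<delta> \<in> K" using val_inj[OF \<delta>] by simp
  qed
  then show ?thesis using D(1,2) by (intro exI[of _ D]) blast
qed

end

section \<open>Vector fields on the product of a variety with affine space\<close>

lemma coord_apply:
  "p \<in> V \<Longrightarrow> (f \<otimes>\<^bsub>coord_ring V G\<^esub> g) p = f p * g p"
  "p \<in> V \<Longrightarrow> (f \<oplus>\<^bsub>coord_ring V G\<^esub> g) p = f p + g p"
  "p \<in> V \<Longrightarrow> \<one>\<^bsub>coord_ring V G\<^esub> p = 1"
  "p \<in> V \<Longrightarrow> \<zero>\<^bsub>coord_ring V G\<^esub> p = 0"
  "p \<in> V \<Longrightarrow> const_fun V c p = c"
  by (simp_all add: coord_ring_def const_fun_def)

lemma coord_extensional:
  "f \<in> carrier (coord_ring V G) \<Longrightarrow> f \<in> extensional V"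
  "f \<otimes>\<^bsub>coord_ring V G\<^esub> g \<in> extensional V" "f \<oplus>\<^bsub>coord_ring V G\<^esub> g \<in> extensional V"
  "\<one>\<^bsub>coord_ring V G\<^esub> \<in> extensional V" "\<zero>\<^bsub>coord_ring V G\<^esub> \<in> extensional V" "const_fun V c \<in> extensional V"
  by (auto simp: coord_ring_def const_fun_def)

lemma coord_restrict:
  assumes "f \<in> poly_funs G"
  shows "restrict f V \<in> carrier (coord_ring V G)"
  using assms by (simp add: coord_ring_def)

lemma const_fun_closed: "const_fun V c \<in> carrier (coord_ring V G)"
  unfolding const_fun_def by (rule coord_restrict) (rule poly_funs.const)

lemma coord_closed:
  assumes "f \<in> carrier (coord_ring V G)" "g \<in> carrier (coord_ring V G)"
  shows "f \<otimes>\<^bsub>coord_ring V G\<^esub> g \<in> carrier (coord_ring V G)" "f \<oplus>\<^bsub>coord_ring V G\<^esub> g \<in> carrier (coord_ring V G)"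
proof -
  obtain p q where p: "p \<in> poly_funs G" "f = restrict p V" and q: "q \<in> poly_funs G" "g = restrict q V"
    using assms by (auto simp: coord_ring_def)
  have "f \<otimes>\<^bsub>coord_ring V G\<^esub> g = restrict (\<lambda>x. p x * q x) V" "f \<oplus>\<^bsub>coord_ring V G\<^esub> g = restrict (\<lambda>x. p x + q x) V"
    by (rule extensionalityI[where A = V]; auto simp: coord_extensional coord_apply p q)+
  then show "f \<otimes>\<^bsub>coord_ring V G\<^esub> g \<in> carrier (coord_ring V G)" "f \<oplus>\<^bsub>coord_ring V G\<^esub> g \<in> carrier (coord_ring V G)"
    using poly_funs.mult[OF p(1) q(1)] poly_funs.add[OF p(1) q(1)] by (auto intro: coord_restrict)
qed

lemma coord_one_zero:
  "\<one>\<^bsub>coord_ring V G\<^esub> = const_fun V 1" "\<zero>\<^bsub>coord_ring V G\<^esub> = const_fun V 0"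
  by (simp_all add: coord_ring_def const_fun_def)

lemma coord_ring_cring: "cring (coord_ring V G)"
proof -
  let ?O = "coord_ring V G"
  note eqI = extensionalityI[of _ V]
  have "abelian_group ?O"
  proof (rule abelian_groupI)
    fix f assume f: "f \<in> carrier ?O"
    have "const_fun V (-1) \<otimes>\<^bsub>?O\<^esub> f \<oplus>\<^bsub>?O\<^esub> f = \<zero>\<^bsub>?O\<^esub>"
      by (rule eqI) (auto simp: coord_extensional coord_apply)
    then show "\<exists>g\<in>carrier ?O. g \<oplus>\<^bsub>?O\<^esub> f = \<zero>\<^bsub>?O\<^esub>"
      using coord_closed(1)[OF const_fun_closed f] by blast
  next
    fix f g h
    show "f \<oplus>\<^bsub>?O\<^esub> g \<oplus>\<^bsub>?O\<^esub> h = f \<oplus>\<^bsub>?O\<^esub> (g \<oplus>\<^bsub>?O\<^esub> h)"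
      by (rule eqI) (auto simp: coord_extensional coord_apply)
    show "f \<oplus>\<^bsub>?O\<^esub> g = g \<oplus>\<^bsub>?O\<^esub> f"
      by (rule eqI) (auto simp: coord_extensional coord_apply)
  next
    fix f assume "f \<in> carrier ?O"
    then show "\<zero>\<^bsub>?O\<^esub> \<oplus>\<^bsub>?O\<^esub> f = f"
      by (intro eqI) (auto simp: coord_extensional coord_apply)
  qed (auto simp: coord_closed coord_one_zero const_fun_closed)
  moreover have "comm_monoid ?O"
  proof (rule comm_monoidI)
    fix f g h
    show "f \<otimes>\<^bsub>?O\<^esub> g \<otimes>\<^bsub>?O\<^esub> h = f \<otimes>\<^bsub>?O\<^esub> (g \<otimes>\<^bsub>?O\<^esub> h)"
      by (rule eqI) (auto simp: coord_extensional coord_apply)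
    show "f \<otimes>\<^bsub>?O\<^esub> g = g \<otimes>\<^bsub>?O\<^esub> f"
      by (rule eqI) (auto simp: coord_extensional coord_apply)
  next
    fix f assume "f \<in> carrier ?O"
    then show "\<one>\<^bsub>?O\<^esub> \<otimes>\<^bsub>?O\<^esub> f = f"
      by (intro eqI) (auto simp: coord_extensional coord_apply)
  qed (auto simp: coord_closed coord_one_zero const_fun_closed)
  ultimately show ?thesis
  proof (rule cringI)
    fix f g h
    show "(f \<oplus>\<^bsub>?O\<^esub> g) \<otimes>\<^bsub>?O\<^esub> h = f \<otimes>\<^bsub>?O\<^esub> h \<oplus>\<^bsub>?O\<^esub> g \<otimes>\<^bsub>?O\<^esub> h"
      by (rule eqI) (auto simp: coord_extensional coord_apply algebra_simps)
  qed
qed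

lemma coord_ring_algebra: "commutative_complex_algebra (coord_ring V G) (const_fun V)"
proof -
  let ?O = "coord_ring V G"
  interpret cring ?O by (rule coord_ring_cring)
  have "const_fun V \<in> ring_hom ring_of_type_algebra ?O"
    by (rule ring_hom_memI)
       (auto simp: ring_of_type_algebra_def const_fun_closed coord_one_zero coord_extensional coord_apply
          intro!: extensionalityI[of _ V])
  then have "complex_algebra ?O (const_fun V)"
    using ring_axioms by (auto simp: complex_algebra_def const_fun_closed m_comm)
  then show ?thesis by unfold_locales
qed

lemma coord_minus_apply:
  assumes "p \<in> V" "f \<in> carrier (coord_ring V G)" "g \<in> carrier (coord_ring V G)"
  shows "(f \<ominus>\<^bsub>coord_ring V G\<^esub> g) p = f p - g p"
proof -
  interpret commutative_complex_algebra "coord_ring V G" "const_fun V" by (rule coord_ring_algebra)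
  have "f \<ominus>\<^bsub>coord_ring V G\<^esub> g = f \<oplus>\<^bsub>coord_ring V G\<^esub> const_fun V (-1) \<otimes>\<^bsub>coord_ring V G\<^esub> g"
    using assms by (simp add: minus_eq A.sc_minus_one)
  then show ?thesis using assms(1) by (simp add: coord_apply)
qed

lemma coord_induct [consumes 1, case_names const coord add mult]:
  assumes "f \<in> carrier (coord_ring V G)"
    and "\<And>c. Q (const_fun V c)" and "\<And>g. g \<in> G \<Longrightarrow> Q (restrict g V)"
    and "\<And>f g. \<lbrakk>f \<in> carrier (coord_ring V G); g \<in> carrier (coord_ring V G); Q f; Q g\<rbrakk> \<Longrightarrow> Q (f \<oplus>\<^bsub>coord_ring V G\<^esub> g)"
    and "\<And>f g. \<lbrakk>f \<in> carrier (coord_ring V G); g \<in> carrier (coord_ring V G); Q f; Q g\<rbrakk> \<Longrightarrow> Q (f \<otimes>\<^bsub>coord_ring V G\<^esub> g)"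
  shows "Q f"
proof -
  obtain p where p: "p \<in> poly_funs G" "f = restrict p V"
    using assms(1) by (auto simp: coord_ring_def)
  have "Q (restrict p V)"
    using p(1)
  proof induction
    case (const c)
    show ?case using assms(2)[of c] unfolding const_fun_def .
  next
    case (add f g)
    have "restrict (\<lambda>p. f p + g p) V = restrict f V \<oplus>\<^bsub>coord_ring V G\<^esub> restrict g V"
      by (rule extensionalityI[of _ V]) (auto simp: coord_extensional coord_apply)
    then show ?case using assms(4) add coord_restrict by metis
  next
    case (mult f g)
    have "restrict (\<lambda>p. f p * g p) V = restrict f V \<otimes>\<^bsub>coord_ring V G\<^esub> restrict g V"
      by (rule extensionalityI[of _ V]) (auto simp: coord_extensional coord_apply)
    then show ?case using assms(5) mult coord_restrict by metis
  qed (rule assms(3))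
  then show ?thesis using p(2) by simp
qed

lemma coord_ring_generated:
  "carrier (coord_ring V G) = generate_ring (coord_ring V G) (range (const_fun V) \<union> (\<lambda>g. restrict g V) ` G)"
proof
  interpret cring "coord_ring V G" by (rule coord_ring_cring)
  show "generate_ring (coord_ring V G) (range (const_fun V) \<union> (\<lambda>g. restrict g V) ` G) \<subseteq> carrier (coord_ring V G)"
    by (rule generate_ring_incl) (auto intro: const_fun_closed coord_restrict poly_funs.coord)
  show "carrier (coord_ring V G) \<subseteq> generate_ring (coord_ring V G) (range (const_fun V) \<union> (\<lambda>g. restrict g V) ` G)"
  proof
    fix f assume "f \<in> carrier (coord_ring V G)"
    then show "f \<in> generate_ring (coord_ring V G) (range (const_fun V) \<union> (\<lambda>g. restrict g V) ` G)"
      by (induction rule: coord_induct) (auto intro: generate_ring.intros)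
  qed
qed

locale product_variety =
  fixes n l :: nat and X :: "(nat \<Rightarrow> complex) set"
begin

abbreviation "Y \<equiv> product_space X l"
abbreviation "OX \<equiv> functions_on n X"
abbreviation "OY \<equiv> product_ring n X l"
abbreviation "ext \<equiv> extend_op n X l"
abbreviation "euler \<equiv> euler_op n X l"

sublocale OX: commutative_complex_algebra OX "const_fun X"
  by (rule coord_ring_algebra)

sublocale OY: commutative_complex_algebra OY "const_fun Y"
  unfolding product_ring_def by (rule coord_ring_algebra)

lemmas OY_apply = coord_apply(5)[where V = Y] coord_apply(1-4)[where V = Y and G = "(\<lambda>i p. fst p i) ` {..<n} \<union> (\<lambda>j p. snd p j) ` {..<l}", folded product_ring_def]
lemmas OY_extensional = coord_extensional(6)[where V = Y] coord_extensional(1-5)[where V = Y and G = "(\<lambda>i p. fst p i) ` {..<n} \<union> (\<lambda>j p. snd p j) ` {..<l}", folded product_ring_def]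
lemmas OY_closed = coord_closed[where V = Y and G = "(\<lambda>i p. fst p i) ` {..<n} \<union> (\<lambda>j p. snd p j) ` {..<l}", folded product_ring_def]
lemmas OY_one_zero = coord_one_zero[where V = Y and G = "(\<lambda>i p. fst p i) ` {..<n} \<union> (\<lambda>j p. snd p j) ` {..<l}", folded product_ring_def]

lemma OY_const: "const_fun Y c \<in> carrier OY"
  unfolding product_ring_def by (rule const_fun_closed)

lemma Y_mem: "(x, t) \<in> Y \<longleftrightarrow> x \<in> X \<and> t \<in> affine_space l"
  by (simp add: product_space_def)

lemma Y_eqI:
  assumes "f \<in> extensional Y" "g \<in> extensional Y"
    and "\<And>x t. \<lbrakk>x \<in> X; t \<in> affine_space l\<rbrakk> \<Longrightarrow> f (x, t) = g (x, t)"
  shows "f = g"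
  by (rule extensionalityI[of _ Y]) (use assms Y_mem in auto)

definition slice :: "(point \<Rightarrow> complex) \<Rightarrow> (nat \<Rightarrow> complex) \<Rightarrow> (nat \<Rightarrow> complex) \<Rightarrow> complex" where
  "slice f t = (\<lambda>x\<in>X. f (x, t))"

definition pull :: "((nat \<Rightarrow> complex) \<Rightarrow> complex) \<Rightarrow> point \<Rightarrow> complex" where
  "pull g = (\<lambda>p\<in>Y. g (fst p))"

definition x_coord :: "nat \<Rightarrow> (nat \<Rightarrow> complex) \<Rightarrow> complex" where
  "x_coord i = (\<lambda>x\<in>X. x i)"

abbreviation "coords \<equiv> (\<lambda>i. pull (x_coord i)) ` {..<n} \<union> t_coord X l ` {..<l}"

lemma coord_simps:
  "x \<in> X \<Longrightarrow> slice f t x = f (x, t)" "slice f t \<in> extensional X"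
  "\<lbrakk>x \<in> X; t \<in> affine_space l\<rbrakk> \<Longrightarrow> pull g (x, t) = g x" "pull g \<in> extensional Y"
  "x \<in> X \<Longrightarrow> x_coord i x = x i" "x_coord i \<in> extensional X"
  "\<lbrakk>x \<in> X; t \<in> affine_space l\<rbrakk> \<Longrightarrow> t_coord X l j (x, t) = t j" "t_coord X l j \<in> extensional Y"
  by (auto simp: slice_def pull_def x_coord_def t_coord_def Y_mem)

lemma x_coord_closed: "i < n \<Longrightarrow> x_coord i \<in> carrier OX"
  unfolding x_coord_def by (rule coord_restrict, rule poly_funs.coord) (auto simp: affine_coords_def)

lemma pull_x_coord: "restrict (\<lambda>p. fst p i) Y = pull (x_coord i)"
  by (rule Y_eqI) (auto simp: coord_simps Y_mem)

lemma coords_closed: "i < n \<Longrightarrow> pull (x_coord i) \<in> carrier OY" "j < l \<Longrightarrow> t_coord X l j \<in> carrier OY"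
  unfolding product_ring_def t_coord_def pull_x_coord[symmetric]
  by (rule coord_restrict, rule poly_funs.coord, blast)+

lemma OY_induct [consumes 1, case_names const x t add mult]:
  assumes "f \<in> carrier OY" and "\<And>c. Q (const_fun Y c)"
    and "\<And>i. i < n \<Longrightarrow> Q (pull (x_coord i))" and "\<And>j. j < l \<Longrightarrow> Q (t_coord X l j)"
    and "\<And>f g. \<lbrakk>f \<in> carrier OY; g \<in> carrier OY; Q f; Q g\<rbrakk> \<Longrightarrow> Q (f \<oplus>\<^bsub>OY\<^esub> g)"
    and "\<And>f g. \<lbrakk>f \<in> carrier OY; g \<in> carrier OY; Q f; Q g\<rbrakk> \<Longrightarrow> Q (f \<otimes>\<^bsub>OY\<^esub> g)"
  shows "Q f"
  using assms(1) unfolding product_ring_def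
proof (induction rule: coord_induct)
  case (coord g)
  then consider i where "i < n" "g = (\<lambda>p. fst p i)" | j where "j < l" "g = (\<lambda>p. snd p j)" by auto
  then show ?case
  proof cases
    case 1
    show ?thesis unfolding 1(2) pull_x_coord by (rule assms(3)[OF 1(1)])
  next
    case 2
    show ?thesis unfolding 2(2) using assms(4)[OF 2(1)] unfolding t_coord_def .
  qed
qed (use assms(2,5,6) in \<open>simp_all add: product_ring_def\<close>)

lemma OY_generated: "carrier OY = generate_ring OY (range (const_fun Y) \<union> coords)"
proof -
  have "(\<lambda>g. restrict g Y) ` ((\<lambda>i p. fst p i) ` {..<n} \<union> (\<lambda>j p. snd p j) ` {..<l}) = coords"
    by (simp only: image_Un image_image pull_x_coord t_coord_def[abs_def])
  then show ?thesis
    unfolding product_ring_def using coord_ring_generated[of Y "(\<lambda>i p. fst p i) ` {..<n} \<union> (\<lambda>j p. snd p j) ` {..<l}"]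
    by simp
qed

lemma OX_generated: "carrier OX = generate_ring OX (range (const_fun X) \<union> x_coord ` {..<n})"
proof -
  have "(\<lambda>g. restrict g X) ` affine_coords n = x_coord ` {..<n}"
    by (simp only: affine_coords_def image_image x_coord_def[abs_def])
  then show ?thesis using coord_ring_generated[of X "affine_coords n"] by simp
qed

lemma slice_simps:
  assumes "t \<in> affine_space l"
  shows "slice (const_fun Y c) t = const_fun X c" "slice (t_coord X l j) t = const_fun X (t j)"
    "slice (f \<oplus>\<^bsub>OY\<^esub> g) t = slice f t \<oplus>\<^bsub>OX\<^esub> slice g t"
    "slice (f \<otimes>\<^bsub>OY\<^esub> g) t = slice f t \<otimes>\<^bsub>OX\<^esub> slice g t"
  using assms
  by (auto intro!: extensionalityI[of _ X] simp: coord_simps OY_apply coord_apply coord_extensional Y_mem)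

lemma slice_pull: "g \<in> carrier OX \<Longrightarrow> t \<in> affine_space l \<Longrightarrow> slice (pull g) t = g"
  by (rule extensionalityI[of _ X]) (auto simp: coord_simps coord_extensional)

lemma slice_closed:
  assumes "f \<in> carrier OY" "t \<in> affine_space l"
  shows "slice f t \<in> carrier OX"
  using assms(1)
  by (induction rule: OY_induct)
     (use assms(2) in \<open>simp_all add: slice_simps slice_pull const_fun_closed x_coord_closed coord_closed\<close>)

lemma pull_const: "pull (const_fun X c) = const_fun Y c"
  by (rule Y_eqI) (auto simp: coord_simps OY_extensional coord_apply Y_mem)

lemma pull_hom: "pull \<in> ring_hom OX OY"
proof (rule ring_hom_memI)
  have add: "pull (f \<oplus>\<^bsub>OX\<^esub> g) = pull f \<oplus>\<^bsub>OY\<^esub> pull g" for f g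
    by (rule Y_eqI) (auto simp: coord_simps OY_apply OY_extensional coord_apply Y_mem)
  have mult: "pull (f \<otimes>\<^bsub>OX\<^esub> g) = pull f \<otimes>\<^bsub>OY\<^esub> pull g" for f g
    by (rule Y_eqI) (auto simp: coord_simps OY_apply OY_extensional coord_apply Y_mem)
  fix f g
  show "pull (f \<oplus>\<^bsub>OX\<^esub> g) = pull f \<oplus>\<^bsub>OY\<^esub> pull g" "pull (f \<otimes>\<^bsub>OX\<^esub> g) = pull f \<otimes>\<^bsub>OY\<^esub> pull g"
    by (rule add, rule mult)
  show "pull f \<in> carrier OY" if "f \<in> carrier OX" for f
    using that
  proof (induction rule: coord_induct)
    case (coord g)
    then obtain i where i: "g = (\<lambda>x. x i)" "i < n" by (auto simp: affine_coords_def)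
    show ?case unfolding i(1) using coords_closed(1)[OF i(2)] unfolding x_coord_def .
  qed (simp_all add: add mult OY_closed pull_const OY_const)
  show "pull \<one>\<^bsub>OX\<^esub> = \<one>\<^bsub>OY\<^esub>"
    by (simp add: coord_one_zero pull_const OY_one_zero)
qed

lemma pull_closed: "g \<in> carrier OX \<Longrightarrow> pull g \<in> carrier OY"
  by (rule ring_hom_closed[OF pull_hom])

lemma ext_apply:
  assumes "f \<in> carrier OY" "x \<in> X" "t \<in> affine_space l"
  shows "ext P f (x, t) = P (slice f t) x"
  using assms by (simp add: extend_op_def slice_def Y_mem)

lemma ext_extensional: "f \<in> carrier OY \<Longrightarrow> ext P f \<in> extensional Y" "ext P \<in> extensional (carrier OY)"
  by (auto simp: extend_op_def)

lemma ext_mult_op: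
  assumes "g \<in> carrier OX"
  shows "ext (mult_op OX g) = mult_op OY (pull g)"
proof (rule OY.endo_eqI)
  fix f assume f: "f \<in> carrier OY"
  show "ext (mult_op OX g) f = mult_op OY (pull g) f"
    by (rule Y_eqI)
       (use f assms in \<open>auto simp: ext_extensional OY.endo_apply OY_extensional ext_apply OX.endo_apply
          slice_closed coord_apply OY_apply Y_mem coord_simps\<close>)
qed (auto simp: ext_extensional OY.endo_op_extensional)

text \<open>An operator on \<open>X\<close> acts on each slice separately.\<close>

lemma slice_ext:
  assumes "f \<in> carrier OY" "t \<in> affine_space l" "P \<in> carrier OX.E"
  shows "slice (ext P f) t = P (slice f t)"
proof -
  have "P (slice f t) \<in> extensional X"
    by (rule coord_extensional(1)) (rule OX.endoD(2)[OF assms(3) slice_closed[OF assms(1,2)]])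
  then show ?thesis
    by (intro extensionalityI[of _ X]) (use assms in \<open>auto simp: coord_simps ext_apply\<close>)
qed

text \<open>In a product, \<open>P\<close> is applied to slices of \<open>ext Q f\<close>, so \<open>ext Q f\<close> must be known to be a function on the product.\<close>

lemma ext_hom:
  assumes "P \<in> carrier OX.E" "Q \<in> carrier OX.E"
  shows "ext (P \<oplus>\<^bsub>OX.E\<^esub> Q) = ext P \<oplus>\<^bsub>OY.E\<^esub> ext Q"
    and "ext Q \<in> carrier OY.E \<Longrightarrow> ext (P \<otimes>\<^bsub>OX.E\<^esub> Q) = ext P \<otimes>\<^bsub>OY.E\<^esub> ext Q"
proof -
  show "ext (P \<oplus>\<^bsub>OX.E\<^esub> Q) = ext P \<oplus>\<^bsub>OY.E\<^esub> ext Q"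
  proof (rule OY.endo_eqI)
    fix f assume f: "f \<in> carrier OY"
    show "ext (P \<oplus>\<^bsub>OX.E\<^esub> Q) f = (ext P \<oplus>\<^bsub>OY.E\<^esub> ext Q) f"
      by (rule Y_eqI)
         (use f in \<open>auto simp: ext_extensional OY.endo_apply OY_extensional ext_apply OX.endo_apply
            slice_closed coord_apply OY_apply Y_mem\<close>)
  qed (auto simp: ext_extensional OY.endo_op_extensional)
  assume Q: "ext Q \<in> carrier OY.E"
  show "ext (P \<otimes>\<^bsub>OX.E\<^esub> Q) = ext P \<otimes>\<^bsub>OY.E\<^esub> ext Q"
  proof (rule OY.endo_eqI)
    fix f assume f: "f \<in> carrier OY"
    then have Qf: "ext Q f \<in> carrier OY" using OY.endoD(2)[OF Q] by blast
    show "ext (P \<otimes>\<^bsub>OX.E\<^esub> Q) f = (ext P \<otimes>\<^bsub>OY.E\<^esub> ext Q) f"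
      by (intro Y_eqI)
         (use f Qf assms(2) in \<open>auto simp: ext_extensional OY.endo_apply ext_apply OX.endo_apply slice_closed slice_ext\<close>)
  qed (auto simp: ext_extensional OY.endo_op_extensional)
qed

lemma ext_pull:
  assumes "\<delta> \<in> carrier OX.E" "g \<in> carrier OX"
  shows "ext \<delta> (pull g) = pull (\<delta> g)"
  by (rule Y_eqI) (use assms in \<open>auto simp: ext_extensional pull_closed ext_apply slice_pull coord_simps\<close>)

lemma ext_derivation_coord:
  assumes "\<delta> \<in> derivations OX (const_fun X)"
  shows "ext \<delta> (const_fun Y c) = const_fun Y 0" "j < l \<Longrightarrow> ext \<delta> (t_coord X l j) = const_fun Y 0"
  using OX.derivation_scalar[OF assms]
  by (auto intro!: Y_eqI simp: ext_extensional OY_extensional OY_const coords_closed ext_apply slice_simps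
       coord_apply Y_mem)

text \<open>That \<open>P\<close> preserves the ring of functions only has to be checked on coordinates: the Leibniz rule extends it to
  polynomials in them.\<close>

lemma derivationI:
  assumes "P \<in> extensional (carrier OY)" "\<And>f. f \<in> carrier OY \<Longrightarrow> P f \<in> extensional Y"
    and const: "\<And>c. P (const_fun Y c) = const_fun Y 0"
    and x: "\<And>i. i < n \<Longrightarrow> P (pull (x_coord i)) \<in> carrier OY"
    and t: "\<And>j. j < l \<Longrightarrow> P (t_coord X l j) \<in> carrier OY"
    and add: "\<And>f g x t. \<lbrakk>f \<in> carrier OY; g \<in> carrier OY; x \<in> X; t \<in> affine_space l\<rbrakk> \<Longrightarrow>
      P (f \<oplus>\<^bsub>OY\<^esub> g) (x, t) = P f (x, t) + P g (x, t)"
    and leibniz: "\<And>f g x t. \<lbrakk>f \<in> carrier OY; g \<in> carrier OY; x \<in> X; t \<in> affine_space l\<rbrakk> \<Longrightarrow>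
      P (f \<otimes>\<^bsub>OY\<^esub> g) (x, t) = f (x, t) * P g (x, t) + g (x, t) * P f (x, t)"
  shows "P \<in> derivations OY (const_fun Y)"
proof -
  have add': "P (f \<oplus>\<^bsub>OY\<^esub> g) = P f \<oplus>\<^bsub>OY\<^esub> P g" if "f \<in> carrier OY" "g \<in> carrier OY" for f g
    by (rule Y_eqI) (use that assms(2) in \<open>auto simp: add OY_apply OY_extensional Y_mem OY_closed\<close>)
  have leibniz': "P (f \<otimes>\<^bsub>OY\<^esub> g) = f \<otimes>\<^bsub>OY\<^esub> P g \<oplus>\<^bsub>OY\<^esub> g \<otimes>\<^bsub>OY\<^esub> P f"
    if "f \<in> carrier OY" "g \<in> carrier OY" for f g
    by (rule Y_eqI) (use that assms(2) in \<open>auto simp: leibniz OY_apply OY_extensional Y_mem OY_closed\<close>)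
  have closed: "P f \<in> carrier OY" if "f \<in> carrier OY" for f
    using that
    by (induction rule: OY_induct) (auto simp: const x t add' leibniz' OY_const intro!: OY_closed)
  have "P (const_fun Y c \<otimes>\<^bsub>OY\<^esub> f) = const_fun Y c \<otimes>\<^bsub>OY\<^esub> P f" if "f \<in> carrier OY" for c f
    using leibniz'[OF OY_const that, of c] that closed[OF that]
    by (simp add: const OY_one_zero[symmetric])
  then have "P \<in> carrier OY.E"
    using assms(1) closed add' by (intro OY.endo_memI) auto
  then show ?thesis using leibniz' by (simp add: derivations_def)
qed

lemma ext_derivation:
  assumes \<delta>: "\<delta> \<in> derivations OX (const_fun X)"
  shows "ext \<delta> \<in> derivations OY (const_fun Y)"
proof (rule derivationI)
  fix f g x t assume fg: "f \<in> carrier OY" "g \<in> carrier OY" and xt: "x \<in> X" "t \<in> affine_space l"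
  note sl = slice_closed[OF fg(1) xt(2)] slice_closed[OF fg(2) xt(2)]
  show "ext \<delta> (f \<oplus>\<^bsub>OY\<^esub> g) (x, t) = ext \<delta> f (x, t) + ext \<delta> g (x, t)"
    using fg xt sl OX.endoD(3)[OF OX.derivationD(1)[OF \<delta>] sl]
    by (simp add: ext_apply OY_closed slice_simps coord_apply)
  show "ext \<delta> (f \<otimes>\<^bsub>OY\<^esub> g) (x, t) = f (x, t) * ext \<delta> g (x, t) + g (x, t) * ext \<delta> f (x, t)"
    using fg xt sl OX.derivationD(2)[OF \<delta> sl]
    by (simp add: ext_apply OY_closed slice_simps coord_apply coord_simps)
next
  fix i assume i: "i < n"
  show "ext \<delta> (pull (x_coord i)) \<in> carrier OY"
    unfolding ext_pull[OF OX.derivationD(1)[OF \<delta>] x_coord_closed[OF i]]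
    by (rule pull_closed, rule OX.derivationD(3)[OF \<delta> x_coord_closed[OF i]])
qed (use ext_derivation_coord[OF \<delta>] in \<open>simp_all add: ext_extensional OY_const\<close>)

lemma affine_update: "t \<in> affine_space l \<Longrightarrow> j < l \<Longrightarrow> t(j := s) \<in> affine_space l"
  by (auto simp: affine_space_def PiE_def extensional_def)

lemma euler_apply:
  assumes "f \<in> carrier OY" "x \<in> X" "t \<in> affine_space l"
  shows "euler j f (x, t) = t j * deriv (\<lambda>s. f (x, t(j := s))) (t j)"
  using assms by (simp add: euler_op_def Y_mem)

lemma euler_extensional: "f \<in> carrier OY \<Longrightarrow> euler j f \<in> extensional Y" "euler j \<in> extensional (carrier OY)"
  by (auto simp: euler_op_def)

lemma differentiable_along_t:
  assumes "f \<in> carrier OY" "x \<in> X" "t \<in> affine_space l" "j < l"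
  shows "(\<lambda>s. f (x, t(j := s))) field_differentiable at s"
  using assms(1)
proof (induction rule: OY_induct)
  case (t i)
  have eq: "(\<lambda>s. t_coord X l i (x, t(j := s))) = (\<lambda>s. if i = j then s else t i)"
    using assms by (auto simp: coord_simps affine_update)
  show ?case unfolding eq by (cases "i = j") auto
next
  case (add f g)
  have eq: "(\<lambda>s. (f \<oplus>\<^bsub>OY\<^esub> g) (x, t(j := s))) = (\<lambda>s. f (x, t(j := s)) + g (x, t(j := s)))"
    using assms by (auto simp: OY_apply Y_mem affine_update)
  show ?case unfolding eq by (intro field_differentiable_add add)
next
  case (mult f g)
  have eq: "(\<lambda>s. (f \<otimes>\<^bsub>OY\<^esub> g) (x, t(j := s))) = (\<lambda>s. f (x, t(j := s)) * g (x, t(j := s)))"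
    using assms by (auto simp: OY_apply Y_mem affine_update)
  show ?case unfolding eq by (intro field_differentiable_mult mult)
qed (use assms in \<open>simp_all add: coord_apply coord_simps Y_mem affine_update del: fun_upd_apply\<close>)

lemma euler_coord:
  assumes "j < l"
  shows "euler j (const_fun Y c) = const_fun Y 0"
    "i < l \<Longrightarrow> euler j (t_coord X l i) = (if i = j then t_coord X l i else const_fun Y 0)"
    "g \<in> carrier OX \<Longrightarrow> euler j (pull g) = const_fun Y 0"
proof -
  show "euler j (const_fun Y c) = const_fun Y 0"
    by (rule Y_eqI) (use assms in \<open>auto simp: euler_extensional OY_extensional OY_const euler_apply
         coord_apply Y_mem affine_update\<close>)
  show "euler j (pull g) = const_fun Y 0" if "g \<in> carrier OX"
    by (rule Y_eqI) (use assms that in \<open>auto simp: euler_extensional OY_extensional pull_closed euler_apply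
         coord_apply coord_simps Y_mem affine_update\<close>)
  show "euler j (t_coord X l i) = (if i = j then t_coord X l i else const_fun Y 0)" if "i < l"
    by (rule Y_eqI) (use assms that in \<open>auto simp: euler_extensional OY_extensional coords_closed euler_apply
         coord_apply coord_simps Y_mem affine_update\<close>)
qed

lemma euler_derivation:
  assumes j: "j < l"
  shows "euler j \<in> derivations OY (const_fun Y)"
proof (rule derivationI)
  fix f g x t assume fg: "f \<in> carrier OY" "g \<in> carrier OY" and xt: "x \<in> X" "t \<in> affine_space l"
  note diff = differentiable_along_t[OF fg(1) xt j] differentiable_along_t[OF fg(2) xt j]
  show "euler j (f \<oplus>\<^bsub>OY\<^esub> g) (x, t) = euler j f (x, t) + euler j g (x, t)"
    using fg xt j diff
    by (simp add: euler_apply OY_closed OY_apply Y_mem affine_update deriv_add distrib_left)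
  show "euler j (f \<otimes>\<^bsub>OY\<^esub> g) (x, t) = f (x, t) * euler j g (x, t) + g (x, t) * euler j f (x, t)"
    using fg xt j diff
    by (simp add: euler_apply OY_closed OY_apply Y_mem affine_update deriv_mult algebra_simps)
qed (use j in \<open>simp_all add: euler_extensional euler_coord OY_const coords_closed x_coord_closed\<close>)

text \<open>Both sides act on slices, where they are the same commutator.\<close>

lemma ext_bracket:
  assumes "\<delta> \<in> derivations OX (const_fun X)" "\<epsilon> \<in> derivations OX (const_fun X)"
  shows "OY.bracket (ext \<delta>) (ext \<epsilon>) = ext (OX.bracket \<delta> \<epsilon>)"
proof (rule OY.endo_eqI)
  fix f assume f: "f \<in> carrier OY"
  note ex = OY.derivationD(3)[OF ext_derivation[OF assms(1)]] OY.derivationD(3)[OF ext_derivation[OF assms(2)]]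
  note dx = OX.derivationD(3)[OF assms(1)] OX.derivationD(3)[OF assms(2)]
  have diff: "(g \<ominus>\<^bsub>OY\<^esub> h) p = g p - h p" if "p \<in> Y" "g \<in> carrier OY" "h \<in> carrier OY" for g h p
    using that unfolding product_ring_def by (rule coord_minus_apply)
  have "OY.bracket (ext \<delta>) (ext \<epsilon>) f \<in> carrier OY"
    using f ex by (simp add: OY.bracket_def)
  then show "OY.bracket (ext \<delta>) (ext \<epsilon>) f = ext (OX.bracket \<delta> \<epsilon>) f"
  proof (intro Y_eqI)
    fix x t assume xt: "x \<in> X" "t \<in> affine_space l"
    note st = slice_closed[OF f xt(2)]
    have "OY.bracket (ext \<delta>) (ext \<epsilon>) f (x, t) = ext \<delta> (ext \<epsilon> f) (x, t) - ext \<epsilon> (ext \<delta> f) (x, t)"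
      using f ex xt by (simp add: OY.bracket_def diff Y_mem)
    also have "\<dots> = \<delta> (\<epsilon> (slice f t)) x - \<epsilon> (\<delta> (slice f t)) x"
      using f ex xt OX.derivationD(1)[OF assms(1)] OX.derivationD(1)[OF assms(2)]
      by (simp add: ext_apply slice_ext)
    also have "\<dots> = ext (OX.bracket \<delta> \<epsilon>) f (x, t)"
      using f st dx xt by (simp add: ext_apply OX.bracket_def coord_minus_apply)
    finally show "OY.bracket (ext \<delta>) (ext \<epsilon>) f (x, t) = ext (OX.bracket \<delta> \<epsilon>) f (x, t)" .
  qed (use f in \<open>auto simp: OY_extensional ext_extensional\<close>)
qed (auto simp: OY.bracket_def ext_extensional)

text \<open>A commutator of derivations is a derivation, hence vanishes if it vanishes on coordinates.\<close>

lemma bracket_zeroI: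
  assumes "\<delta> \<in> derivations OY (const_fun Y)" "\<epsilon> \<in> derivations OY (const_fun Y)"
    and "\<And>b. b \<in> coords \<Longrightarrow> \<delta> (\<epsilon> b) = \<epsilon> (\<delta> b)"
  shows "OY.bracket \<delta> \<epsilon> = \<zero>\<^bsub>OY.E\<^esub>"
proof (rule OY.derivation_eqI[OF OY_generated])
  fix b assume b: "b \<in> coords"
  then have "b \<in> carrier OY" using coords_closed by auto
  moreover from this have "\<epsilon> (\<delta> b) \<in> carrier OY"
    by (intro OY.derivationD(3)[OF assms(1)] OY.derivationD(3)[OF assms(2)])
  ultimately show "OY.bracket \<delta> \<epsilon> b = \<zero>\<^bsub>OY.E\<^esub> b"
    using assms(3)[OF b] by (simp add: OY.bracket_def OY.endo_apply OY.minus_eq OY.r_neg)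
qed (intro OY.bracket_derivation OY.zero_derivation assms(1,2))+

lemma euler_brackets:
  assumes j: "j < l"
  shows "k < l \<Longrightarrow> OY.bracket (euler j) (euler k) = \<zero>\<^bsub>OY.E\<^esub>"
    and "\<delta> \<in> derivations OX (const_fun X) \<Longrightarrow> OY.bracket (ext \<delta>) (euler j) = \<zero>\<^bsub>OY.E\<^esub>"
    and "\<delta> \<in> derivations OX (const_fun X) \<Longrightarrow> OY.bracket (euler j) (ext \<delta>) = \<zero>\<^bsub>OY.E\<^esub>"
proof -
  show "OY.bracket (euler j) (euler k) = \<zero>\<^bsub>OY.E\<^esub>" if k: "k < l"
  proof (rule bracket_zeroI[OF euler_derivation[OF j] euler_derivation[OF k]])
    fix b assume "b \<in> coords"
    then show "euler j (euler k b) = euler k (euler j b)"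
      using j k by (auto simp: euler_coord x_coord_closed)
  qed
  have commute: "ext \<delta> (euler j b) = euler j (ext \<delta> b)"
    if \<delta>: "\<delta> \<in> derivations OX (const_fun X)" and b: "b \<in> coords" for b \<delta>
    using b
  proof
    assume "b \<in> (\<lambda>i. pull (x_coord i)) ` {..<n}"
    then obtain i where i: "b = pull (x_coord i)" "i < n" by blast
    have "\<delta> (x_coord i) \<in> carrier OX"
      by (rule OX.derivationD(3)[OF \<delta> x_coord_closed[OF i(2)]])
    then show ?thesis
      unfolding i(1) using x_coord_closed[OF i(2)] j
      by (simp add: euler_coord ext_derivation_coord[OF \<delta>] ext_pull[OF OX.derivationD(1)[OF \<delta>]])
  next
    assume "b \<in> t_coord X l ` {..<l}"
    then show ?thesis using j by (auto simp: euler_coord ext_derivation_coord[OF \<delta>])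
  qed
  show "OY.bracket (ext \<delta>) (euler j) = \<zero>\<^bsub>OY.E\<^esub>" if \<delta>: "\<delta> \<in> derivations OX (const_fun X)"
    by (rule bracket_zeroI[OF ext_derivation[OF \<delta>] euler_derivation[OF j]]) (rule commute[OF \<delta>])
  show "OY.bracket (euler j) (ext \<delta>) = \<zero>\<^bsub>OY.E\<^esub>" if \<delta>: "\<delta> \<in> derivations OX (const_fun X)"
    by (rule bracket_zeroI[OF euler_derivation[OF j] ext_derivation[OF \<delta>]]) (rule commute[OF \<delta>, symmetric])
qed

end

section \<open>Logarithmic differential operators\<close>

lemma (in complex_algebra_ring) subring_algebra:
  assumes "subring S A" "range \<kappa> \<subseteq> S"
  shows "complex_algebra_ring (A\<lparr>carrier := S\<rparr>) \<kappa>"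
proof -
  have "ring (A\<lparr>carrier := S\<rparr>)" by (rule subring_is_ring[OF assms(1)])
  moreover have "\<kappa> \<in> ring_hom ring_of_type_algebra (A\<lparr>carrier := S\<rparr>)"
    using assms(2) complex_algebra_map(2-4)[OF algebra]
    by (intro ring_hom_memI) (auto simp: ring_of_type_algebra_def)
  moreover have "\<forall>c. \<forall>a\<in>S. \<kappa> c \<otimes> a = a \<otimes> \<kappa> c"
    using scalar_central subringE(1)[OF assms(1)] by blast
  ultimately show ?thesis
    by (simp add: complex_algebra_ring_def complex_algebra_ring_axioms_def complex_algebra_def)
qed

context product_variety
begin

abbreviation "DX \<equiv> diff_ops OX (const_fun X)"
abbreviation "DY \<equiv> diff_ops OY (const_fun Y)"
abbreviation "DL \<equiv> log_diff_ops n X l"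
abbreviation "derX \<equiv> derivations OX (const_fun X)"
abbreviation "log_gens \<equiv> ext ` carrier DX \<union> (\<lambda>j. mult_op OY (t_coord X l j)) ` {..<l} \<union> euler ` {..<l}"

lemma derX_subset: "derX \<subseteq> carrier OX.E"
  by (auto intro: OX.derivationD)

text \<open>The operators on \<open>X\<close> are generated by functions and vector fields, and \<open>ext\<close> is compatible with sums and
  products of those operators whose extension is already known to preserve functions on the product.\<close>

lemma ext_induct:
  assumes P: "P \<in> carrier DX" and S: "S \<subseteq> carrier OY.E"
    and add: "\<And>Q Q'. \<lbrakk>Q \<in> S; Q' \<in> S\<rbrakk> \<Longrightarrow> Q \<oplus>\<^bsub>OY.E\<^esub> Q' \<in> S"
    and mult: "\<And>Q Q'. \<lbrakk>Q \<in> S; Q' \<in> S\<rbrakk> \<Longrightarrow> Q \<otimes>\<^bsub>OY.E\<^esub> Q' \<in> S"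
    and func: "\<And>g. g \<in> carrier OX \<Longrightarrow> mult_op OY (pull g) \<in> S"
    and field: "\<And>\<delta>. \<delta> \<in> derX \<Longrightarrow> ext \<delta> \<in> S"
  shows "ext P \<in> S"
proof -
  interpret E: complex_algebra_ring OX.E "\<lambda>c. mult_op OX (const_fun X c)"
    using OX.endo_complex_algebra OX.endo_ring_ring
    by (simp add: complex_algebra_ring_def complex_algebra_ring_axioms_def)
  have gens: "mult_op OX g \<in> carrier OX.E \<and> ext (mult_op OX g) \<in> S" if "g \<in> carrier OX" for g
    using that func ext_mult_op OX.mult_op_closed by simp
  have "P \<in> generate_ring OX.E (mult_op OX ` carrier OX \<union> derX)"
    using P by (simp add: diff_ops_def)
  then have "P \<in> carrier OX.E \<and> ext P \<in> S"
  proof induction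
    case one
    show ?case using gens[OF OX.one_closed] ring_hom_one[OF OX.mult_op_hom] by simp
  next
    case (incl h)
    then show ?case using gens field derX_subset by blast
  next
    case (a_inv h)
    then have "\<ominus>\<^bsub>OX.E\<^esub> h = mult_op OX (const_fun X (-1)) \<otimes>\<^bsub>OX.E\<^esub> h"
      using E.A.sc_minus_one[of h] by simp
    moreover have "ext (mult_op OX (const_fun X (-1)) \<otimes>\<^bsub>OX.E\<^esub> h) = ext (mult_op OX (const_fun X (-1))) \<otimes>\<^bsub>OY.E\<^esub> ext h"
      using a_inv gens[OF const_fun_closed] S by (intro ext_hom(2)) auto
    ultimately show ?case using a_inv gens[OF const_fun_closed] mult by auto
  next
    case (eng_add h h')
    then show ?case using ext_hom(1) add by auto
  next
    case (eng_mult h h')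
    then have "ext (h \<otimes>\<^bsub>OX.E\<^esub> h') = ext h \<otimes>\<^bsub>OY.E\<^esub> ext h'"
      using S by (intro ext_hom(2)) auto
    then show ?case using eng_mult mult by auto
  qed
  then show ?thesis by blast
qed

lemma DY_algebra: "complex_algebra_ring DY (log_scalar n X l)" and DY_subset: "carrier DY \<subseteq> carrier OY.E"
  and DY_gens: "mult_op OY ` carrier OY \<subseteq> carrier DY" "derivations OY (const_fun Y) \<subseteq> carrier DY"
proof -
  interpret E: complex_algebra_ring OY.E "log_scalar n X l"
    unfolding log_scalar_def using OY.endo_complex_algebra OY.endo_ring_ring
    by (simp add: complex_algebra_ring_def complex_algebra_ring_axioms_def)
  have sub: "mult_op OY ` carrier OY \<union> derivations OY (const_fun Y) \<subseteq> carrier OY.E"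
    using OY.mult_op_closed OY.derivationD(1) by blast
  show DY: "mult_op OY ` carrier OY \<subseteq> carrier DY" "derivations OY (const_fun Y) \<subseteq> carrier DY"
    unfolding diff_ops_def by (auto intro: generate_ring.incl)
  then have "range (log_scalar n X l) \<subseteq> generate_ring OY.E (mult_op OY ` carrier OY \<union> derivations OY (const_fun Y))"
    using OY_const unfolding log_scalar_def diff_ops_def by auto
  then show "complex_algebra_ring DY (log_scalar n X l)"
    unfolding diff_ops_def by (intro E.subring_algebra E.generate_ring_is_subring sub)
  show "carrier DY \<subseteq> carrier OY.E"
    unfolding diff_ops_def using E.generate_ring_incl[OF sub] by simp
qed

sublocale DY: complex_algebra_ring DY "log_scalar n X l"
  by (rule DY_algebra)

lemma DY_ops: "P \<otimes>\<^bsub>DY\<^esub> Q = P \<otimes>\<^bsub>OY.E\<^esub> Q" "P \<oplus>\<^bsub>DY\<^esub> Q = P \<oplus>\<^bsub>OY.E\<^esub> Q" "\<zero>\<^bsub>DY\<^esub> = \<zero>\<^bsub>OY.E\<^esub>" "\<one>\<^bsub>DY\<^esub> = \<one>\<^bsub>OY.E\<^esub>"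
  by (simp_all add: diff_ops_def)

lemma log_gens_subset: "log_gens \<subseteq> carrier DY"
proof -
  have "ext P \<in> carrier DY" if "P \<in> carrier DX" for P
    by (rule ext_induct[OF that DY_subset])
       (use DY.a_closed DY.m_closed DY_gens pull_closed ext_derivation in \<open>auto simp flip: DY_ops\<close>)
  moreover have "mult_op OY (t_coord X l j) \<in> carrier DY" "euler j \<in> carrier DY" if "j < l" for j
    using DY_gens coords_closed(2)[OF that] euler_derivation[OF that] by blast+
  ultimately show ?thesis by blast
qed

lemma DL_def: "DL = DY\<lparr>carrier := generate_ring DY log_gens\<rparr>"
  by (simp only: log_diff_ops_def Let_def)

lemma DL_carrier: "carrier DL = generate_ring DY log_gens"
  by (simp add: DL_def)

lemma DL_ops: "P \<otimes>\<^bsub>DL\<^esub> Q = P \<otimes>\<^bsub>OY.E\<^esub> Q" "P \<oplus>\<^bsub>DL\<^esub> Q = P \<oplus>\<^bsub>OY.E\<^esub> Q" "\<zero>\<^bsub>DL\<^esub> = \<zero>\<^bsub>OY.E\<^esub>" "\<one>\<^bsub>DL\<^esub> = \<one>\<^bsub>OY.E\<^esub>"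
  by (simp_all add: DL_def DY_ops)

lemma DX_gens: "g \<in> carrier OX \<Longrightarrow> mult_op OX g \<in> carrier DX" "\<delta> \<in> derX \<Longrightarrow> \<delta> \<in> carrier DX"
  unfolding diff_ops_def by (auto intro: generate_ring.incl)

lemma DL_gens:
  "g \<in> carrier OX \<Longrightarrow> mult_op OY (pull g) \<in> carrier DL"
  "\<delta> \<in> derX \<Longrightarrow> ext \<delta> \<in> carrier DL"
  "j < l \<Longrightarrow> mult_op OY (t_coord X l j) \<in> carrier DL"
  "j < l \<Longrightarrow> euler j \<in> carrier DL"
  unfolding DL_carrier using DX_gens ext_mult_op by (auto intro!: generate_ring.incl) (metis imageI)

sublocale DL: complex_algebra_ring DL "log_scalar n X l"
proof -
  have "range (log_scalar n X l) \<subseteq> generate_ring DY log_gens"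
    using DL_gens(1)[OF const_fun_closed] unfolding DL_carrier log_scalar_def pull_const by blast
  then show "complex_algebra_ring DL (log_scalar n X l)"
    unfolding DL_def by (intro DY.subring_algebra DY.generate_ring_is_subring log_gens_subset)
qed

lemma mult_op_DL: "f \<in> carrier OY \<Longrightarrow> mult_op OY f \<in> carrier DL"
proof (induction rule: OY_induct)
  case (const c)
  show ?case using DL_gens(1)[OF const_fun_closed, of c] by (simp add: pull_const)
next
  case (x i)
  then show ?case by (intro DL_gens(1) x_coord_closed)
next
  case (t j)
  then show ?case by (rule DL_gens(3))
next
  case (add f g)
  then show ?case
    using DL.a_closed ring_hom_add[OF OY.mult_op_hom add(1,2)] by (simp add: DL_ops)
next
  case (mult f g)
  then show ?case
    using DL.m_closed ring_hom_mult[OF OY.mult_op_hom mult(1,2)] by (simp add: DL_ops)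
qed

text \<open>All functions on the product may be used as generators, not only the \<open>t\<^sub>j\<close>, since functions on \<open>X\<close> are among the
  operators on \<open>X\<close>.\<close>

lemma DL_induct:
  assumes P: "P \<in> carrier DL" and S: "S \<subseteq> carrier DL"
    and add: "\<And>Q Q'. \<lbrakk>Q \<in> S; Q' \<in> S\<rbrakk> \<Longrightarrow> Q \<oplus>\<^bsub>OY.E\<^esub> Q' \<in> S"
    and mult: "\<And>Q Q'. \<lbrakk>Q \<in> S; Q' \<in> S\<rbrakk> \<Longrightarrow> Q \<otimes>\<^bsub>OY.E\<^esub> Q' \<in> S"
    and func: "\<And>f. f \<in> carrier OY \<Longrightarrow> mult_op OY f \<in> S"
    and field: "\<And>\<delta>. \<delta> \<in> derX \<Longrightarrow> ext \<delta> \<in> S" "\<And>j. j < l \<Longrightarrow> euler j \<in> S"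
  shows "P \<in> S"
proof -
  have DL_E: "carrier DL \<subseteq> carrier OY.E"
    using DY.generate_ring_incl[OF log_gens_subset] DY_subset unfolding DL_carrier by blast
  have sub: "S \<subseteq> carrier DY" "S \<subseteq> carrier OY.E"
    using S DL_E DY.generate_ring_incl[OF log_gens_subset] unfolding DL_carrier by blast+
  have scalar: "log_scalar n X l c \<in> S" for c
    unfolding log_scalar_def by (rule func[OF OY_const])
  have space: "DY.A.csubspace S"
  proof (rule DY.A.csubspaceI)
    have "mult_op OY \<zero>\<^bsub>OY\<^esub> = \<zero>\<^bsub>DY\<^esub>"
      using DY.scalar_zero by (simp add: log_scalar_def OY_one_zero)
    then show "\<zero>\<^bsub>DY\<^esub> \<in> S" using func[OF OY.zero_closed] by simp
  qed (use sub add mult scalar in \<open>auto simp: DY_ops\<close>)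
  have "generate_ring DY log_gens \<subseteq> S"
  proof (rule DY.generate_ring_subset[OF _ space])
    have "ext P \<in> S" if "P \<in> carrier DX" for P
      by (rule ext_induct[OF that sub(2) add mult]) (use func pull_closed field in auto)
    then show "log_gens \<subseteq> S" using func coords_closed(2) field by auto
    show "\<one>\<^bsub>DY\<^esub> \<in> S"
      using scalar[of 1] complex_algebra_map(4)[OF DY.algebra] by simp
  qed (use mult in \<open>simp add: DY_ops\<close>)
  then show ?thesis using P unfolding DL_carrier by blast
qed

definition t_monomial :: "(nat \<Rightarrow> nat) \<Rightarrow> point \<Rightarrow> complex" where
  "t_monomial m = (\<lambda>p\<in>Y. \<Prod>j<l. snd p j ^ m j)"

lemma t_monomial_closed: "t_monomial m \<in> carrier OY"
proof -
  let ?G = "(\<lambda>i p. fst p i) ` {..<n} \<union> (\<lambda>j p. snd p j) ` {..<l} :: (point \<Rightarrow> complex) set"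
  have pow: "(\<lambda>p. snd p j ^ k) \<in> poly_funs ?G" if "j < l" for j k
  proof (induction k)
    case 0
    show ?case using poly_funs.const[of 1] by simp
  next
    case (Suc k)
    have "(\<lambda>p. snd p j) \<in> poly_funs ?G" using that by (intro poly_funs.coord) auto
    from poly_funs.mult[OF this Suc] show ?case by simp
  qed
  have "(\<lambda>p. \<Prod>j<k. snd p j ^ m j) \<in> poly_funs ?G" if "k \<le> l" for k
    using that
  proof (induction k)
    case 0
    show ?case using poly_funs.const[of 1] by simp
  next
    case (Suc k)
    then show ?case using poly_funs.mult[OF Suc.IH pow[of k "m k"]] by simp
  qed
  from coord_restrict[OF this[OF order_refl]] show ?thesis
    unfolding t_monomial_def product_ring_def .
qed

lemma t_monomial_apply: "x \<in> X \<Longrightarrow> t \<in> affine_space l \<Longrightarrow> t_monomial m (x, t) = (\<Prod>j<l. t j ^ m j)"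
  by (simp add: t_monomial_def Y_mem)

lemma ext_t_monomial:
  assumes "\<delta> \<in> derX"
  shows "ext \<delta> (t_monomial m) = \<zero>\<^bsub>OY\<^esub>"
proof (rule Y_eqI)
  fix x t assume xt: "x \<in> X" "t \<in> affine_space l"
  have "slice (t_monomial m) t = const_fun X (\<Prod>j<l. t j ^ m j)"
    by (rule extensionalityI[of _ X]) (use xt in \<open>auto simp: coord_simps coord_apply coord_extensional t_monomial_apply\<close>)
  then show "ext \<delta> (t_monomial m) (x, t) = \<zero>\<^bsub>OY\<^esub> (x, t)"
    using xt t_monomial_closed OX.derivation_scalar[OF assms] by (simp add: ext_apply OY_apply coord_apply Y_mem)
qed (auto simp: ext_extensional t_monomial_closed OY_extensional)

text \<open>The monomial is an eigenfunction of \<open>t\<^sub>j \<partial>\<^sub>j\<close> with eigenvalue its exponent \<open>m\<^sub>j\<close>.\<close>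

lemma euler_t_monomial:
  assumes j: "j < l"
  shows "euler j (t_monomial m) = const_fun Y (of_nat (m j)) \<otimes>\<^bsub>OY\<^esub> t_monomial m"
proof (rule Y_eqI)
  fix x t assume xt: "x \<in> X" "t \<in> affine_space l"
  define C where "C = (\<Prod>i\<in>{..<l} - {j}. t i ^ m i)"
  have split: "(\<Prod>i<l. (t(j := s)) i ^ m i) = s ^ m j * C" for s
  proof -
    have "(\<Prod>i<l. (t(j := s)) i ^ m i) = (t(j := s)) j ^ m j * (\<Prod>i\<in>{..<l} - {j}. (t(j := s)) i ^ m i)"
      by (rule prod.remove) (use j in auto)
    also have "(\<Prod>i\<in>{..<l} - {j}. (t(j := s)) i ^ m i) = C"
      unfolding C_def by (rule prod.cong) auto
    finally show ?thesis by simp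
  qed
  have fn: "(\<lambda>s. t_monomial m (x, t(j := s))) = (\<lambda>s. s ^ m j * C)"
    using xt j by (simp only: t_monomial_apply affine_update split)
  have "deriv (\<lambda>s. s ^ m j * C) (t j) = of_nat (m j) * t j ^ (m j - 1) * C"
    by (rule DERIV_imp_deriv) (auto intro!: derivative_eq_intros)
  moreover have "t j * (of_nat (m j) * t j ^ (m j - 1) * C) = of_nat (m j) * (t j ^ m j * C)"
    by (cases "m j") auto
  moreover have "t j ^ m j * C = (\<Prod>i<l. t i ^ m i)" using split[of "t j"] by simp
  ultimately show "euler j (t_monomial m) (x, t) = (const_fun Y (of_nat (m j)) \<otimes>\<^bsub>OY\<^esub> t_monomial m) (x, t)"
    using xt by (simp add: euler_apply t_monomial_closed fn OY_apply Y_mem t_monomial_apply)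
qed (auto simp: euler_extensional t_monomial_closed OY_extensional)

end

section \<open>The logarithmic Artin--Rees property\<close>

text \<open>The full algebra: logarithmic operators tensored with a commutative algebra \<open>R\<close> that is generated by the
  finite set \<open>F\<close>.\<close>

locale log_operators = product_variety n l X + tensor_product "log_diff_ops n X l" "log_scalar n X l" R \<phi> + R: cring R
  for n l :: nat and X and R :: "('r, 'y) ring_scheme" (structure) and \<phi> +
  fixes F :: "'r set"
  assumes F: "finite F" "F \<subseteq> carrier R" and R_generated: "carrier R = generate_ring R (range \<phi> \<union> F)"
begin

abbreviation "\<kappa> \<equiv> \<lambda>c. pure (log_scalar n X l c) \<one>"
abbreviation "op_emb \<equiv> \<lambda>P. pure P \<one>"
abbreviation "fun_emb \<equiv> \<lambda>f. pure (mult_op OY f) \<one>"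
abbreviation "coef_emb \<equiv> \<lambda>r. pure \<one>\<^bsub>DL\<^esub> r"

sublocale T: complex_algebra_ring T \<kappa>
  using tensor_complex_algebra tensor_ring_ring
  by (simp add: complex_algebra_ring_def complex_algebra_ring_axioms_def)

lemma op_emb_hom:
  "P \<in> carrier DL \<Longrightarrow> op_emb P \<in> carrier T"
  "\<lbrakk>P \<in> carrier DL; Q \<in> carrier DL\<rbrakk> \<Longrightarrow> op_emb (P \<oplus>\<^bsub>OY.E\<^esub> Q) = op_emb P \<oplus>\<^bsub>T\<^esub> op_emb Q"
  "\<lbrakk>P \<in> carrier DL; Q \<in> carrier DL\<rbrakk> \<Longrightarrow> op_emb (P \<otimes>\<^bsub>OY.E\<^esub> Q) = op_emb P \<otimes>\<^bsub>T\<^esub> op_emb Q"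
  "op_emb \<zero>\<^bsub>OY.E\<^esub> = \<zero>\<^bsub>T\<^esub>"
  using ring_hom_closed[OF left_hom] ring_hom_add[OF left_hom] ring_hom_mult[OF left_hom]
    ring_hom_zero[OF left_hom DL.ring_axioms T.ring_axioms]
  by (simp_all add: DL_ops)

lemma fun_emb_hom:
  "f \<in> carrier OY \<Longrightarrow> fun_emb f \<in> carrier T"
  "\<lbrakk>f \<in> carrier OY; g \<in> carrier OY\<rbrakk> \<Longrightarrow> fun_emb (f \<oplus>\<^bsub>OY\<^esub> g) = fun_emb f \<oplus>\<^bsub>T\<^esub> fun_emb g"
  "\<lbrakk>f \<in> carrier OY; g \<in> carrier OY\<rbrakk> \<Longrightarrow> fun_emb (f \<otimes>\<^bsub>OY\<^esub> g) = fun_emb f \<otimes>\<^bsub>T\<^esub> fun_emb g"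
  "fun_emb (const_fun Y c) = \<kappa> c"
  using op_emb_hom mult_op_DL ring_hom_add[OF OY.mult_op_hom] ring_hom_mult[OF OY.mult_op_hom]
  by (simp_all add: log_scalar_def)

lemma fun_emb_commute: "f \<in> carrier OY \<Longrightarrow> g \<in> carrier OY \<Longrightarrow> fun_emb f \<otimes>\<^bsub>T\<^esub> fun_emb g = fun_emb g \<otimes>\<^bsub>T\<^esub> fun_emb f"
  using fun_emb_hom(3)[of f g] fun_emb_hom(3)[of g f] OY.m_comm by simp

lemma coef_emb_commute: "P \<in> carrier DL \<Longrightarrow> r \<in> carrier R \<Longrightarrow> op_emb P \<otimes>\<^bsub>T\<^esub> coef_emb r = coef_emb r \<otimes>\<^bsub>T\<^esub> op_emb P"
  using pure_factor[of P r] by simp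

lemma coef_emb_closed: "r \<in> carrier R \<Longrightarrow> coef_emb r \<in> carrier T"
  by (rule ring_hom_closed[OF right_hom])

lemma derivation_function_commute:
  assumes "\<delta> \<in> derivations OY (const_fun Y)" "\<delta> \<in> carrier DL" "f \<in> carrier OY"
  shows "op_emb \<delta> \<otimes>\<^bsub>T\<^esub> fun_emb f = fun_emb f \<otimes>\<^bsub>T\<^esub> op_emb \<delta> \<oplus>\<^bsub>T\<^esub> fun_emb (\<delta> f)"
proof -
  have "op_emb \<delta> \<otimes>\<^bsub>T\<^esub> fun_emb f = op_emb (\<delta> \<otimes>\<^bsub>OY.E\<^esub> mult_op OY f)"
    using op_emb_hom(3)[OF assms(2) mult_op_DL[OF assms(3)]] by simp
  also have "\<dots> = op_emb (mult_op OY f \<otimes>\<^bsub>OY.E\<^esub> \<delta> \<oplus>\<^bsub>OY.E\<^esub> mult_op OY (\<delta> f))"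
    using OY.derivation_commutes_mult_op[OF assms(1,3)] by simp
  also have "\<dots> = fun_emb f \<otimes>\<^bsub>T\<^esub> op_emb \<delta> \<oplus>\<^bsub>T\<^esub> fun_emb (\<delta> f)"
  proof -
    have "mult_op OY f \<otimes>\<^bsub>OY.E\<^esub> \<delta> \<in> carrier DL"
      using DL.m_closed[OF mult_op_DL[OF assms(3)] assms(2)] by (simp add: DL_ops)
    then show ?thesis
      using op_emb_hom(2)[OF _ mult_op_DL[OF OY.derivationD(3)[OF assms(1,3)]]]
        op_emb_hom(3)[OF mult_op_DL[OF assms(3)] assms(2)] by simp
  qed
  finally show ?thesis .
qed

definition B :: "'r log_elem set" where
  "B = fun_emb ` coords \<union> coef_emb ` F"

text \<open>The subalgebra of functions on the product with coefficients in \<open>R\<close>.\<close>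

definition Z :: "'r log_elem set" where
  "Z = generate_ring T (range \<kappa> \<union> B)"

lemma B_closed: "B \<subseteq> carrier T"
proof -
  have "fun_emb b \<in> carrier T" if "b \<in> coords" for b using that coords_closed fun_emb_hom(1) by blast
  then show ?thesis using F(2) coef_emb_closed unfolding B_def by blast
qed

lemma Z_subring: "subring Z T"
  unfolding Z_def by (rule T.generate_ring_is_subring) (use B_closed in auto)

lemma Z_closed:
  "a \<in> Z \<Longrightarrow> a \<in> carrier T" "\<kappa> c \<in> Z" "b \<in> B \<Longrightarrow> b \<in> Z" "\<zero>\<^bsub>T\<^esub> \<in> Z" "\<one>\<^bsub>T\<^esub> \<in> Z"
  "\<lbrakk>a \<in> Z; b \<in> Z\<rbrakk> \<Longrightarrow> a \<oplus>\<^bsub>T\<^esub> b \<in> Z" "\<lbrakk>a \<in> Z; b \<in> Z\<rbrakk> \<Longrightarrow> a \<otimes>\<^bsub>T\<^esub> b \<in> Z"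
  using subringE[OF Z_subring] by (auto simp: Z_def intro: generate_ring.incl)

lemma fun_emb_Z: "f \<in> carrier OY \<Longrightarrow> fun_emb f \<in> Z"
  by (induction rule: OY_induct)
     (auto simp: fun_emb_hom Z_closed B_def intro!: Z_closed(3))

lemma coef_emb_Z:
  assumes "r \<in> carrier R"
  shows "coef_emb r \<in> Z"
proof -
  have scalar: "coef_emb (\<phi> c \<otimes>\<^bsub>R\<^esub> r) = \<kappa> c \<otimes>\<^bsub>T\<^esub> coef_emb r" if "r \<in> carrier R" for c r
  proof -
    have "coef_emb (\<phi> c \<otimes>\<^bsub>R\<^esub> r) = pure (log_scalar n X l c \<otimes>\<^bsub>DL\<^esub> \<one>\<^bsub>DL\<^esub>) r"
      using pure_scalar[OF DL.one_closed that] by simp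
    also have "\<dots> = \<kappa> c \<otimes>\<^bsub>T\<^esub> coef_emb r"
      using pure_factor(1)[OF DL.scalar_closed that] by simp
    finally show ?thesis .
  qed
  let ?S = "{r \<in> carrier R. coef_emb r \<in> Z}"
  have "generate_ring R (range \<phi> \<union> F) \<subseteq> ?S"
  proof (rule B.generate_ring_subset)
    have one: "coef_emb \<one>\<^bsub>R\<^esub> \<in> Z" using pure_one Z_closed(5) by simp
    show "\<one>\<^bsub>R\<^esub> \<in> ?S" using one by simp
    have "coef_emb (\<phi> c) \<in> Z" for c
      using scalar[of "\<one>\<^bsub>R\<^esub>" c] one Z_closed(2,7) by simp
    then show "range \<phi> \<union> F \<subseteq> ?S"
      using F(2) Z_closed(3) by (auto simp: B_def)
    show "B.A.csubspace ?S"
    proof (rule B.A.csubspaceI)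
      show "\<zero>\<^bsub>R\<^esub> \<in> ?S"
        using ring_hom_zero[OF right_hom B.ring_axioms T.ring_axioms] Z_closed(4) by simp
    next
      fix c r assume "r \<in> ?S"
      then show "\<phi> c \<otimes>\<^bsub>R\<^esub> r \<in> ?S"
        using scalar Z_closed(2,7) by simp
    qed (use ring_hom_add[OF right_hom] Z_closed(6) in auto)
    show "a \<otimes>\<^bsub>R\<^esub> b \<in> ?S"
      if "a \<in> ?S" "b \<in> ?S" for a b
      using that ring_hom_mult[OF right_hom] Z_closed(7) by auto
  qed
  then show ?thesis using assms R_generated by blast
qed

lemma B_cases: "b \<in> B \<Longrightarrow> (\<exists>f\<in>carrier OY. b = fun_emb f) \<or> (\<exists>r\<in>carrier R. b = coef_emb r)"
  using coords_closed F(2) unfolding B_def by blast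

lemma B_commute: "b \<in> B \<Longrightarrow> b' \<in> B \<Longrightarrow> b \<otimes>\<^bsub>T\<^esub> b' = b' \<otimes>\<^bsub>T\<^esub> b"
proof -
  have f: "fun_emb f \<otimes>\<^bsub>T\<^esub> coef_emb r = coef_emb r \<otimes>\<^bsub>T\<^esub> fun_emb f" if "f \<in> carrier OY" "r \<in> carrier R" for f r
    using coef_emb_commute mult_op_DL that by blast
  have r: "coef_emb r \<otimes>\<^bsub>T\<^esub> coef_emb s = coef_emb s \<otimes>\<^bsub>T\<^esub> coef_emb r" if "r \<in> carrier R" "s \<in> carrier R" for r s
    using that by (simp add: pure_mult R.m_comm)
  assume "b \<in> B" "b' \<in> B"
  then show ?thesis using B_cases[of b] B_cases[of b'] f r fun_emb_commute by auto
qed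

text \<open>The vector fields are extensions of finitely many generators \<open>\<Delta>\<close> of the derivations on \<open>X\<close>, together with the Euler
  operators. With \<open>\<Delta>\<close> in place of all derivations, a commutator in \<open>\<Delta>\<close> is again a combination of \<open>\<Delta>\<close> with function
  coefficients, because \<open>\<Delta>\<close> generates; commutators with Euler operators vanish.\<close>

theorem log_artin_rees:
  assumes "left_module T M" "finitely_generated_module T M" "submodule U T M"
  shows "\<exists>n\<^sub>0::nat. \<forall>k\<ge>n\<^sub>0. (\<lambda>v. (fun_emb (t_monomial m) [^]\<^bsub>T\<^esub> k) \<odot>\<^bsub>M\<^esub> v) ` carrier M \<inter> U \<subseteq>
    (\<lambda>v. (fun_emb (t_monomial m) [^]\<^bsub>T\<^esub> (k - n\<^sub>0)) \<odot>\<^bsub>M\<^esub> v) ` U"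
proof -
  obtain \<Delta> where \<Delta>: "\<Delta> \<subseteq> derX" "finite \<Delta>"
    and \<Delta>_gen: "\<And>K. \<lbrakk>\<zero>\<^bsub>OX.E\<^esub> \<in> K; \<forall>\<delta>\<in>K. \<forall>\<epsilon>\<in>K. \<delta> \<oplus>\<^bsub>OX.E\<^esub> \<epsilon> \<in> K;
      \<forall>a\<in>carrier OX. \<forall>\<delta>\<in>K. mult_op OX a \<otimes>\<^bsub>OX.E\<^esub> \<delta> \<in> K; \<Delta> \<subseteq> K\<rbrakk> \<Longrightarrow> derX \<subseteq> K"
    using OX.derivations_finitely_generated[OF OX_generated] by (metis finite_imageI finite_lessThan)
  define D where "D = op_emb ` (ext ` \<Delta> \<union> euler ` {..<l})"
  define S where "S = {b \<otimes>\<^bsub>T\<^esub> d | b d. b \<in> Z \<and> d \<in> insert \<one>\<^bsub>T\<^esub> D}"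
  have fields: "\<exists>\<delta>. d = op_emb \<delta> \<and> \<delta> \<in> derivations OY (const_fun Y) \<and> \<delta> \<in> carrier DL
      \<and> (\<delta> \<in> ext ` \<Delta> \<or> \<delta> \<in> euler ` {..<l})" if "d \<in> D" for d
    using that \<Delta>(1) ext_derivation euler_derivation DL_gens(2,4) unfolding D_def by blast
  have D_closed: "D \<subseteq> carrier T" using fields op_emb_hom(1) by blast
  have S_closed: "S \<subseteq> carrier T"
    unfolding S_def using D_closed Z_closed(1) T.m_closed T.one_closed by blast
  have lin_S: "T.A.csubspace (T.A.lin S)" by (rule T.A.csubspace_lin[OF S_closed])
  have Z_S: "a \<in> T.A.lin S" if "a \<in> Z" for a
  proof -
    have "a = a \<otimes>\<^bsub>T\<^esub> \<one>\<^bsub>T\<^esub>" using Z_closed(1)[OF that] by simp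
    then show ?thesis using that unfolding S_def by (intro T.A.lin_incl) blast
  qed
  have D_S: "d \<in> T.A.lin S" if "d \<in> D" for d
  proof -
    have "d = \<one>\<^bsub>T\<^esub> \<otimes>\<^bsub>T\<^esub> d" using that D_closed by auto
    then show ?thesis using that Z_closed(5) unfolding S_def by (intro T.A.lin_incl) blast
  qed
  have Z_mult_S: "a \<otimes>\<^bsub>T\<^esub> s \<in> T.A.lin S" if a: "a \<in> Z" and s: "s \<in> T.A.lin S" for a s
  proof (rule T.A.lin_map[where h = "\<lambda>s. a \<otimes>\<^bsub>T\<^esub> s", OF S_closed _ _ _ lin_S _ s])
    fix x assume "x \<in> S"
    then obtain b d where bd: "x = b \<otimes>\<^bsub>T\<^esub> d" "b \<in> Z" "d \<in> insert \<one>\<^bsub>T\<^esub> D" unfolding S_def by blast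
    have "d \<in> carrier T" using bd(3) D_closed by blast
    then have "a \<otimes>\<^bsub>T\<^esub> x = (a \<otimes>\<^bsub>T\<^esub> b) \<otimes>\<^bsub>T\<^esub> d"
      using bd Z_closed(1) a by (simp add: T.m_assoc)
    then show "a \<otimes>\<^bsub>T\<^esub> x \<in> T.A.lin S"
      using bd Z_closed(7)[OF a] unfolding S_def by (intro T.A.lin_incl) blast
  next
    fix c x assume "x \<in> carrier T"
    then show "a \<otimes>\<^bsub>T\<^esub> (\<kappa> c \<otimes>\<^bsub>T\<^esub> x) = \<kappa> c \<otimes>\<^bsub>T\<^esub> (a \<otimes>\<^bsub>T\<^esub> x)"
      using Z_closed(1)[OF a] T.scalar_central[of a c] by (simp flip: T.m_assoc)
  qed (use Z_closed(1)[OF a] in \<open>auto simp: T.r_distr\<close>)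
  \<comment> \<open>Every vector field of \<open>X\<close> is a combination of \<open>D\<close> with function coefficients, since such combinations form a module over the functions on \<open>X\<close>.\<close>
  have field_S: "op_emb (ext \<delta>) \<in> T.A.lin S" if "\<delta> \<in> derX" for \<delta>
  proof -
    let ?K = "{\<delta> \<in> derX. op_emb (ext \<delta>) \<in> T.A.lin S}"
    have "derX \<subseteq> ?K"
    proof (rule \<Delta>_gen)
      have "ext \<zero>\<^bsub>OX.E\<^esub> = \<zero>\<^bsub>OY.E\<^esub>"
      proof (rule OY.derivation_eqI[OF OY_generated])
        show "ext \<zero>\<^bsub>OX.E\<^esub> \<in> derivations OY (const_fun Y)" by (rule ext_derivation[OF OX.zero_derivation])
        fix b assume "b \<in> coords"
        then have "b \<in> carrier OY" using coords_closed by blast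
        then show "ext \<zero>\<^bsub>OX.E\<^esub> b = \<zero>\<^bsub>OY.E\<^esub> b"
          by (intro Y_eqI) (auto simp: ext_extensional ext_apply OY.endo_apply OX.endo_apply slice_closed
               OY_extensional OY_apply coord_apply Y_mem)
      qed (rule OY.zero_derivation)
      then show "\<zero>\<^bsub>OX.E\<^esub> \<in> ?K"
        using OX.zero_derivation op_emb_hom(4) T.A.csubspaceD(2)[OF lin_S] by simp
      show "\<forall>\<delta>\<in>?K. \<forall>\<epsilon>\<in>?K.
          \<delta> \<oplus>\<^bsub>OX.E\<^esub> \<epsilon> \<in> ?K"
        using OX.derivation_combination(1) ext_hom(1)[OF OX.derivationD(1) OX.derivationD(1)]
          op_emb_hom(2)[OF DL_gens(2) DL_gens(2)] T.A.csubspaceD(3)[OF lin_S] by simp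
      show "\<forall>a\<in>carrier OX. \<forall>\<delta>\<in>?K.
          mult_op OX a \<otimes>\<^bsub>OX.E\<^esub> \<delta> \<in> ?K"
      proof (intro ballI)
        fix a \<delta> assume a: "a \<in> carrier OX" and "\<delta> \<in> ?K"
        then have \<delta>: "\<delta> \<in> derX" "op_emb (ext \<delta>) \<in> T.A.lin S" by auto
        have "ext (mult_op OX a \<otimes>\<^bsub>OX.E\<^esub> \<delta>) = mult_op OY (pull a) \<otimes>\<^bsub>OY.E\<^esub> ext \<delta>"
          using ext_hom(2)[OF OX.mult_op_closed[OF a] OX.derivationD(1)[OF \<delta>(1)]
              OY.derivationD(1)[OF ext_derivation[OF \<delta>(1)]]] ext_mult_op[OF a] by simp
        then have "op_emb (ext (mult_op OX a \<otimes>\<^bsub>OX.E\<^esub> \<delta>)) = fun_emb (pull a) \<otimes>\<^bsub>T\<^esub> op_emb (ext \<delta>)"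
          using op_emb_hom(3)[OF mult_op_DL[OF pull_closed[OF a]] DL_gens(2)[OF \<delta>(1)]] by simp
        then show "mult_op OX a \<otimes>\<^bsub>OX.E\<^esub> \<delta> \<in> ?K"
          using OX.derivation_combination(2)[OF \<delta>(1) \<delta>(1) a] Z_mult_S[OF fun_emb_Z[OF pull_closed[OF a]] \<delta>(2)]
          by simp
      qed
      show "\<Delta> \<subseteq> ?K"
        using \<Delta>(1) D_S unfolding D_def by blast
    qed
    then show ?thesis using that by blast
  qed
  have bracket_S: "\<exists>c\<in>T.A.lin S. op_emb \<delta> \<otimes>\<^bsub>T\<^esub> op_emb \<epsilon> = op_emb \<epsilon> \<otimes>\<^bsub>T\<^esub> op_emb \<delta> \<oplus>\<^bsub>T\<^esub> c"
    if "\<delta> \<in> ext ` \<Delta> \<or> \<delta> \<in> euler ` {..<l}" "\<epsilon> \<in> ext ` \<Delta> \<or> \<epsilon> \<in> euler ` {..<l}"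
      "\<delta> \<in> derivations OY (const_fun Y)" "\<epsilon> \<in> derivations OY (const_fun Y)"
      "\<delta> \<in> carrier DL" "\<epsilon> \<in> carrier DL" for \<delta> \<epsilon>
  proof -
    note kinds = that(1,2)
    \<comment> \<open>The commutator is zero if an Euler operator is involved, and otherwise extends a commutator on \<open>X\<close>.\<close>
    have br: "OY.bracket \<delta> \<epsilon> \<in> carrier DL \<and> op_emb (OY.bracket \<delta> \<epsilon>) \<in> T.A.lin S"
    proof -
      consider \<delta>' \<epsilon>' where "\<delta> = ext \<delta>'" "\<epsilon> = ext \<epsilon>'" "\<delta>' \<in> derX" "\<epsilon>' \<in> derX"
        | "OY.bracket \<delta> \<epsilon> = \<zero>\<^bsub>OY.E\<^esub>"
        using kinds \<Delta>(1) euler_brackets by blast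
      then show ?thesis
      proof cases
        case 1
        then show ?thesis
          using ext_bracket[OF 1(3,4)] OX.bracket_derivation[OF 1(3,4)] field_S DL_gens(2) by simp
      next
        case 2
        then show ?thesis
          using op_emb_hom(4) T.A.csubspaceD(2)[OF lin_S] DL.zero_closed by (simp add: DL_ops)
      qed
    qed
    have "op_emb \<delta> \<otimes>\<^bsub>T\<^esub> op_emb \<epsilon> = op_emb (\<epsilon> \<otimes>\<^bsub>OY.E\<^esub> \<delta> \<oplus>\<^bsub>OY.E\<^esub> OY.bracket \<delta> \<epsilon>)"
      using op_emb_hom(3)[OF that(5,6)]
        OY.bracket_endo(2)[OF OY.derivationD(1)[OF that(3)] OY.derivationD(1)[OF that(4)]] by simp
    also have "\<dots> = op_emb \<epsilon> \<otimes>\<^bsub>T\<^esub> op_emb \<delta> \<oplus>\<^bsub>T\<^esub> op_emb (OY.bracket \<delta> \<epsilon>)"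
    proof -
      have "\<epsilon> \<otimes>\<^bsub>OY.E\<^esub> \<delta> \<in> carrier DL" using DL.m_closed[OF that(6,5)] by (simp add: DL_ops)
      then show ?thesis using br op_emb_hom(2) op_emb_hom(3)[OF that(6,5)] by simp
    qed
    finally show ?thesis using br by blast
  qed
  interpret filtered_generators T \<kappa> B D
  proof unfold_locales
    show "finite B" unfolding B_def using F(1) by simp
    show "finite D" unfolding D_def using \<Delta>(2) by simp
    show "B \<subseteq> carrier T" by (rule B_closed)
    show "D \<subseteq> carrier T" by (rule D_closed)
    show "b \<otimes>\<^bsub>T\<^esub> b' = b' \<otimes>\<^bsub>T\<^esub> b" if "b \<in> B" "b' \<in> B" for b b' by (rule B_commute[OF that])
  next
    fix d b assume "d \<in> D" "b \<in> B"
    then obtain \<delta> where \<delta>: "d = op_emb \<delta>" "\<delta> \<in> derivations OY (const_fun Y)" "\<delta> \<in> carrier DL"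
      using fields by blast
    consider f where "f \<in> carrier OY" "b = fun_emb f" | r where "r \<in> carrier R" "b = coef_emb r"
      using B_cases[OF \<open>b \<in> B\<close>] by blast
    then have "\<exists>c\<in>Z. d \<otimes>\<^bsub>T\<^esub> b = b \<otimes>\<^bsub>T\<^esub> d \<oplus>\<^bsub>T\<^esub> c"
    proof cases
      case 1
      have "fun_emb (\<delta> f) \<in> Z" by (rule fun_emb_Z[OF OY.derivationD(3)[OF \<delta>(2) 1(1)]])
      then show ?thesis using derivation_function_commute[OF \<delta>(2,3) 1(1)] \<delta>(1) 1(2) by blast
    next
      case 2
      have "b \<otimes>\<^bsub>T\<^esub> d \<in> carrier T"
        using \<delta>(1,3) 2 op_emb_hom(1) coef_emb_closed by simp
      then have "d \<otimes>\<^bsub>T\<^esub> b = b \<otimes>\<^bsub>T\<^esub> d \<oplus>\<^bsub>T\<^esub> \<zero>\<^bsub>T\<^esub>"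
        using coef_emb_commute[OF \<delta>(3) 2(1)] \<delta>(1) 2(2) by simp
      then show ?thesis using Z_closed(4) by blast
    qed
    then show "\<exists>c\<in>generate_ring T (range \<kappa> \<union> B). d \<otimes>\<^bsub>T\<^esub> b = b \<otimes>\<^bsub>T\<^esub> d \<oplus>\<^bsub>T\<^esub> c"
      unfolding Z_def .
  next
    fix d d' assume dd: "d \<in> D" "d' \<in> D"
    obtain \<delta> where \<delta>: "d = op_emb \<delta>" "\<delta> \<in> derivations OY (const_fun Y)" "\<delta> \<in> carrier DL"
      "\<delta> \<in> ext ` \<Delta> \<or> \<delta> \<in> euler ` {..<l}"
      using fields[OF dd(1)] by blast
    obtain \<epsilon> where \<epsilon>: "d' = op_emb \<epsilon>" "\<epsilon> \<in> derivations OY (const_fun Y)" "\<epsilon> \<in> carrier DL"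
      "\<epsilon> \<in> ext ` \<Delta> \<or> \<epsilon> \<in> euler ` {..<l}"
      using fields[OF dd(2)] by blast
    show "\<exists>c\<in>T.A.lin {b \<otimes>\<^bsub>T\<^esub> d | b d. b \<in> generate_ring T (range \<kappa> \<union> B) \<and> d \<in> insert \<one>\<^bsub>T\<^esub> D}.
        d \<otimes>\<^bsub>T\<^esub> d' = d' \<otimes>\<^bsub>T\<^esub> d \<oplus>\<^bsub>T\<^esub> c"
      using bracket_S[OF \<delta>(4) \<epsilon>(4) \<delta>(2) \<epsilon>(2) \<delta>(3) \<epsilon>(3)] unfolding S_def Z_def \<delta>(1) \<epsilon>(1) .
  next
    have gens: "range \<kappa> \<union> B \<union> D \<subseteq> carrier T"
      by (intro Un_least B_closed D_closed image_subsetI T.scalar_closed)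
    define W where "W = generate_ring T (range \<kappa> \<union> B \<union> D)"
    have W: "subring W T" unfolding W_def by (rule T.generate_ring_is_subring[OF gens])
    have W_space: "T.A.csubspace W"
    proof (rule T.A.csubspaceI)
      fix c x assume "x \<in> W"
      moreover have "\<kappa> c \<in> W" unfolding W_def by (rule generate_ring.incl) blast
      ultimately show "\<kappa> c \<otimes>\<^bsub>T\<^esub> x \<in> W" by (intro subringE(6)[OF W])
    qed (rule subringE(1,2,7)[OF W]; assumption)+
    have Z_W: "Z \<subseteq> W"
      unfolding Z_def
    proof (rule T.generate_ring_min_subring1[OF _ W])
      show "range \<kappa> \<union> B \<subseteq> carrier T" using gens by blast
      show "range \<kappa> \<union> B \<subseteq> W" unfolding W_def by (blast intro: generate_ring.incl)
    qed
    have D_W: "D \<subseteq> W" unfolding W_def by (blast intro: generate_ring.incl)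
    have S_W: "T.A.lin S \<subseteq> W"
      by (rule T.A.lin_least[OF W_space]) (use Z_W D_W subringE(3,6)[OF W] in \<open>auto simp: S_def\<close>)
    have op_W: "op_emb P \<in> W" if "P \<in> carrier DL" for P
    proof -
      let ?S = "{P \<in> carrier DL. op_emb P \<in> W}"
      have "P \<in> ?S"
      proof (rule DL_induct[OF that])
        show "euler j \<in> ?S" if "j < l" for j
          using that D_W DL_gens(4) unfolding D_def by auto
        show "ext \<delta> \<in> ?S" if "\<delta> \<in> derX" for \<delta>
          using that field_S S_W DL_gens(2) by auto
        show "mult_op OY f \<in> ?S" if "f \<in> carrier OY" for f
          using fun_emb_Z[OF that] Z_W mult_op_DL[OF that] by auto
        fix Q Q' assume "Q \<in> ?S" "Q' \<in> ?S"
        then show "Q \<oplus>\<^bsub>OY.E\<^esub> Q' \<in> ?S" "Q \<otimes>\<^bsub>OY.E\<^esub> Q' \<in> ?S"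
          using DL.a_closed[of Q Q'] DL.m_closed[of Q Q'] op_emb_hom(2,3) subringE(6,7)[OF W]
          by (simp_all add: DL_ops)
      qed auto
      then show ?thesis by blast
    qed
    have "x \<in> W" if "x \<in> carrier T" for x
    proof (rule tensor_induct[OF that])
      show "pure P r \<in> W" if "P \<in> carrier DL" "r \<in> carrier R" for P r
        using pure_factor(1)[OF that] op_W[OF that(1)] coef_emb_Z[OF that(2)] Z_W subringE(6)[OF W] by auto
    qed (use T.A.csubspace_diff[OF W_space] T.A.csubspaceD(2)[OF W_space] in auto)
    then show "carrier T = generate_ring T (range \<kappa> \<union> B \<union> D)"
      using subringE(1)[OF W] unfolding W_def by blast
  qed
  let ?\<alpha> = "fun_emb (t_monomial m)"
  have \<alpha>: "?\<alpha> \<in> carrier T" by (rule fun_emb_hom(1)[OF t_monomial_closed])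
  have "b \<otimes>\<^bsub>T\<^esub> ?\<alpha> = ?\<alpha> \<otimes>\<^bsub>T\<^esub> b" if "b \<in> B" for b
    using B_cases[OF that]
  proof (elim disjE bexE)
    fix f assume f: "f \<in> carrier OY" "b = fun_emb f"
    show ?thesis unfolding f(2) by (rule fun_emb_commute[OF f(1) t_monomial_closed])
  next
    fix r assume r: "r \<in> carrier R" "b = coef_emb r"
    show ?thesis unfolding r(2) by (rule coef_emb_commute[OF mult_op_DL[OF t_monomial_closed] r(1), symmetric])
  qed
  moreover have "\<exists>e. d \<otimes>\<^bsub>T\<^esub> ?\<alpha> = ?\<alpha> \<otimes>\<^bsub>T\<^esub> d \<oplus>\<^bsub>T\<^esub> \<kappa> e \<otimes>\<^bsub>T\<^esub> ?\<alpha>" if d: "d \<in> D" for d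
  proof -
    obtain \<delta> where \<delta>: "d = op_emb \<delta>" "\<delta> \<in> derivations OY (const_fun Y)" "\<delta> \<in> carrier DL"
      "\<delta> \<in> ext ` \<Delta> \<or> \<delta> \<in> euler ` {..<l}"
      using fields[OF d] by blast
    have "\<exists>e. \<delta> (t_monomial m) = const_fun Y e \<otimes>\<^bsub>OY\<^esub> t_monomial m"
      using \<delta>(4)
    proof
      assume "\<delta> \<in> ext ` \<Delta>"
      then show ?thesis
        using subsetD[OF \<Delta>(1)] OY.scalar_zero t_monomial_closed
        by (intro exI[of _ 0]) (auto simp: ext_t_monomial)
    next
      assume "\<delta> \<in> euler ` {..<l}"
      then show ?thesis using euler_t_monomial by blast
    qed
    then obtain e where "\<delta> (t_monomial m) = const_fun Y e \<otimes>\<^bsub>OY\<^esub> t_monomial m" by blast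
    then have "fun_emb (\<delta> (t_monomial m)) = \<kappa> e \<otimes>\<^bsub>T\<^esub> ?\<alpha>"
      using fun_emb_hom(3)[OF OY_const t_monomial_closed] fun_emb_hom(4) by simp
    then show ?thesis
      using derivation_function_commute[OF \<delta>(2,3) t_monomial_closed] \<delta>(1) by metis
  qed
  ultimately show ?thesis by (rule artin_rees_eigenelement[OF assms \<alpha>])
qed

end

theorem theorem5p14:
  fixes n l :: nat
    and X :: "(nat \<Rightarrow> complex) set"
    and R :: "('r, 'y) ring_scheme"
    and \<phi> :: "complex \<Rightarrow> 'r"
    and m :: "nat \<Rightarrow> nat"
    and M :: "('r log_elem, 'v, 'z) module_scheme"
    and N :: "'v set"
  assumes "irreducible_affine_variety n X"
    and "smooth_variety n X"
    and "domain R"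
    and "complex_algebra R \<phi>"
    and "finite_type R \<phi>"
    and "regular_ring R"
    and "left_module (log_ring n X l R \<phi>) M"
    and "finitely_generated_module (log_ring n X l R \<phi>) M"
    and "submodule N (log_ring n X l R \<phi>) M"
  shows "\<exists>n\<^sub>0::nat. \<forall>k\<ge>n\<^sub>0.
    (\<lambda>v. (log_monomial n X l R \<phi> m [^]\<^bsub>log_ring n X l R \<phi>\<^esub> k) \<odot>\<^bsub>M\<^esub> v) ` carrier M \<inter> N \<subseteq>
    (\<lambda>v. (log_monomial n X l R \<phi> m [^]\<^bsub>log_ring n X l R \<phi>\<^esub> (k - n\<^sub>0)) \<odot>\<^bsub>M\<^esub> v) ` N"
proof -
  obtain F where F: "F \<subseteq> carrier R" "finite F" "carrier R = generate_ring R (range \<phi> \<union> F)"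
    using assms(5) unfolding finite_type_def by blast
  interpret V: product_variety n l X .
  have "cring R" using assms(3) by (simp add: domain_def)
  moreover have "complex_algebra_ring R \<phi>"
    using assms(4) by (simp add: complex_algebra_ring_def complex_algebra_ring_axioms_def complex_algebra_def)
  ultimately interpret log_operators n l X R \<phi> F
    using F V.DL.complex_algebra_ring_axioms
    by (simp add: log_operators_def log_operators_axioms_def tensor_product_def)
  have "log_monomial n X l R \<phi> m = fun_emb (V.t_monomial m)"
    by (simp add: log_monomial_def V.t_monomial_def)
  then show ?thesis
    using log_artin_rees[of M N m] assms(7-9) unfolding log_ring_def by simp
qed

end
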